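(* For all $x,y>0$ and all $\alpha,\nu\in\mathbb{C}$, \[ W_{\alpha,\nu}(x)\,W_{\alpha,\nu}(y)=\int_0^\infty W_{\alpha,\nu}(\xi)\,k_\alpha(x,y,\xi)\,\frac{d\xi}{\xi^2}, \] where \[ k_\alpha(x,y,\xi):=2^{-1-\alpha}\pi^{-1/2}(xy\xi)^{1/2}\exp\!\Big(\frac{x}{2}+\frac{y}{2}+\frac{\xi}{2}-\frac{(xy+x\xi+y\xi)^2}{8xy\xi}\Big)\,D_{2\alpha}\!\Big(\frac{xy+x\xi+y\xi}{(2xy\xi)^{1/2}}\Big). \]
   Context: $W_{\kappa,\mu}(x)$ denotes the Whittaker function of the second kind: the solution of Whittaker's equation $u''+\big(-\tfrac14+\tfrac{\kappa}{x}+\tfrac{1/4-\mu^2}{x^2}\big)u=0$ uniquely determined by $W_{\kappa,\mu}(x)\sim x^{\kappa}e^{-x/2}$ as $x\to\infty$. $D_\mu(z)$ denotes the parabolic cylinder function, $D_\mu(z)=2^{\mu/2+1/4}z^{-1/2}W_{\mu/2+1/4,\,1/4}(z^2/2)$. *)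

theory Defs
  imports "HOL-Analysis.Analysis"
begin

definition whittaker_solution :: "complex \<Rightarrow> complex \<Rightarrow> (real \<Rightarrow> complex) \<Rightarrow> bool" where
  "whittaker_solution kappa mu u \<longleftrightarrow>
     (\<exists>u'. \<forall>x>0. (u has_vector_derivative u' x) (at x) \<and>
        (u' has_vector_derivative
           (- ((-1/4 + kappa / complex_of_real x + (1/4 - mu^2) / (complex_of_real x)^2) * u x))) (at x))"

text \<open>Whittaker function of the second kind: the solution with
  W(x) ~ x^kappa e^(-x/2) as x tends to infinity (values for x \<le> 0 are fixed to 0,
  only x > 0 is meaningful).\<close>
definition whittakerW :: "complex \<Rightarrow> complex \<Rightarrow> real \<Rightarrow> complex" where
  "whittakerW kappa mu = (THE u. whittaker_solution kappa mu u \<and>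
      ((\<lambda>x. u x / (complex_of_real x powr kappa * exp (- complex_of_real x / 2))) \<longlongrightarrow> 1) at_top \<and>
      (\<forall>x\<le>0. u x = 0))"

text \<open>Parabolic cylinder function D_mu(z) for real z > 0.\<close>
definition parabolicD :: "complex \<Rightarrow> real \<Rightarrow> complex" where
  "parabolicD mu z = 2 powr (mu/2 + 1/4) * complex_of_real z powr (-1/2)
       * whittakerW (mu/2 + 1/4) (1/4) (z^2 / 2)"

definition kernel_k :: "complex \<Rightarrow> real \<Rightarrow> real \<Rightarrow> real \<Rightarrow> complex" where
  "kernel_k alpha x y \<xi> =
     2 powr (-1 - alpha) * complex_of_real (1 / sqrt pi) * complex_of_real (sqrt (x*y*\<xi>))
     * complex_of_real (exp (x/2 + y/2 + \<xi>/2 - (x*y + x*\<xi> + y*\<xi>)^2 / (8*x*y*\<xi>)))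
     * parabolicD (2*alpha) ((x*y + x*\<xi> + y*\<xi>) / sqrt (2*x*y*\<xi>))"

end

theory Submission
  imports Defs "HOL-Real_Asymp.Real_Asymp" "HOL-Probability.Distributions"
begin

text \<open>
  As a function of one argument, the kernel \<open>k\<^sub>\<alpha>\<close> (which is symmetric in its three arguments) satisfies
  \<open>L\<^sub>x k\<^sub>\<alpha> = L\<^sub>\<xi> k\<^sub>\<alpha>\<close> for \<open>L\<^sub>x = x\<^sup>2 \<partial>\<^sub>x\<^sup>2 - x\<^sup>2/4 + \<alpha> x\<close>, and Whittaker's equation says \<open>L W = (\<nu>\<^sup>2 - 1/4) W\<close>.
  Since \<open>L\<close> is symmetric with respect to \<open>d\<xi>/\<xi>\<^sup>2\<close>, the right-hand side \<open>F(x)\<close> of the product formula solves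
  Whittaker's equation in \<open>x\<close>. Substituting \<open>\<xi> = y exp (s / sqrt x)\<close> turns \<open>F(x)\<close> into a Laplace-type integral
  concentrating at \<open>\<xi> = y\<close>, whence \<open>F(x) ~ W(y) x\<^sup>\<alpha> exp (-x/2)\<close> as \<open>x\<close> tends to infinity. The difference
  \<open>F(x) - W(y) W(x)\<close> is then a solution that is \<open>o(x\<^sup>\<alpha> exp (-x/2))\<close>, and the only such solution is 0.
  This works for all complex \<open>\<alpha>\<close>, \<open>\<nu>\<close> at once, without analytic continuation.
\<close>

section \<open>Integrals depending on a parameter\<close>

text \<open>Two obstacles shape the proof. First, \<open>whittakerW\<close> is a definite
  description, so a recessive solution has to be produced for all complex parameters before anything
  can be said about it. Tricomi's Laplace integral is used only where its integrand stays bounded at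
  0; a first-order operator raising \<open>\<kappa>\<close> by 1 reaches the remaining parameters.
  Second, every exchange of limit and integral needs a majorant on the half line, where
  \<open>W\<close> may blow up at 0 like an unknown power. The kernel decays like
  \<open>exp (- d * (t + 1/t))\<close>, so it is enough that all other factors grow more slowly than
  every such exponential. The equation shared by the two variables of the kernel comes from its
  shape: an elementary factor times a Kummer function \<open>v\<close> of one variable
  \<open>w\<close>. Applying the difference of the two operators leaves \<open>(a - b)\<close> times
  the left side of Kummer's equation for \<open>v\<close>. The constant
  \<open>sqrt y / (2 * sqrt pi)\<close> split off the kernel is the reciprocal of the Laplace limit:
  \<open>2 * sqrt pi\<close> is the mass of \<open>exp (- s^2 / 4)\<close>, and
  \<open>1 / sqrt y\<close> is what Jacobian, weight and kernel leave at the concentration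
  point.\<close>

lemma has_vector_derivative_tendsto:
  fixes f :: "real \<Rightarrow> 'a::real_normed_vector"
  shows "(f has_vector_derivative D) (at x) \<longleftrightarrow>
    ((\<lambda>y. (1 / (y - x)) *\<^sub>R (f y - f x)) \<longlongrightarrow> D) (at x)"
proof -
  have "((\<lambda>y. (1 / norm (y - x)) *\<^sub>R (f y - (f x + (y - x) *\<^sub>R D))) \<longlongrightarrow> 0) (at x) \<longleftrightarrow>
        ((\<lambda>y. (1 / (y - x)) *\<^sub>R (f y - f x) - D) \<longlongrightarrow> 0) (at x)"
  proof -
    have "norm ((1 / norm (y - x)) *\<^sub>R (f y - (f x + (y - x) *\<^sub>R D))) =
          norm ((1 / (y - x)) *\<^sub>R (f y - f x) - D)" if "y \<noteq> x" for y
    proof -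
      have "(1 / (y - x)) *\<^sub>R (f y - f x) - D = (1 / (y - x)) *\<^sub>R (f y - (f x + (y - x) *\<^sub>R D))"
        using that by (simp add: scaleR_diff_right scaleR_add_right)
      then show ?thesis by simp
    qed
    then have "((\<lambda>y. norm ((1 / norm (y - x)) *\<^sub>R (f y - (f x + (y - x) *\<^sub>R D)))) \<longlongrightarrow> 0) (at x) \<longleftrightarrow>
        ((\<lambda>y. norm ((1 / (y - x)) *\<^sub>R (f y - f x) - D)) \<longlongrightarrow> 0) (at x)"
      by (intro filterlim_cong refl) (auto simp: eventually_at_filter)
    then show ?thesis unfolding tendsto_norm_zero_iff .
  qed
  then show ?thesis
    unfolding has_vector_derivative_def has_derivative_within
    by (simp add: bounded_linear_scaleR_left flip: LIM_zero_iff[of _ D])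
qed

text \<open>The mean value inequality turns the bound \<open>g\<close> on the derivative into a
  bound on all difference quotients, so dominated convergence applies along every sequence tending
  to \<open>x0\<close>. Integrability of \<open>f' x0\<close> comes out as a conclusion, so it never
  has to be checked separately.\<close>

lemma has_vector_derivative_integral_dominated:
  fixes f :: "real \<Rightarrow> 'n::euclidean_space \<Rightarrow> 'a::euclidean_space"
  assumes x0: "a < x0" "x0 < b"
    and int: "\<And>x. a < x \<Longrightarrow> x < b \<Longrightarrow> f x integrable_on S"
    and der: "\<And>x t. a < x \<Longrightarrow> x < b \<Longrightarrow> t \<in> S \<Longrightarrow>
      ((\<lambda>x. f x t) has_vector_derivative f' x t) (at x)"
    and bnd: "\<And>x t. a < x \<Longrightarrow> x < b \<Longrightarrow> t \<in> S \<Longrightarrow> norm (f' x t) \<le> g t"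
    and g: "g integrable_on S"
  shows "f' x0 integrable_on S"
    and "((\<lambda>x. integral S (f x)) has_vector_derivative integral S (f' x0)) (at x0)"
proof -
  have key: "f' x0 integrable_on S \<and>
      (\<lambda>n. (1 / (X n - x0)) *\<^sub>R (integral S (f (X n)) - integral S (f x0))) \<longlonglongrightarrow> integral S (f' x0)"
    if X: "\<And>n. a < X n" "\<And>n. X n < b" "\<And>n. X n \<noteq> x0" "X \<longlonglongrightarrow> x0" for X :: "nat \<Rightarrow> real"
  proof -
    let ?q = "\<lambda>n t. (1 / (X n - x0)) *\<^sub>R (f (X n) t - f x0 t)"
    have qint: "?q n integrable_on S" for n
      using X x0 int by (intro integrable_cmul integrable_diff) auto
    have "norm (?q n t) \<le> g t" if t: "t \<in> S" for n t
    proof -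
      have "norm (f (X n) t - f x0 t) \<le> g t * norm (X n - x0)"
      proof (rule differentiable_bound[where S = "{a<..<b}" and f' = "\<lambda>x h. h *\<^sub>R f' x t"])
        fix x assume "x \<in> {a<..<b}"
        then show "((\<lambda>x. f x t) has_derivative (\<lambda>h. h *\<^sub>R f' x t)) (at x within {a<..<b})"
          using der[of x t] t
          by (auto simp: has_vector_derivative_def intro: has_derivative_at_withinI)
        show "onorm (\<lambda>h. h *\<^sub>R f' x t) \<le> g t"
          using bnd[of x t] t \<open>x \<in> {a<..<b}\<close>
          by (simp add: onorm_scaleR_left onorm_id)
      qed (use X x0 in auto)
      then show ?thesis using X(3)[of n] by (simp add: divide_simps)
    qed
    moreover have "(\<lambda>n. ?q n t) \<longlonglongrightarrow> f' x0 t" if t: "t \<in> S" for t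
    proof -
      have "((\<lambda>y. (1 / (y - x0)) *\<^sub>R (f y t - f x0 t)) \<longlongrightarrow> f' x0 t) (at x0)"
        using der[OF x0 t] by (simp add: has_vector_derivative_tendsto)
      moreover have "filterlim X (at x0) sequentially"
        using X by (auto simp: filterlim_at)
      ultimately show ?thesis by (rule filterlim_compose)
    qed
    ultimately have "f' x0 integrable_on S" "(\<lambda>n. integral S (?q n)) \<longlonglongrightarrow> integral S (f' x0)"
      using dominated_convergence[of ?q S g "f' x0", OF qint g] by auto
    moreover have "integral S (?q n) = (1 / (X n - x0)) *\<^sub>R (integral S (f (X n)) - integral S (f x0))" for n
      using X x0 int by (subst integral_cmul, subst integral_diff) auto
    ultimately show ?thesis by (simp only: conj_absorb simp_thms)
  qed
  \<comment> \<open>One admissible sequence is enough for integrability of \<open>f' x0\<close>. The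
    denominators start at 2, which keeps even \<open>Y 0\<close> strictly below
    \<open>b\<close>.\<close>
  define Y where "Y n = x0 + (b - x0) / real (Suc (Suc n))" for n
  have "Y \<longlonglongrightarrow> x0" unfolding Y_def by real_asymp
  moreover have "Y n < b" "Y n > x0" for n
  proof -
    have "(b - x0) / real (Suc (Suc n)) < b - x0" using x0 by (simp add: divide_simps)
    then show "Y n < b" by (simp add: Y_def)
    show "Y n > x0" using x0 by (simp add: Y_def)
  qed
  ultimately have "f' x0 integrable_on S"
    using x0(1) by (intro key[of Y, THEN conjunct1]) (auto intro: order.strict_trans simp: less_imp_neq[symmetric])
  then show "f' x0 integrable_on S" .
  show "((\<lambda>x. integral S (f x)) has_vector_derivative integral S (f' x0)) (at x0)"
    unfolding has_vector_derivative_tendsto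
  proof (subst tendsto_at_iff_sequentially, intro allI impI)
    fix X :: "nat \<Rightarrow> real"
    assume X: "\<forall>i. X i \<in> UNIV - {x0}" "X \<longlonglongrightarrow> x0"
    have "eventually (\<lambda>n. X n \<in> {a<..<b}) sequentially"
      using X(2) x0 by (intro topological_tendstoD) auto
    then obtain N where N: "\<And>n. n \<ge> N \<Longrightarrow> X n \<in> {a<..<b}"
      by (auto simp: eventually_sequentially)
    have "(\<lambda>n. (1 / (X (n + N) - x0)) *\<^sub>R (integral S (f (X (n + N))) - integral S (f x0))) \<longlonglongrightarrow> integral S (f' x0)"
      using N X LIMSEQ_ignore_initial_segment[OF X(2), of N]
      by (intro key[of "\<lambda>n. X (n + N)", THEN conjunct2]) auto
    then show "((\<lambda>y. (1 / (y - x0)) *\<^sub>R (integral S (f y) - integral S (f x0))) \<circ> X) \<longlonglongrightarrow> integral S (f' x0)"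
      unfolding o_def by (rule LIMSEQ_offset)
  qed
qed

text \<open>The fundamental theorem on \<open>[1/(n+2), n+2]\<close>, followed by dominated
  convergence for the truncated integrands. This is the form in which integration by parts without
  boundary terms is used, for Kummer's equation and for the symmetry of the Whittaker
  operator.\<close>

lemma integral_derivative_vanishing_ends:
  fixes f :: "real \<Rightarrow> 'a::euclidean_space"
  assumes der: "\<And>t. t > 0 \<Longrightarrow> (F has_vector_derivative f t) (at t)"
    and f: "f integrable_on {0<..}" "\<And>t. t > 0 \<Longrightarrow> norm (f t) \<le> g t"
    and g: "g integrable_on {0<..}"
    and lim: "(F \<longlongrightarrow> 0) (at_right 0)" "(F \<longlongrightarrow> 0) at_top"
  shows "integral {0<..} f = 0"
proof -
  define I where "I n = {1 / (real n + 2)..real n + 2}" for n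
  have Ile: "1 / (real n + 2) \<le> real n + 2" for n
    by (rule order.trans[of _ 1]) auto
  have I: "(f has_integral (F (real n + 2) - F (1 / (real n + 2)))) (I n)" for n
    unfolding I_def
  proof (rule fundamental_theorem_of_calculus[OF Ile])
    fix t assume "t \<in> {1 / (real n + 2)..real n + 2}"
    then have "1 / (real n + 2) \<le> t" by simp
    then have "t > 0" by (rule less_le_trans[rotated]) simp
    then show "(F has_vector_derivative f t) (at t within {1 / (real n + 2)..real n + 2})"
      by (rule has_vector_derivative_at_within[OF der])
  qed
  have Isub: "I n \<subseteq> {0<..}" for n
  proof
    fix t assume "t \<in> I n"
    then have "1 / (real n + 2) \<le> t" by (simp add: I_def)
    then have "t > 0" by (rule less_le_trans[rotated]) simp
    then show "t \<in> {0<..}" by simp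
  qed
  let ?h = "\<lambda>n t. if t \<in> I n then f t else 0"
  have h: "(?h n has_integral (F (real n + 2) - F (1 / (real n + 2)))) {0<..}" for n
    using I[of n] by (subst has_integral_restrict[OF Isub]) auto
  have "(\<lambda>n. integral {0<..} (?h n)) \<longlonglongrightarrow> integral {0<..} f"
  proof (rule dominated_convergence(2)[of _ _ g])
    show "?h n integrable_on {0<..}" for n using h by blast
    show "g integrable_on {0<..}" by fact
    show "norm (?h n t) \<le> g t" if "t \<in> {0<..}" for n t
      using f(2)[of t] that order.trans[OF norm_ge_zero f(2)[of t]] by auto
    show "(\<lambda>n. ?h n t) \<longlonglongrightarrow> f t" if t: "t \<in> {0<..}" for t
    proof (rule tendsto_eventually)
      have "eventually (\<lambda>n. 1 / (real n + 2) \<le> t) sequentially"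
        using t by simp real_asymp
      moreover have "eventually (\<lambda>n. t \<le> real n + 2) sequentially" by real_asymp
      ultimately show "eventually (\<lambda>n. ?h n t = f t) sequentially"
        by eventually_elim (auto simp: I_def)
    qed
  qed
  moreover have "integral {0<..} (?h n) = F (real n + 2) - F (1 / (real n + 2))" for n
    using h by (rule integral_unique)
  moreover have "(\<lambda>n. F (real n + 2) - F (1 / (real n + 2))) \<longlonglongrightarrow> 0 - 0"
  proof (rule tendsto_diff)
    show "(\<lambda>n. F (real n + 2)) \<longlonglongrightarrow> 0"
      by (rule filterlim_compose[OF lim(2)]) real_asymp
    show "(\<lambda>n. F (1 / (real n + 2))) \<longlonglongrightarrow> 0"
      by (rule filterlim_compose[OF lim(1)]) real_asymp
  qed
  ultimately show ?thesis by (simp add: LIMSEQ_unique)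
qed

lemma continuous_on_has_vector_derivative:
  assumes "\<And>x. x \<in> S \<Longrightarrow> (f has_vector_derivative f' x) (at x)"
  shows "continuous_on S f"
  using assms has_vector_derivative_continuous continuous_at_imp_continuous_on by blast

lemma continuous_bounded_by_integrable_imp_integrable:
  fixes f :: "real \<Rightarrow> 'b::euclidean_space"
  assumes "continuous_on S f" "open S" "g integrable_on S" "\<And>t. t \<in> S \<Longrightarrow> norm (f t) \<le> g t"
  shows "f absolutely_integrable_on S"
  using assms by (intro measurable_bounded_by_integrable_imp_absolutely_integrable[where g=g]
      continuous_imp_measurable_on_sets_lebesgue) auto

section \<open>Subexponential growth on the half line\<close>

text \<open>Growth control at both ends of the half line, uniformly in a parameter. Unlike polynomial bounds
  this class needs no bookkeeping of exponents, and any kernel factor \<open>exp (-\<delta> (t + 1/t))\<close> absorbs it.\<close>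

definition subexp :: "'a set \<Rightarrow> ('a \<Rightarrow> real \<Rightarrow> complex) \<Rightarrow> bool" where
  "subexp A f \<longleftrightarrow> (\<forall>e>0. \<exists>C. \<forall>a\<in>A. \<forall>t>0. norm (f a t) \<le> C * exp (e * (t + 1/t)))"

lemma subexpD:
  assumes "subexp A f" "e > 0"
  obtains C where "C > 0" "\<And>a t. a \<in> A \<Longrightarrow> t > 0 \<Longrightarrow> norm (f a t) \<le> C * exp (e * (t + 1/t))"
proof -
  obtain C where C: "\<forall>a\<in>A. \<forall>t>0. norm (f a t) \<le> C * exp (e * (t + 1/t))"
    using assms unfolding subexp_def by blast
  have "norm (f a t) \<le> (\<bar>C\<bar> + 1) * exp (e * (t + 1/t))" if "a \<in> A" "t > 0" for a t
  proof -
    have "C * exp (e * (t + 1/t)) \<le> (\<bar>C\<bar> + 1) * exp (e * (t + 1/t))"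
      by (intro mult_right_mono) auto
    then show ?thesis using C that order.trans by blast
  qed
  then show ?thesis by (intro that[of "\<bar>C\<bar> + 1"]) auto
qed

lemma subexpI:
  assumes "\<And>e. e > 0 \<Longrightarrow> \<exists>C. \<forall>a\<in>A. \<forall>t>0. norm (f a t) \<le> C * exp (e * (t + 1/t))"
  shows "subexp A f"
  using assms by (auto simp: subexp_def)

named_theorems subexp_intros

lemma subexp_add [subexp_intros]:
  assumes "subexp A f" "subexp A g"
  shows "subexp A (\<lambda>a t. f a t + g a t)"
proof (rule subexpI)
  fix e :: real assume "e > 0"
  obtain C where C: "\<And>a t. a \<in> A \<Longrightarrow> t > 0 \<Longrightarrow> norm (f a t) \<le> C * exp (e * (t + 1/t))"
    using subexpD[OF assms(1) \<open>e > 0\<close>] by metis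
  obtain D where D: "\<And>a t. a \<in> A \<Longrightarrow> t > 0 \<Longrightarrow> norm (g a t) \<le> D * exp (e * (t + 1/t))"
    using subexpD[OF assms(2) \<open>e > 0\<close>] by metis
  have "norm (f a t + g a t) \<le> (C + D) * exp (e * (t + 1/t))" if "a \<in> A" "t > 0" for a t
    using norm_triangle_ineq[of "f a t" "g a t"] C[OF that] D[OF that]
    unfolding distrib_right by linarith
  then show "\<exists>C. \<forall>a\<in>A. \<forall>t>0. norm (f a t + g a t) \<le> C * exp (e * (t + 1/t))" by blast
qed

text \<open>Products stay in the class because the rate is arbitrary: each factor is given half of
  it.\<close>

lemma subexp_mult [subexp_intros]:
  assumes "subexp A f" "subexp A g"
  shows "subexp A (\<lambda>a t. f a t * g a t)"
proof (rule subexpI)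
  fix e :: real assume e: "e > 0"
  then have e2: "e / 2 > 0" by simp
  obtain C where C: "C > 0" "\<And>a t. a \<in> A \<Longrightarrow> t > 0 \<Longrightarrow> norm (f a t) \<le> C * exp (e / 2 * (t + 1/t))"
    using subexpD[OF assms(1) e2] by metis
  obtain D where D: "\<And>a t. a \<in> A \<Longrightarrow> t > 0 \<Longrightarrow> norm (g a t) \<le> D * exp (e / 2 * (t + 1/t))"
    using subexpD[OF assms(2) e2] by metis
  have "norm (f a t * g a t) \<le> (C * D) * exp (e * (t + 1/t))" if "a \<in> A" "t > 0" for a t
  proof -
    have "norm (f a t * g a t) \<le> (C * exp (e / 2 * (t + 1/t))) * (D * exp (e / 2 * (t + 1/t)))"
      unfolding norm_mult using C(2)[OF that] D[OF that] C(1) by (intro mult_mono) auto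
    also have "\<dots> = C * D * (exp (e / 2 * (t + 1/t)) * exp (e / 2 * (t + 1/t)))" by simp
    also have "exp (e / 2 * (t + 1/t)) * exp (e / 2 * (t + 1/t)) = exp (e * (t + 1/t))"
      unfolding exp_add [symmetric] by (simp add: algebra_simps)
    finally show ?thesis .
  qed
  then show "\<exists>C. \<forall>a\<in>A. \<forall>t>0. norm (f a t * g a t) \<le> C * exp (e * (t + 1/t))" by blast
qed

lemma subexp_bound:
  assumes "subexp A g" "\<And>a t. a \<in> A \<Longrightarrow> t > 0 \<Longrightarrow> norm (f a t) \<le> norm (g a t)"
  shows "subexp A f"
  using assms unfolding subexp_def by (meson order.trans)

lemma subexp_bounded:
  assumes "\<And>a t. a \<in> A \<Longrightarrow> t > 0 \<Longrightarrow> norm (f a t) \<le> C"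
  shows "subexp A f"
proof (rule subexpI)
  fix e :: real assume e: "e > 0"
  have "norm (f a t) \<le> \<bar>C\<bar> * exp (e * (t + 1/t))" if "a \<in> A" "t > 0" for a t
  proof -
    have "norm (f a t) \<le> \<bar>C\<bar> * 1" using assms[OF that] by simp
    also have "\<dots> \<le> \<bar>C\<bar> * exp (e * (t + 1/t))" using that e by (intro mult_left_mono) auto
    finally show ?thesis .
  qed
  then show "\<exists>C. \<forall>a\<in>A. \<forall>t>0. norm (f a t) \<le> C * exp (e * (t + 1/t))" by blast
qed

lemma subexp_const [subexp_intros]: "subexp A (\<lambda>a t. c)"
  by (rule subexp_bounded[of _ _ "norm c"]) auto

lemma subexp_uminus [subexp_intros]: "subexp A f \<Longrightarrow> subexp A (\<lambda>a t. - f a t)"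
  by (simp add: subexp_def)

lemma subexp_diff [subexp_intros]: "subexp A f \<Longrightarrow> subexp A g \<Longrightarrow> subexp A (\<lambda>a t. f a t - g a t)"
  using subexp_add[OF _ subexp_uminus, of A f g] by simp

lemma subexp_power [subexp_intros]: "subexp A f \<Longrightarrow> subexp A (\<lambda>a t. f a t ^ n)"
  by (induction n) (auto intro: subexp_intros)

lemma subexp_linear: "subexp A (\<lambda>a t. complex_of_real (t + 1/t))"
proof (rule subexpI)
  fix e :: real assume e: "e > 0"
  have "norm (complex_of_real (t + 1/t)) \<le> 1/e * exp (e * (t + 1/t))" if "t > 0" for t
  proof -
    have "e * (t + 1/t) \<le> exp (e * (t + 1/t))"
      using exp_ge_add_one_self[of "e * (t + 1/t)"] by linarith
    moreover have "norm (complex_of_real (t + 1/t)) = t + 1/t" using that by (simp del: of_real_add)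
    ultimately show ?thesis using e by (simp add: field_simps)
  qed
  then show "\<exists>C. \<forall>a\<in>A. \<forall>t>0. norm (complex_of_real (t + 1/t)) \<le> C * exp (e * (t + 1/t))" by blast
qed

lemma subexp_real_bound:
  assumes "\<And>a t. a \<in> A \<Longrightarrow> t > 0 \<Longrightarrow> norm (f a t) \<le> M * (t + 1/t)"
  shows "subexp A f"
proof (rule subexp_bound)
  show "subexp A (\<lambda>a t. complex_of_real M * complex_of_real (t + 1/t))"
    by (intro subexp_mult subexp_const subexp_linear)
  show "norm (f a t) \<le> norm (complex_of_real M * complex_of_real (t + 1/t))" if "a \<in> A" "t > 0" for a t
  proof -
    have "norm (f a t) \<le> \<bar>M * (t + 1/t)\<bar>" using assms[OF that] by simp
    also have "\<dots> = norm (complex_of_real M * complex_of_real (t + 1/t))"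
      by (simp only: flip: of_real_mult) (simp only: norm_of_real)
    finally show ?thesis .
  qed
qed

lemma subexp_var [subexp_intros]: "subexp A (\<lambda>a t. complex_of_real t)"
  by (rule subexp_real_bound[of _ _ 1]) auto

lemma subexp_inverse_var [subexp_intros]: "subexp A (\<lambda>a t. 1 / complex_of_real t)"
  by (rule subexp_real_bound[of _ _ 1]) (auto simp: norm_divide)

text \<open>A substitution that inflates \<open>t + 1/t\<close> by at most a factor only rescales
  the rate. Its purpose is to carry growth bounds for the Kummer function over to its argument
  \<open>karg\<close>.\<close>

lemma subexp_compose:
  assumes f: "subexp UNIV (\<lambda>_. f :: real \<Rightarrow> complex)"
    and w: "\<And>a t. a \<in> A \<Longrightarrow> t > 0 \<Longrightarrow> w a t > 0 \<and> w a t + 1 / w a t \<le> M * (t + 1/t)"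
  shows "subexp A (\<lambda>a t. f (w a t))"
proof (rule subexpI)
  fix e :: real assume e: "e > 0"
  define M' where "M' = \<bar>M\<bar> + 1"
  have M': "M' > 0" by (simp add: M'_def)
  have wM: "w a t + 1 / w a t \<le> M' * (t + 1/t)" if "a \<in> A" "t > 0" for a t
  proof -
    have "M * (t + 1/t) \<le> M' * (t + 1/t)" using that by (intro mult_right_mono) (auto simp: M'_def)
    then show ?thesis using w[OF that] by linarith
  qed
  obtain C where C: "C > 0" "\<And>t. t > 0 \<Longrightarrow> norm (f t) \<le> C * exp (e / M' * (t + 1/t))"
    using subexpD[OF f, of "e / M'"] e M' by auto
  have "norm (f (w a t)) \<le> C * exp (e * (t + 1/t))" if "a \<in> A" "t > 0" for a t
  proof -
    have "norm (f (w a t)) \<le> C * exp (e / M' * (w a t + 1 / w a t))" using w[OF that] by (intro C) auto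
    also have "\<dots> \<le> C * exp (e * (t + 1/t))"
    proof -
      have "e / M' * (w a t + 1 / w a t) \<le> e / M' * (M' * (t + 1/t))"
        using wM[OF that] M' e by (intro mult_left_mono) auto
      then show ?thesis using C M' by simp
    qed
    finally show ?thesis .
  qed
  then show "\<exists>C. \<forall>a\<in>A. \<forall>t>0. norm (f (w a t)) \<le> C * exp (e * (t + 1/t))" by blast
qed

lemma integrable_on_exp_minus_half_line:
  "d > 0 \<Longrightarrow> (\<lambda>t. C * exp (-d * t) :: real) integrable_on {0<..}"
proof -
  assume "d > 0"
  then have "(\<lambda>t. exp (-d * t)) absolutely_integrable_on {0..}"
    using integrable_on_exp_minus_to_infinity[of d 0] by (intro nonnegative_absolutely_integrable_1) auto
  then have "(\<lambda>t. exp (-d * t)) absolutely_integrable_on {0<..}"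
    by (rule set_integrable_subset) auto
  then show ?thesis by (intro integrable_on_mult_right set_lebesgue_integral_eq_integral)
qed

lemma integrable_on_exp_two_ended:
  assumes "d > 0"
  shows "(\<lambda>t. C * exp (- (d * (t + 1/t))) :: real) integrable_on {0<..}"
proof -
  have g: "(\<lambda>t. exp (-d * t)) integrable_on {0<..}"
    using integrable_on_exp_minus_half_line[OF assms, of 1] by simp
  have "(\<lambda>t. exp (- (d * (t + 1/t)))) absolutely_integrable_on {0<..}"
  proof (rule continuous_bounded_by_integrable_imp_integrable[OF _ _ g])
    show "continuous_on {0<..} (\<lambda>t. exp (- (d * (t + 1 / t))))"
      by (auto intro!: continuous_intros)
    show "norm (exp (- (d * (t + 1 / t)))) \<le> exp (- d * t)" if "t \<in> {0<..}" for t
      using that assms by simp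
  qed auto
  then show ?thesis
    by (intro integrable_on_mult_right set_lebesgue_integral_eq_integral)
qed

text \<open>Half of the decay of \<open>E\<close> pays for the growth of \<open>f\<close>; the other
  half remains.\<close>

lemma subexp_times_exp_bound:
  assumes f: "subexp A f" and d: "d > 0"
    and E: "\<And>a t. a \<in> A \<Longrightarrow> t > 0 \<Longrightarrow> norm (E a t) \<le> exp (- (d * (t + 1/t)))"
  obtains C where "C > 0" "\<And>a t. a \<in> A \<Longrightarrow> t > 0 \<Longrightarrow> norm (f a t * E a t) \<le> C * exp (- (d / 2 * (t + 1/t)))"
proof -
  obtain C where C: "C > 0" "\<And>a t. a \<in> A \<Longrightarrow> t > 0 \<Longrightarrow> norm (f a t) \<le> C * exp (d / 2 * (t + 1/t))"
    using subexpD[OF f, of "d / 2"] d by auto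
  have "norm (f a t * E a t) \<le> C * exp (- (d / 2 * (t + 1/t)))" if "a \<in> A" "t > 0" for a t
  proof -
    have "norm (f a t * E a t) \<le> (C * exp (d / 2 * (t + 1/t))) * exp (- (d * (t + 1/t)))"
      unfolding norm_mult using C E that by (intro mult_mono) auto
    also have "\<dots> = C * exp (- (d / 2 * (t + 1/t)))"
      unfolding mult.assoc exp_add[symmetric] by (simp add: field_simps)
    finally show ?thesis .
  qed
  then show ?thesis using that C(1) by blast
qed

lemma tendsto_zero_exp_two_ended:
  fixes f :: "real \<Rightarrow> 'a::real_normed_vector"
  assumes "d > 0" "\<And>t. t > 0 \<Longrightarrow> norm (f t) \<le> C * exp (- (d * (t + 1/t)))"
  shows "(f \<longlongrightarrow> 0) (at_right 0)" "(f \<longlongrightarrow> 0) at_top"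
proof -
  have "((\<lambda>t. C * exp (- (d * (t + 1/t)))) \<longlongrightarrow> 0) (at_right 0)"
       "((\<lambda>t. C * exp (- (d * (t + 1/t)))) \<longlongrightarrow> 0) at_top"
    using \<open>d > 0\<close> by real_asymp+
  moreover have "eventually (\<lambda>t. norm (f t) \<le> C * exp (- (d * (t + 1/t)))) (at_right 0)"
    using assms(2) by (intro eventually_mono[OF eventually_at_right_less])
  moreover have "eventually (\<lambda>t. norm (f t) \<le> C * exp (- (d * (t + 1/t)))) at_top"
    using assms(2) by (intro eventually_mono[OF eventually_gt_at_top[of 0]])
  ultimately show "(f \<longlongrightarrow> 0) (at_right 0)" "(f \<longlongrightarrow> 0) at_top"
    by (auto intro: Lim_null_comparison)
qed

section \<open>Uniqueness of the recessive solution\<close>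

text \<open>Whittaker's equation solved for the second derivative:
  \<open>u'' = wcoef * u\<close>.\<close>

definition wcoef :: "complex \<Rightarrow> complex \<Rightarrow> real \<Rightarrow> complex" where
  "wcoef \<kappa> \<mu> x = - (-1/4 + \<kappa> / complex_of_real x + (1/4 - \<mu>^2) / (complex_of_real x)^2)"

definition whittaker_pair :: "complex \<Rightarrow> complex \<Rightarrow> (real \<Rightarrow> complex) \<Rightarrow> (real \<Rightarrow> complex) \<Rightarrow> bool" where
  "whittaker_pair \<kappa> \<mu> u u' \<longleftrightarrow> (\<forall>x>0. (u has_vector_derivative u' x) (at x) \<and>
     (u' has_vector_derivative wcoef \<kappa> \<mu> x * u x) (at x))"

lemma whittaker_solution_iff: "whittaker_solution \<kappa> \<mu> u \<longleftrightarrow> (\<exists>u'. whittaker_pair \<kappa> \<mu> u u')"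
  unfolding whittaker_solution_def whittaker_pair_def wcoef_def mult_minus_left by (rule refl)

lemma whittaker_pairD:
  assumes "whittaker_pair \<kappa> \<mu> u u'" "x > 0"
  shows "(u has_vector_derivative u' x) (at x)" "(u' has_vector_derivative wcoef \<kappa> \<mu> x * u x) (at x)"
  using assms by (auto simp: whittaker_pair_def)

definition wasym :: "complex \<Rightarrow> real \<Rightarrow> complex" where
  "wasym \<kappa> x = complex_of_real x powr \<kappa> * exp (- complex_of_real x / 2)"

lemma norm_wasym: "x > 0 \<Longrightarrow> norm (wasym \<kappa> x) = x powr Re \<kappa> * exp (- x / 2)"
  by (simp add: wasym_def norm_mult norm_powr_real_powr)

lemma wasym_nonzero: "x > 0 \<Longrightarrow> wasym \<kappa> x \<noteq> 0"
  by (simp add: wasym_def)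

lemma wasym_tendsto_0: "(wasym \<kappa> \<longlongrightarrow> 0) at_top"
proof (rule Lim_null_comparison)
  show "eventually (\<lambda>x. norm (wasym \<kappa> x) \<le> x powr Re \<kappa> * exp (- x / 2)) at_top"
    using eventually_gt_at_top[of 0] by eventually_elim (simp add: norm_wasym)
  show "((\<lambda>x. x powr Re \<kappa> * exp (- x / 2)) \<longlongrightarrow> 0) at_top" by real_asymp
qed

text \<open>The factor \<open>x^2\<close> clears the pole of \<open>wcoef\<close> at the regular
  singular point 0.\<close>

lemma norm_wcoef_le:
  assumes "0 < x" "x \<le> X"
  shows "norm (wcoef \<kappa> \<mu> x) * x^2 \<le> X^2 / 4 + norm \<kappa> * X + norm (1/4 - \<mu>^2)"
proof -
  have "complex_of_real (x^2) * wcoef \<kappa> \<mu> x = of_real (x^2) / 4 + (- (\<kappa> * of_real x)) + (- (1/4 - \<mu>^2))"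
    using assms by (simp add: wcoef_def field_simps power2_eq_square)
  then have "norm (wcoef \<kappa> \<mu> x) * x^2 = norm (of_real (x^2) / 4 + (- (\<kappa> * of_real x)) + (- (1/4 - \<mu>^2)))"
    by (metis abs_of_nonneg mult.commute norm_mult norm_of_real zero_le_power2)
  also have "\<dots> \<le> norm (complex_of_real (x^2) / 4) + norm (- (\<kappa> * of_real x)) + norm (- (1/4 - \<mu>^2))"
    by (intro norm_triangle_le add_mono order.refl)
  also have "\<dots> = x^2 / 4 + norm \<kappa> * x + norm (1/4 - \<mu>^2)"
    using assms by (simp only: norm_minus_cancel norm_divide norm_mult norm_of_real) simp
  also have "\<dots> \<le> X^2 / 4 + norm \<kappa> * X + norm (1/4 - \<mu>^2)"
    using assms by (intro add_mono divide_right_mono power_mono mult_left_mono) auto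
  finally show ?thesis .
qed

text \<open>A coefficient of size \<open>Q / x^2\<close> has the scaling of an Euler equation, for
  which \<open>E = |u|^2 + |x u'|^2\<close> is the natural energy:
  \<open>x * E' \<ge> - (1 + Q) * E\<close>, so a large power of \<open>x\<close> makes
  \<open>x^M * E\<close> nondecreasing. Read from right to left this bounds \<open>u\<close> and
  \<open>u'\<close> near 0 by a power, and it carries vanishing Cauchy data from \<open>X\<close> to
  all smaller \<open>x\<close>.\<close>

lemma euler_energy_monotone:
  fixes u :: "real \<Rightarrow> complex"
  assumes u: "\<And>x. 0 < x \<Longrightarrow> x \<le> X \<Longrightarrow> (u has_vector_derivative u' x) (at x)"
    and u': "\<And>x. 0 < x \<Longrightarrow> x \<le> X \<Longrightarrow> (u' has_vector_derivative q x * u x) (at x)"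
    and q: "\<And>x. 0 < x \<Longrightarrow> x \<le> X \<Longrightarrow> norm (q x) * x^2 \<le> Q"
  shows "\<exists>M::nat. \<forall>x. 0 < x \<and> x \<le> X \<longrightarrow>
    x ^ M * ((norm (u x))^2 + (x * norm (u' x))^2) \<le> X ^ M * ((norm (u X))^2 + (X * norm (u' X))^2)"
proof -
  obtain M0 :: nat where "3 + Q \<le> M0" using real_arch_simple by blast
  \<comment> \<open>Written as a successor so that the derivative of \<open>x^M\<close> is
    \<open>M * x^M0\<close>, without subtraction of naturals.\<close>
  define M where "M = Suc M0"
  have M: "3 + Q \<le> M" using \<open>3 + Q \<le> M0\<close> by (simp add: M_def)
  define E where "E x = u x \<bullet> u x + x^2 * (u' x \<bullet> u' x)" for x
  define E' where "E' x = 2 * (u x \<bullet> u' x) + 2 * x * (u' x \<bullet> u' x) + x^2 * (2 * (u' x \<bullet> (q x * u x)))" for x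
  have E: "(E has_real_derivative E' x) (at x)" if "0 < x" "x \<le> X" for x
  proof -
    have "((\<lambda>x. u x \<bullet> u x) has_real_derivative 2 * (u x \<bullet> u' x)) (at x)"
      using bounded_bilinear.has_vector_derivative[OF bounded_bilinear_inner u u, OF that that]
      by (simp add: has_real_derivative_iff_has_vector_derivative inner_commute)
    moreover have "((\<lambda>x. u' x \<bullet> u' x) has_real_derivative 2 * (u' x \<bullet> (q x * u x))) (at x)"
      using bounded_bilinear.has_vector_derivative[OF bounded_bilinear_inner u' u', OF that that]
      by (simp add: has_real_derivative_iff_has_vector_derivative inner_commute)
    ultimately show ?thesis
      unfolding E_def [abs_def] E'_def
      by (auto intro!: derivative_eq_intros simp: algebra_simps)
  qed
  have bound: "M * E x + x * E' x \<ge> 0" if x: "0 < x" "x \<le> X" for x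
  proof -
    define m n where "m = norm (u x)" and "n = x * norm (u' x)"
    have Q0: "Q \<ge> 0" using order.trans[OF _ q[OF x]] by simp
    have E_eq: "E x = m^2 + n^2"
      by (simp add: E_def m_def n_def dot_square_norm power_mult_distrib)
    have 1: "\<bar>u x \<bullet> u' x\<bar> * x \<le> m * n"
      using mult_right_mono[OF Cauchy_Schwarz_ineq2[of "u x" "u' x"], of x] x
      by (simp add: m_def n_def mult_ac)
    have 2: "x * (x * (u' x \<bullet> u' x)) = n^2"
      by (simp add: n_def dot_square_norm power2_eq_square)
    have 3: "x * (x^2 * \<bar>u' x \<bullet> (q x * u x)\<bar>) \<le> Q * (m * n)"
    proof -
      have "x * (x^2 * \<bar>u' x \<bullet> (q x * u x)\<bar>) \<le> x * (x^2 * (norm (u' x) * (norm (q x) * norm (u x))))"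
        using x Cauchy_Schwarz_ineq2[of "u' x" "q x * u x"]
        by (intro mult_left_mono) (auto simp: norm_mult)
      also have "\<dots> = (norm (q x) * x^2) * (m * n)" by (simp add: m_def n_def)
      also have "\<dots> \<le> Q * (m * n)" using q[OF x] x by (intro mult_right_mono) (auto simp: m_def n_def)
      finally show ?thesis .
    qed
    have mn: "2 * (m * n) \<le> m^2 + n^2" using sum_squares_bound[of m n] by simp
    have "x * E' x = 2 * (u x \<bullet> u' x * x) + 2 * n^2 + 2 * (x * (x^2 * (u' x \<bullet> (q x * u x))))"
      unfolding E'_def 2[symmetric] by (simp add: algebra_simps)
    moreover have "\<bar>u x \<bullet> u' x * x\<bar> \<le> m * n" using 1 x by (simp add: abs_mult)
    moreover have "\<bar>x * (x^2 * (u' x \<bullet> (q x * u x)))\<bar> \<le> Q * (m * n)" using 3 x by (simp add: abs_mult)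
    ultimately have "x * E' x \<ge> - 2 * (m * n) - 2 * (Q * (m * n))"
      using zero_le_power2[of n] unfolding abs_le_iff by linarith
    moreover have "Q * (2 * (m * n)) \<le> Q * E x" using mn Q0 unfolding E_eq by (intro mult_left_mono)
    moreover have "(3 + Q) * E x \<le> M * E x" using M by (intro mult_right_mono) (auto simp: E_eq)
    moreover have "0 \<le> E x" "2 * (m * n) \<le> E x" using mn by (auto simp: E_eq)
    ultimately show ?thesis unfolding distrib_right by linarith
  qed
  have "x ^ M * E x \<le> X ^ M * E X" if x: "0 < x" "x \<le> X" for x
  proof (rule DERIV_nonneg_imp_nondecreasing[OF x(2)])
    fix y assume y: "x \<le> y" "y \<le> X"
    then have y0: "0 < y" using x by linarith
    have "((\<lambda>x. x ^ M * E x) has_real_derivative (M * y ^ M0 * E y + y ^ M * E' y)) (at y)"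
    proof -
      have "((\<lambda>x. x ^ M) has_real_derivative M * y ^ M0) (at y)"
        using DERIV_pow[of M y] by (simp add: M_def)
      from DERIV_mult[OF this E[OF y0 y(2)]] show ?thesis by (simp add: algebra_simps)
    qed
    moreover have "M * y ^ M0 * E y + y ^ M * E' y = y ^ M0 * (M * E y + y * E' y)"
      by (simp add: M_def algebra_simps)
    moreover have "\<dots> \<ge> 0" using bound[OF y0 y(2)] y0 by (intro mult_nonneg_nonneg) auto
    ultimately show "\<exists>D. ((\<lambda>x. x ^ M * E x) has_real_derivative D) (at y) \<and> 0 \<le> D" by metis
  qed
  moreover have "E x = (norm (u x))^2 + (x * norm (u' x))^2" for x
    by (simp add: E_def dot_square_norm power_mult_distrib)
  ultimately show ?thesis by (intro exI[of _ M]) simp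
qed

lemma whittaker_energy_monotone:
  assumes "whittaker_pair \<kappa> \<mu> u u'"
  shows "\<exists>M::nat. \<forall>x. 0 < x \<and> x \<le> X \<longrightarrow>
    x ^ M * ((norm (u x))^2 + (x * norm (u' x))^2) \<le> X ^ M * ((norm (u X))^2 + (X * norm (u' X))^2)"
proof (rule euler_energy_monotone[of X u u' "wcoef \<kappa> \<mu>"])
  show "(u has_vector_derivative u' x) (at x)" "(u' has_vector_derivative wcoef \<kappa> \<mu> x * u x) (at x)"
    if "0 < x" for x using whittaker_pairD[OF assms that] by auto
qed (rule norm_wcoef_le)

text \<open>By the mean value inequality for \<open>f y - y C\<close> on unit steps,
  \<open>f (x + 1) - f x\<close> tends to \<open>C\<close>; since \<open>f\<close> converges, it
  also tends to 0.\<close>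

lemma derivative_limit_zero:
  fixes f :: "real \<Rightarrow> 'a::real_normed_vector"
  assumes f: "\<And>x. x > 0 \<Longrightarrow> (f has_vector_derivative f' x) (at x)"
    and lim: "(f \<longlongrightarrow> L) at_top" "(f' \<longlongrightarrow> C) at_top"
  shows "C = 0"
proof -
  have "norm C \<le> e" if e: "e > 0" for e
  proof -
    have "eventually (\<lambda>x. dist (f' x) C < e) at_top" using lim(2) e by (rule tendstoD)
    then obtain X0 where X0: "\<And>x. x \<ge> X0 \<Longrightarrow> dist (f' x) C < e" by (auto simp: eventually_at_top_linorder)
    define X where "X = max X0 1"
    have "norm (f (x + 1) - f x - C) \<le> e" if x: "x \<ge> X" for x
    proof -
      have "norm ((f (x + 1) - (x + 1) *\<^sub>R C) - (f x - x *\<^sub>R C)) \<le> e * norm ((x + 1) - x)"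
      proof (rule differentiable_bound[where S = "{X..}" and f' = "\<lambda>x h. h *\<^sub>R (f' x - C)"])
        fix y assume "y \<in> {X..}"
        then have y: "y > 0" "y \<ge> X0" by (auto simp: X_def)
        have "((\<lambda>y. f y - y *\<^sub>R C) has_vector_derivative f' y - 1 *\<^sub>R C) (at y)"
          by (intro has_vector_derivative_diff f y bounded_linear.has_vector_derivative[OF bounded_linear_scaleR_left]
              has_vector_derivative_id)
        then show "((\<lambda>y. f y - y *\<^sub>R C) has_derivative (\<lambda>h. h *\<^sub>R (f' y - C))) (at y within {X..})"
          by (auto simp: has_vector_derivative_def intro: has_derivative_at_withinI)
        show "onorm (\<lambda>h. h *\<^sub>R (f' y - C)) \<le> e"
          using X0[OF y(2)] by (simp add: onorm_scaleR_left onorm_id dist_norm)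
      qed (use x in auto)
      then show ?thesis by (simp add: algebra_simps)
    qed
    then have "eventually (\<lambda>x. norm (f (x + 1) - f x - C) \<le> e) at_top"
      by (auto simp: eventually_at_top_linorder)
    moreover have "filterlim (\<lambda>x::real. x + 1) at_top at_top" by real_asymp
    then have "((\<lambda>x. f (x + 1)) \<longlongrightarrow> L) at_top" by (rule filterlim_compose[OF lim(1)])
    then have "((\<lambda>x. norm (f (x + 1) - f x - C)) \<longlongrightarrow> norm (L - L - C)) at_top"
      by (intro tendsto_intros lim)
    ultimately have "norm (L - L - C) \<le> e" by (intro tendsto_upperbound) auto
    then show ?thesis by simp
  qed
  then have "norm C \<le> 0" by (rule field_le_epsilon) simp
  then show ?thesis by simp
qed

text \<open>The asymptotics of \<open>u'\<close> are demanded explicitly, since an asymptotic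
  relation for \<open>u\<close> cannot simply be differentiated. Both the Wronskian argument and the
  raising operator rely on them. The value \<open>-1/2\<close> is the logarithmic derivative of
  \<open>exp (- x/2)\<close>.\<close>

definition recessive_pair :: "complex \<Rightarrow> complex \<Rightarrow> (real \<Rightarrow> complex) \<Rightarrow> (real \<Rightarrow> complex) \<Rightarrow> bool" where
  "recessive_pair \<kappa> \<mu> u u' \<longleftrightarrow> whittaker_pair \<kappa> \<mu> u u' \<and>
     ((\<lambda>x. u x / wasym \<kappa> x) \<longlongrightarrow> 1) at_top \<and> ((\<lambda>x. u' x / wasym \<kappa> x) \<longlongrightarrow> -1/2) at_top"

text \<open>With \<open>w\<close> the recessive solution, \<open>(d * w)' = C + 2 * d * w'\<close> where \<open>C\<close> is the (constant)
  Wronskian; since \<open>d * w\<close> and \<open>d * w'\<close> tend to 0, this forces \<open>C = 0\<close>.\<close>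

lemma whittaker_pair_small_eq_0:
  assumes w: "recessive_pair \<kappa> \<mu> w w'"
    and d: "whittaker_pair \<kappa> \<mu> d d'" "((\<lambda>x. d x / wasym \<kappa> x) \<longlongrightarrow> 0) at_top"
    and "x0 > 0"
  shows "d x0 = 0"
proof -
  have W: "whittaker_pair \<kappa> \<mu> w w'" "((\<lambda>x. w x / wasym \<kappa> x) \<longlongrightarrow> 1) at_top"
    "((\<lambda>x. w' x / wasym \<kappa> x) \<longlongrightarrow> -1/2) at_top"
    using w by (auto simp: recessive_pair_def)
  note wd = whittaker_pairD[OF W(1)] and dd = whittaker_pairD[OF d(1)]
  define wr where "wr x = w x * d' x - d x * w' x" for x
  have "(wr has_vector_derivative 0) (at x)" if "x > 0" for x
  proof -
    have "(wr has_vector_derivative (w x * (wcoef \<kappa> \<mu> x * d x) + w' x * d' x) -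
        (d x * (wcoef \<kappa> \<mu> x * w x) + d' x * w' x)) (at x)"
      unfolding wr_def [abs_def]
      by (intro has_vector_derivative_diff has_vector_derivative_mult wd dd that)
    then show ?thesis by (simp add: algebra_simps)
  qed
  then have "(wr has_vector_derivative 0) (at x within {0<..})" if "x \<in> {0<..}" for x
    using that by (auto intro!: has_vector_derivative_at_within[where S="{0<..}"])
  then obtain C where "\<And>x. x \<in> {0<..} \<Longrightarrow> wr x = C"
    using has_vector_derivative_zero_constant[of "{0<..}" wr] by (metis convex_real_interval(3))
  then have C: "wr x = C" if "x > 0" for x using that by simp
  have small: "((\<lambda>x. d x * v x) \<longlongrightarrow> 0) at_top" if "((\<lambda>x. v x / wasym \<kappa> x) \<longlongrightarrow> l) at_top" for v l
  proof -
    have "((\<lambda>x. (d x / wasym \<kappa> x) * (v x / wasym \<kappa> x) * (wasym \<kappa> x * wasym \<kappa> x)) \<longlongrightarrow> 0 * l * (0 * 0)) at_top"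
      by (intro tendsto_mult d that wasym_tendsto_0)
    moreover have "eventually (\<lambda>x. (d x / wasym \<kappa> x) * (v x / wasym \<kappa> x) * (wasym \<kappa> x * wasym \<kappa> x) = d x * v x) at_top"
      using eventually_gt_at_top[of 0] by eventually_elim (simp add: wasym_nonzero)
    ultimately show ?thesis by (simp add: tendsto_cong)
  qed
  have "C = 0"
  proof (rule derivative_limit_zero)
    fix x :: real assume "x > 0"
    show "((\<lambda>x. d x * w x) has_vector_derivative (d x * w' x + d' x * w x)) (at x)"
      by (intro has_vector_derivative_mult wd dd \<open>x > 0\<close>)
  next
    show "((\<lambda>x. d x * w x) \<longlongrightarrow> 0) at_top" by (rule small[OF W(2)])
    have "((\<lambda>x. C + 2 * (d x * w' x)) \<longlongrightarrow> C + 2 * 0) at_top"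
      by (intro tendsto_intros small[OF W(3)])
    moreover have "eventually (\<lambda>x. C + 2 * (d x * w' x) = d x * w' x + d' x * w x) at_top"
      using eventually_gt_at_top[of 0]
    proof eventually_elim
      case (elim x)
      show ?case using C[OF elim] by (simp add: wr_def algebra_simps)
    qed
    ultimately show "((\<lambda>x. d x * w' x + d' x * w x) \<longlongrightarrow> C) at_top" by (simp add: tendsto_cong)
  qed
  \<comment> \<open>With vanishing Wronskian, \<open>d / w\<close> is constant on any interval free
    of zeros of \<open>w\<close>. Such an interval exists near infinity, and there the constant is
    the limit \<open>0 / 1\<close>.\<close>
  have "eventually (\<lambda>x. w x / wasym \<kappa> x \<noteq> 0) at_top"
    using W(2) by (rule tendsto_imp_eventually_ne) simp
  then obtain X0 where X0: "\<And>x. x \<ge> X0 \<Longrightarrow> w x / wasym \<kappa> x \<noteq> 0" by (auto simp: eventually_at_top_linorder)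
  define X where "X = max X0 (max x0 1)"
  have w0: "w x \<noteq> 0" if "x \<ge> X" for x
    using X0[of x] that by (auto simp: X_def)
  have X: "X \<ge> x0" "X > 0" by (auto simp: X_def)
  have "((\<lambda>x. d x / w x) has_vector_derivative 0) (at x within {X..})" if "x \<in> {X..}" for x
  proof (rule has_vector_derivative_at_within)
    have x: "x > 0" "w x \<noteq> 0" using that X w0 by auto
    have "((\<lambda>x. d x * inverse (w x)) has_vector_derivative
        (d x * (w' x * (- inverse (w x ^ Suc (Suc 0)))) + d' x * inverse (w x))) (at x)"
      using field_vector_diff_chain_at[OF wd(1)[OF x(1)] DERIV_inverse[OF x(2)]]
      by (intro has_vector_derivative_mult dd x) (simp add: o_def)
    moreover have "d x * (w' x * (- inverse (w x ^ Suc (Suc 0)))) + d' x * inverse (w x) = 0"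
      using C[OF x(1)] \<open>C = 0\<close> x(2) by (simp add: wr_def field_simps)
    ultimately show "((\<lambda>x. d x / w x) has_vector_derivative 0) (at x)"
      by (simp only: divide_inverse)
  qed
  then obtain c where "\<And>x. x \<in> {X..} \<Longrightarrow> d x / w x = c"
    using has_vector_derivative_zero_constant[of "{X..}" "\<lambda>x. d x / w x"] by (metis convex_real_interval(1))
  then have c: "d x / w x = c" if "x \<ge> X" for x using that by simp
  have "((\<lambda>x. (d x / wasym \<kappa> x) / (w x / wasym \<kappa> x)) \<longlongrightarrow> 0 / 1) at_top"
    by (intro tendsto_divide d W) auto
  moreover have "eventually (\<lambda>x. (d x / wasym \<kappa> x) / (w x / wasym \<kappa> x) = c) at_top"
    using eventually_ge_at_top[of X]
  proof eventually_elim
    case (elim x)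
    then show ?case using c[OF elim] wasym_nonzero[of x \<kappa>] X by auto
  qed
  ultimately have "((\<lambda>x. c) \<longlongrightarrow> 0) (at_top :: real filter)" by (simp add: tendsto_cong)
  then have "c = 0" by (simp add: tendsto_const_iff)
  then have "d X = 0" using c[of X] w0[of X] by auto
  moreover have "d' X = 0" using C[of X] X \<open>C = 0\<close> \<open>d X = 0\<close> w0[of X] by (auto simp: wr_def)
  \<comment> \<open>Below \<open>X\<close> the function \<open>w\<close> may have zeros, so the
    quotient cannot be followed down to \<open>x0\<close>. The energy inequality carries
    \<open>d X = d' X = 0\<close> there instead.\<close>
  moreover obtain M :: nat where "\<forall>x. 0 < x \<and> x \<le> X \<longrightarrow>
    x ^ M * ((norm (d x))^2 + (x * norm (d' x))^2) \<le> X ^ M * ((norm (d X))^2 + (X * norm (d' X))^2)"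
    using whittaker_energy_monotone[OF d(1)] ..
  ultimately have "x0 ^ M * ((norm (d x0))^2 + (x0 * norm (d' x0))^2) \<le> 0"
    using \<open>x0 > 0\<close> X by fastforce
  then have "(norm (d x0))^2 + (x0 * norm (d' x0))^2 \<le> 0"
    using \<open>x0 > 0\<close> by (metis mult_le_0_iff not_le zero_less_power)
  then show ?thesis by (simp add: sum_power2_le_zero_iff)
qed

lemma dominated_convergence_real_at_top:
  fixes f :: "real \<Rightarrow> 'n::euclidean_space \<Rightarrow> 'm::euclidean_space"
  assumes f: "\<And>x. x \<ge> xmin \<Longrightarrow> f x integrable_on S" and h: "h integrable_on S"
    and le: "\<And>x t. x \<ge> xmin \<Longrightarrow> t \<in> S \<Longrightarrow> norm (f x t) \<le> h t"
    and conv: "\<And>t. t \<in> S \<Longrightarrow> ((\<lambda>x. f x t) \<longlongrightarrow> g t) at_top"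
  shows "((\<lambda>x. integral S (f x)) \<longlongrightarrow> integral S g) at_top"
proof (rule tendsto_at_topI_sequentially)
  fix X :: "nat \<Rightarrow> real" assume X: "filterlim X at_top sequentially"
  then have "eventually (\<lambda>n. X n \<ge> xmin) sequentially" by (simp add: filterlim_at_top)
  then obtain N where N: "\<And>n. n \<ge> N \<Longrightarrow> X n \<ge> xmin" by (auto simp: eventually_sequentially)
  have "(\<lambda>n. integral S (f (X (n + N)))) \<longlonglongrightarrow> integral S g"
  proof (rule dominated_convergence(2)[OF _ h])
    show "f (X (n + N)) integrable_on S" for n using f N by simp
    show "norm (f (X (n + N)) t) \<le> h t" if "t \<in> S" for n t using le N that by simp
    show "(\<lambda>n. f (X (n + N)) t) \<longlonglongrightarrow> g t" if "t \<in> S" for t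
      using LIMSEQ_ignore_initial_segment[OF filterlim_compose[OF conv[OF that] X]] by simp
  qed
  then show "(\<lambda>n. integral S (f (X n))) \<longlonglongrightarrow> integral S g" by (rule LIMSEQ_offset)
qed

section \<open>Existence of the recessive solution\<close>

lemma of_real_powr_exp_ln: "t > 0 \<Longrightarrow> complex_of_real t powr p = exp (p * of_real (ln t))"
  by (simp add: powr_def Ln_of_real)

lemma has_vector_derivative_of_real_powr:
  assumes "x > 0"
  shows "((\<lambda>x. complex_of_real x powr p) has_vector_derivative p * of_real (1/x) * complex_of_real x powr p) (at x)"
proof -
  have "((\<lambda>z. z powr p) has_field_derivative p * complex_of_real x powr (p - 1)) (at (complex_of_real x))"
    using assms by (intro has_field_derivative_powr) (auto simp: complex_nonpos_Reals_iff)
  then have "((\<lambda>x. complex_of_real x powr p) has_vector_derivative p * complex_of_real x powr (p - 1)) (at x)"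
    by (rule has_vector_derivative_real_field)
  moreover have "complex_of_real x powr (p - 1) = of_real (1/x) * complex_of_real x powr p"
    using assms by (simp add: powr_diff)
  ultimately show ?thesis by (simp add: mult.assoc)
qed

lemma has_vector_derivative_of_real_real:
  assumes "(r has_real_derivative r') (at x)"
  shows "((\<lambda>x. complex_of_real (r x)) has_vector_derivative complex_of_real r') (at x)"
  using has_vector_derivative_of_real[of r r' "at x"] assms
  by (simp add: has_real_derivative_iff_has_vector_derivative)

lemma continuous_on_of_real_powr [continuous_intros]:
  "continuous_on S f \<Longrightarrow> (\<And>t. t \<in> S \<Longrightarrow> f t > 0) \<Longrightarrow>
   continuous_on S (\<lambda>t. complex_of_real (f t) powr p)"
  by (intro continuous_on_powr_complex continuous_intros) (auto simp: less_imp_le, metis less_irrefl)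

lemma powr_le_exp:
  fixes N d :: real
  assumes "N \<ge> 0" "d > 0"
  obtains C where "C > 0" "\<And>t. t \<ge> 0 \<Longrightarrow> (1 + t) powr N \<le> C * exp (d * t)"
proof -
  \<comment> \<open>Chosen so that \<open>s \<le> 1\<close> and \<open>s * N \<le> d\<close>: then
    \<open>s * (1 + t) \<le> 1 + s * t \<le> exp (s * t)\<close>, and raising this to the power
    \<open>N\<close> costs at most the rate \<open>d\<close>.\<close>
  define s where "s = d / (N + d)"
  have s: "s > 0" "s \<le> 1" "s * N \<le> d" using assms by (auto simp: s_def field_simps)
  have "(1 + t) powr N \<le> (1 / s) powr N * exp (d * t)" if t: "t \<ge> 0" for t
  proof -
    have "s * (1 + t) \<le> 1 + s * t" using s by (simp add: algebra_simps)
    also have "\<dots> \<le> exp (s * t)" by (rule exp_ge_add_one_self)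
    finally have "1 + t \<le> 1 / s * exp (s * t)" using s by (simp add: field_simps)
    then have "(1 + t) powr N \<le> (1 / s * exp (s * t)) powr N" using assms t by (intro powr_mono2) auto
    also have "\<dots> = (1 / s) powr N * exp (s * N * t)" by (simp only: powr_mult exp_powr_real mult_ac)
    also have "\<dots> \<le> (1 / s) powr N * exp (d * t)"
      using s t by (intro mult_left_mono) (auto intro: mult_right_mono)
    finally show ?thesis .
  qed
  moreover have "(1 / s) powr N > 0" using s by simp
  ultimately show ?thesis using that by blast
qed

section \<open>Tricomi's Laplace integral\<close>

definition kintegrand :: "complex \<Rightarrow> complex \<Rightarrow> real \<Rightarrow> real \<Rightarrow> complex" where
  "kintegrand p c x t = of_real (exp (- (x * t))) * (complex_of_real t powr p * complex_of_real (1 + t) powr c)"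

text \<open>\<open>kint (a - 1) (b - a - 1) x\<close> is \<open>Gamma a\<close> times Tricomi's function \<open>U(a, b, x)\<close>.\<close>

definition kint :: "complex \<Rightarrow> complex \<Rightarrow> real \<Rightarrow> complex" where
  "kint p c x = integral {0<..} (kintegrand p c x)"

text \<open>The condition \<open>Re p \<ge> 0\<close> excludes a singularity at 0, so a single power
  of \<open>1 + t\<close> controls both factors.\<close>

lemma norm_powr_pair_le:
  assumes "Re p \<ge> 0" "t > 0"
  shows "norm (complex_of_real t powr p * complex_of_real (1 + t) powr c) \<le> (1 + t) powr (Re p + \<bar>Re c\<bar>)"
proof -
  have "norm (complex_of_real t powr p * complex_of_real (1 + t) powr c) = t powr Re p * (1 + t) powr Re c"
    using assms norm_powr_real_powr[of "complex_of_real t" p] norm_powr_real_powr[of "complex_of_real (1 + t)" c]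
    by (simp add: norm_mult del: of_real_add)
  also have "\<dots> \<le> (1 + t) powr Re p * (1 + t) powr \<bar>Re c\<bar>"
    using assms by (intro mult_mono powr_mono powr_mono2) auto
  also have "\<dots> = (1 + t) powr (Re p + \<bar>Re c\<bar>)" by (simp add: powr_add)
  finally show ?thesis .
qed

lemma kintegrand_bound:
  assumes "Re p \<ge> 0" "x1 > 0"
  obtains C where "C > 0" "\<And>x t. x \<ge> x1 \<Longrightarrow> t > 0 \<Longrightarrow> norm (kintegrand p c x t) \<le> C * exp (- (x1 / 2) * t)"
proof -
  obtain C where C: "C > 0" "\<And>t. t \<ge> 0 \<Longrightarrow> (1 + t) powr (Re p + \<bar>Re c\<bar>) \<le> C * exp (x1 / 2 * t)"
    using powr_le_exp[of "Re p + \<bar>Re c\<bar>" "x1 / 2"] assms by auto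
  have "norm (kintegrand p c x t) \<le> C * exp (- (x1 / 2) * t)" if "x \<ge> x1" "t > 0" for x t
  proof -
    have "norm (kintegrand p c x t) \<le> exp (- (x1 * t)) * (C * exp (x1 / 2 * t))"
      unfolding kintegrand_def norm_mult[of "of_real _"]
      using that assms norm_powr_pair_le[of p t c] C(2)[of t] by (intro mult_mono) auto
    also have "\<dots> = C * (exp (- (x1 * t)) * exp (x1 / 2 * t))" by simp
    also have "exp (- (x1 * t)) * exp (x1 / 2 * t) = exp (- (x1 / 2) * t)"
      unfolding exp_add[symmetric] by (simp add: field_simps)
    finally show ?thesis .
  qed
  then show ?thesis using that C(1) by blast
qed

lemma continuous_on_kintegrand: "continuous_on {0<..} (kintegrand p c x)"
  unfolding kintegrand_def [abs_def] by (intro continuous_intros) auto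

lemma kintegrand_integrable:
  assumes "Re p \<ge> 0" "x > 0"
  shows "kintegrand p c x absolutely_integrable_on {0<..}"
proof -
  obtain C where C: "C > 0" "\<And>y t. y \<ge> x \<Longrightarrow> t > 0 \<Longrightarrow> norm (kintegrand p c y t) \<le> C * exp (- (x / 2) * t)"
    using kintegrand_bound[OF assms] by metis
  show ?thesis
    using C integrable_on_exp_minus_half_line[of "x / 2" C] assms
    by (intro continuous_bounded_by_integrable_imp_integrable[OF continuous_on_kintegrand, where g="\<lambda>t. C * exp (- (x / 2) * t)"]) auto
qed

lemma kintegrand_Suc: "t > 0 \<Longrightarrow> kintegrand (p + 1) c x t = of_real t * kintegrand p c x t"
  by (simp add: kintegrand_def powr_add)

text \<open>Differentiating \<open>exp (- x * t)\<close> brings down \<open>-t\<close>, which raises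
  \<open>p\<close> by 1; the family is thus closed under differentiation.\<close>

lemma kint_deriv:
  assumes "Re p \<ge> 0" "x > 0"
  shows "(kint p c has_vector_derivative - kint (p + 1) c x) (at x)"
proof -
  obtain C where C: "C > 0" "\<And>y t. y \<ge> x / 2 \<Longrightarrow> t > 0 \<Longrightarrow> norm (kintegrand (p + 1) c y t) \<le> C * exp (- (x / 2 / 2) * t)"
    using kintegrand_bound[of "p + 1" "x / 2" c] assms by auto
  have "((\<lambda>x. integral {0<..} (kintegrand p c x)) has_vector_derivative
      integral {0<..} (\<lambda>t. - kintegrand (p + 1) c x t)) (at x)"
  proof (rule has_vector_derivative_integral_dominated(2)[where a = "x / 2" and b = "2 * x"])
    show "kintegrand p c y integrable_on {0<..}" if "x / 2 < y" for y
      using that assms by (intro set_lebesgue_integral_eq_integral kintegrand_integrable) auto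
    show "((\<lambda>x. kintegrand p c x t) has_vector_derivative - kintegrand (p + 1) c y t) (at y)"
      if "x / 2 < y" "t \<in> {0<..}" for y t
    proof -
      have "((\<lambda>y. exp (- (y * t))) has_real_derivative exp (- (y * t)) * (- t)) (at y)"
        by (auto intro!: derivative_eq_intros)
      from has_vector_derivative_mult[OF has_vector_derivative_of_real_real[OF this]
          has_vector_derivative_const[of "complex_of_real t powr p * complex_of_real (1 + t) powr c"]]
      show ?thesis unfolding kintegrand_Suc[of t, OF that(2)[simplified]]
        unfolding kintegrand_def
        by (rule has_vector_derivative_eq_rhs) (simp del: of_real_add)
    qed
    show "norm (- kintegrand (p + 1) c y t) \<le> C * exp (- (x / 2 / 2) * t)"
      if "x / 2 < y" "t \<in> {0<..}" for y t using C that by simp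
    show "(\<lambda>t. C * exp (- (x / 2 / 2) * t)) integrable_on {0<..}"
      using assms by (intro integrable_on_exp_minus_half_line) auto
  qed (use assms in auto)
  then show ?thesis by (simp add: kint_def[abs_def])
qed

text \<open>The corresponding combination of integrands is the \<open>t\<close>-derivative of
  \<open>- exp (- x * t) * t^a * (1 + t)^(c+1)\<close>, which vanishes at both ends. Together with
  \<open>kint_deriv\<close> this is Kummer's equation for \<open>kint (a - 1) c\<close>, with second
  parameter \<open>a + c + 1\<close>.\<close>

lemma kint_kummer:
  assumes "Re a \<ge> 1" "x > 0"
  shows "of_real x * kint (a + 1) c x = (a + c + 1 - of_real x) * kint a c x + a * kint (a - 1) c x"
proof -
  define f where "f t = of_real x * kintegrand (a + 1) c x t - (a + c + 1 - of_real x) * kintegrand a c x t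
    - a * kintegrand (a - 1) c x t" for t
  define G where "G t = - (kintegrand a (c + 1) x t)" for t
  have ai: "kintegrand (a + 1) c x absolutely_integrable_on {0<..}"
    "kintegrand a c x absolutely_integrable_on {0<..}"
    "kintegrand (a - 1) c x absolutely_integrable_on {0<..}"
    using assms by (auto intro!: kintegrand_integrable)
  have fi: "f absolutely_integrable_on {0<..}"
    unfolding f_def [abs_def] by (intro set_integral_diff set_integrable_mult_right ai)
  have "integral {0<..} f = 0"
  proof (rule integral_derivative_vanishing_ends[where F = G and g = "\<lambda>t. norm (f t)"])
    fix t :: real assume t: "t > 0"
    have "((\<lambda>t. exp (- (x * t))) has_real_derivative exp (- (x * t)) * (- x)) (at t)"
      by (auto intro!: derivative_eq_intros)
    note 1 = has_vector_derivative_of_real_real[OF this]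
    have 2: "((\<lambda>t. complex_of_real (1 + t) powr (c + 1)) has_vector_derivative
        (c + 1) * of_real (1 / (1 + t)) * complex_of_real (1 + t) powr (c + 1)) (at t)"
    proof -
      have "((\<lambda>t. 1 + t) has_vector_derivative 1) (at t)" by (auto intro!: derivative_eq_intros)
      from vector_diff_chain_at[OF this has_vector_derivative_of_real_powr[of "1 + t" "c + 1"]]
      show ?thesis using t by (simp add: o_def)
    qed
    have "(G has_vector_derivative
       - (of_real (exp (- (x * t))) * (complex_of_real t powr a * ((c + 1) * of_real (1 / (1 + t)) * complex_of_real (1 + t) powr (c + 1))
            + (a * of_real (1/t) * complex_of_real t powr a) * complex_of_real (1 + t) powr (c + 1))
         + of_real (exp (- (x * t)) * (- x)) * (complex_of_real t powr a * complex_of_real (1 + t) powr (c + 1)))) (at t)"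
      unfolding G_def [abs_def] kintegrand_def
      by (intro has_vector_derivative_minus has_vector_derivative_mult 1 2 has_vector_derivative_of_real_powr t)
    moreover have "- (of_real (exp (- (x * t))) * (complex_of_real t powr a * ((c + 1) * of_real (1 / (1 + t)) * complex_of_real (1 + t) powr (c + 1))
            + (a * of_real (1/t) * complex_of_real t powr a) * complex_of_real (1 + t) powr (c + 1))
         + of_real (exp (- (x * t)) * (- x)) * (complex_of_real t powr a * complex_of_real (1 + t) powr (c + 1))) = f t"
    proof -
      \<comment> \<open>All powers are reduced to \<open>t^(a-1)\<close> and \<open>(1+t)^c\<close>,
        so that the identity becomes one of rational functions in \<open>T\<close>.\<close>
      define A B E T where "A = complex_of_real t powr (a - 1)" and "B = complex_of_real (1 + t) powr c"
        and "E = complex_of_real (exp (- (x * t)))" and "T = complex_of_real t"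
      have T: "T \<noteq> 0" "1 + T \<noteq> 0" using t unfolding T_def
        by (auto simp: complex_eq_iff)
      have e: "complex_of_real t powr a = T * A" "complex_of_real t powr (a + 1) = T * (T * A)"
        "complex_of_real (1 + t) powr (c + 1) = (1 + T) * B"
        using t T by (auto simp: A_def B_def T_def powr_add powr_diff)
      have k: "kintegrand (a - 1) c x t = E * (A * B)" "kintegrand a c x t = E * (T * A * B)"
        "kintegrand (a + 1) c x t = E * (T * (T * A) * B)"
        unfolding kintegrand_def e by (simp_all add: A_def B_def E_def)
      show ?thesis
        unfolding f_def k e
        unfolding of_real_mult of_real_minus of_real_divide of_real_add of_real_1
          E_def[symmetric] T_def[symmetric]
        using T by (simp add: field_simps)
    qed
    ultimately show "(G has_vector_derivative f t) (at t)" by simp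
  next
    have nG: "norm (G t) = exp (- (x * t)) * (t powr Re a * (1 + t) powr (Re c + 1))" if "t > 0" for t
      using that norm_powr_real_powr[of "complex_of_real t" a] norm_powr_real_powr[of "complex_of_real (1 + t)" "c + 1"]
      by (simp add: G_def kintegrand_def norm_mult del: of_real_add)
    have lim: "((\<lambda>t. exp (- (x * t)) * (t powr Re a * (1 + t) powr (Re c + 1))) \<longlongrightarrow> 0) (at_right 0)"
      "((\<lambda>t. exp (- (x * t)) * (t powr Re a * (1 + t) powr (Re c + 1))) \<longlongrightarrow> 0) at_top"
      using assms by real_asymp+
    show "(G \<longlongrightarrow> 0) (at_right 0)"
      by (rule Lim_null_comparison[OF eventually_mono[OF eventually_at_right_less] lim(1)]) (simp add: nG)
    show "(G \<longlongrightarrow> 0) at_top"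
      by (rule Lim_null_comparison[OF eventually_mono[OF eventually_gt_at_top[of 0]] lim(2)]) (simp add: nG)
  qed (use fi in \<open>auto simp: absolutely_integrable_on_def\<close>)
  moreover have "integral {0<..} f = of_real x * kint (a + 1) c x - (a + c + 1 - of_real x) * kint a c x - a * kint (a - 1) c x"
  proof -
    note i = ai[THEN set_lebesgue_integral_eq_integral(1)]
    have "(f has_integral (of_real x * kint (a + 1) c x - (a + c + 1 - of_real x) * kint a c x - a * kint (a - 1) c x)) {0<..}"
      unfolding f_def [abs_def] kint_def
      by (intro has_integral_diff has_integral_mult_right integrable_integral i)
    then show ?thesis by (rule integral_unique)
  qed
  ultimately show ?thesis by (simp add: algebra_simps)
qed

text \<open>The leading case of Watson's lemma: substituting \<open>t = s / x\<close> turns the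
  second power into \<open>(1 + s/x)^c\<close>, which tends to 1 and leaves Euler's integral for
  Gamma.\<close>

lemma kint_asymptotic:
  assumes "Re p \<ge> 0"
  shows "((\<lambda>x. complex_of_real x powr (p + 1) * kint p c x) \<longlongrightarrow> Gamma (p + 1)) at_top"
proof -
  define h where "h x s = of_real (exp (- s)) * (complex_of_real s powr p * complex_of_real (1 + s / x) powr c)" for x s
  define h0 where "h0 s = of_real (exp (- s)) * complex_of_real s powr p" for s :: real
  have scale: "complex_of_real x powr (p + 1) * kint p c x = integral {0<..} (h x)" if x: "x > 0" for x
  proof -
    have img: "(\<lambda>s. s / x) ` {0<..} = {0<..}"
    proof -
      have "t \<in> (\<lambda>s. s / x) ` {0<..}" if "t > 0" for t
        using x that by (intro image_eqI[of _ _ "t * x"]) auto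
      then show ?thesis using x by auto
    qed
    have "(\<lambda>s. \<bar>1 / x\<bar> *\<^sub>R kintegrand p c x (s / x)) absolutely_integrable_on {0<..} \<and>
        integral {0<..} (\<lambda>s. \<bar>1 / x\<bar> *\<^sub>R kintegrand p c x (s / x)) = kint p c x"
      using x kintegrand_integrable[OF assms x, of c]
      by (subst has_absolute_integral_change_of_variables_real[where g = "\<lambda>s. s / x"])
         (auto simp: img kint_def inj_on_def intro!: derivative_eq_intros)
    then have i: "integral {0<..} (\<lambda>s. \<bar>1 / x\<bar> *\<^sub>R kintegrand p c x (s / x)) = kint p c x" ..
    have "complex_of_real x powr (p + 1) * kint p c x =
        integral {0<..} (\<lambda>s. complex_of_real x powr (p + 1) * (\<bar>1 / x\<bar> *\<^sub>R kintegrand p c x (s / x)))"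
      unfolding integral_mult_right i ..
    also have "\<dots> = integral {0<..} (h x)"
    proof (rule integral_cong)
      fix s :: real assume "s \<in> {0<..}"
      then have s: "s > 0" by simp
      have "complex_of_real s powr p = complex_of_real x powr p * complex_of_real (s / x) powr p"
        using x s by (simp add: of_real_powr_exp_ln ln_div exp_add[symmetric] algebra_simps del: of_real_divide)
      then show "complex_of_real x powr (p + 1) * (\<bar>1 / x\<bar> *\<^sub>R kintegrand p c x (s / x)) = h x s"
        using x by (simp add: kintegrand_def h_def powr_add scaleR_conv_of_real)
    qed
    finally show ?thesis .
  qed
  obtain C where C: "C > 0" "\<And>t. t \<ge> 0 \<Longrightarrow> (1 + t) powr (Re p + \<bar>Re c\<bar>) \<le> C * exp (1 / 2 * t)"
    using powr_le_exp[of "Re p + \<bar>Re c\<bar>" "1 / 2"] assms by auto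
  have bnd: "norm (h x s) \<le> C * exp (- (1 / 2) * s)" if "x \<ge> 1" "s > 0" for x s
  proof -
    have "norm (complex_of_real s powr p * complex_of_real (1 + s / x) powr c) = s powr Re p * (1 + s / x) powr Re c"
      using that norm_powr_real_powr[of "complex_of_real s" p] norm_powr_real_powr[of "complex_of_real (1 + s / x)" c]
      by (simp add: norm_mult add_nonneg_nonneg del: of_real_add of_real_divide)
    also have "\<dots> \<le> (1 + s) powr Re p * (1 + s) powr \<bar>Re c\<bar>"
    proof (intro mult_mono powr_mono2)
      have "s / x \<le> s" using that by (simp add: field_simps)
      have "(1 + s / x) powr Re c \<le> (1 + s / x) powr \<bar>Re c\<bar>" using that by (intro powr_mono) auto
      also have "\<dots> \<le> (1 + s) powr \<bar>Re c\<bar>" using that \<open>s / x \<le> s\<close> by (intro powr_mono2) auto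
      finally show "(1 + s / x) powr Re c \<le> (1 + s) powr \<bar>Re c\<bar>" .
    qed (use that assms in auto)
    also have "\<dots> = (1 + s) powr (Re p + \<bar>Re c\<bar>)" by (simp add: powr_add)
    also have "\<dots> \<le> C * exp (1 / 2 * s)" using that by (intro C) auto
    finally have "norm (h x s) \<le> exp (- s) * (C * exp (1 / 2 * s))"
      unfolding h_def norm_mult[of "of_real _"] by (intro mult_mono) auto
    also have "\<dots> = C * (exp (- s) * exp (1 / 2 * s))" by simp
    also have "exp (- s) * exp (1 / 2 * s) = exp (- (1 / 2) * s)"
      unfolding exp_add[symmetric] by (simp add: field_simps)
    finally show ?thesis .
  qed
  have "((\<lambda>x. integral {0<..} (h x)) \<longlongrightarrow> integral {0<..} h0) at_top"
  proof (rule dominated_convergence_real_at_top[where xmin = 1 and h = "\<lambda>s. C * exp (- (1 / 2) * s)"])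
    show "(\<lambda>s. C * exp (- (1 / 2) * s)) integrable_on {0<..}" by (rule integrable_on_exp_minus_half_line) simp
    show "norm (h x s) \<le> C * exp (- (1 / 2) * s)" if "x \<ge> 1" "s \<in> {0<..}" for x s using bnd that by simp
    show "h x integrable_on {0<..}" if "x \<ge> 1" for x
    proof -
      have "continuous_on {0<..} (h x)" unfolding h_def [abs_def] using that
        by (intro continuous_intros) (auto intro!: add_pos_pos)
      then have "h x absolutely_integrable_on {0<..}"
        by (rule continuous_bounded_by_integrable_imp_integrable[OF _ _ integrable_on_exp_minus_half_line[of "1 / 2" C]])
           (use bnd that in auto)
      then show ?thesis by (rule set_lebesgue_integral_eq_integral)
    qed
    show "((\<lambda>x. h x s) \<longlongrightarrow> h0 s) at_top" if "s \<in> {0<..}" for s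
    proof -
      have "((\<lambda>x. 1 + s / x) \<longlongrightarrow> 1) at_top" by real_asymp
      then have "((\<lambda>x. complex_of_real (1 + s / x)) \<longlongrightarrow> of_real 1) at_top" by (rule tendsto_of_real)
      then have "((\<lambda>x. complex_of_real (1 + s / x) powr c) \<longlongrightarrow> of_real 1 powr c) at_top"
        by (intro tendsto_powr_complex) (auto simp: complex_nonpos_Reals_iff)
      then have "((\<lambda>x. h x s) \<longlongrightarrow> of_real (exp (- s)) * (complex_of_real s powr p * of_real 1 powr c)) at_top"
        unfolding h_def by (intro tendsto_mult tendsto_const)
      then show ?thesis by (simp add: h0_def)
    qed
  qed
  moreover have "integral {0<..} h0 = Gamma (p + 1)"
  proof -
    have "((\<lambda>t. complex_of_real t powr (p + 1 - 1) / of_real (exp t)) has_integral Gamma (p + 1)) {0<..}"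
      using assms by (intro Gamma_integral_complex') auto
    then show ?thesis by (intro integral_unique) (simp add: h0_def[abs_def] exp_minus divide_inverse mult.commute)
  qed
  moreover have "eventually (\<lambda>x. integral {0<..} (h x) = complex_of_real x powr (p + 1) * kint p c x) at_top"
    using eventually_gt_at_top[of 0] by eventually_elim (simp add: scale)
  ultimately show ?thesis by (simp add: tendsto_cong)
qed

section \<open>Existence for all parameters by raising \<open>\<kappa>\<close>\<close>

lemma wasym_Suc: "x > 0 \<Longrightarrow> wasym (\<kappa> + 1) x = of_real x * wasym \<kappa> x"
  by (simp add: wasym_def powr_add)

lemma tendsto_of_real_inverse: "((\<lambda>x. complex_of_real (1 / x)) \<longlongrightarrow> 0) at_top"
proof -
  have "((\<lambda>x::real. 1 / x) \<longlongrightarrow> 0) at_top" by real_asymp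
  from tendsto_of_real[OF this] show ?thesis unfolding of_real_0 .
qed

text \<open>The contiguity relation \<open>W\<^bsub>\<kappa>+1\<^esub> = (x/2 - \<kappa>) W\<^bsub>\<kappa>\<^esub> - x W\<^bsub>\<kappa>\<^esub>'\<close>.\<close>

lemma recessive_pair_raise:
  assumes "recessive_pair \<kappa> \<mu> u u'"
  shows "\<exists>v v'. recessive_pair (\<kappa> + 1) \<mu> v v'"
proof -
  have U: "whittaker_pair \<kappa> \<mu> u u'" "((\<lambda>x. u x / wasym \<kappa> x) \<longlongrightarrow> 1) at_top"
    "((\<lambda>x. u' x / wasym \<kappa> x) \<longlongrightarrow> -1/2) at_top"
    using assms by (auto simp: recessive_pair_def)
  note ud = whittaker_pairD[OF U(1)]
  define m where "m = 1/4 - \<mu>^2"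
  define v where "v x = (of_real (x/2) - \<kappa>) * u x - of_real x * u' x" for x
  \<comment> \<open>The derivative of \<open>v\<close>, with \<open>u''\<close> eliminated by
    Whittaker's equation.\<close>
  define v' where "v' x = (of_real (1/2 - x/4) + \<kappa> + m * of_real (1/x)) * u x + (of_real (x/2) - \<kappa> - 1) * u' x" for x
  have q: "wcoef \<kappa> \<mu> x = 1/4 - \<kappa> / of_real x - m / (of_real x)^2" for x
    by (simp add: wcoef_def m_def)
  have q1: "wcoef (\<kappa> + 1) \<mu> x = 1/4 - (\<kappa> + 1) / of_real x - m / (of_real x)^2" for x
    by (simp add: wcoef_def m_def)
  have "whittaker_pair (\<kappa> + 1) \<mu> v v'"
    unfolding whittaker_pair_def
  proof (intro allI impI conjI)
    fix x :: real assume x: "x > 0"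
    have d1: "((\<lambda>x. x/2) has_real_derivative 1/2) (at x)" "((\<lambda>x. x) has_real_derivative 1) (at x)"
       "((\<lambda>x. 1/2 - x/4) has_real_derivative -1/4) (at x)"
       "((\<lambda>x. 1/x) has_real_derivative - (1/x^2)) (at x)"
      using x by (auto intro!: derivative_eq_intros simp: power2_eq_square)
    note d = d1[THEN has_vector_derivative_of_real_real]
    have "(v has_vector_derivative ((of_real (x/2) - \<kappa>) * u' x + (of_real (1/2) - 0) * u x) -
        (of_real x * (wcoef \<kappa> \<mu> x * u x) + of_real 1 * u' x)) (at x)"
      unfolding v_def [abs_def]
      by (intro has_vector_derivative_diff has_vector_derivative_mult has_vector_derivative_const d ud x)
    then show "(v has_vector_derivative v' x) (at x)"
      by (rule has_vector_derivative_eq_rhs) (use x in \<open>simp add: v'_def q field_simps power2_eq_square\<close>)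
    have "(v' has_vector_derivative ((of_real (1/2 - x/4) + \<kappa> + m * of_real (1/x)) * u' x
        + (of_real (-1/4) + 0 + (m * of_real (- (1/x^2)) + 0 * of_real (1/x))) * u x)
        + ((of_real (x/2) - \<kappa> - 1) * (wcoef \<kappa> \<mu> x * u x) + (of_real (1/2) - 0 - 0) * u' x)) (at x)"
      unfolding v'_def [abs_def]
      by (intro has_vector_derivative_diff has_vector_derivative_add has_vector_derivative_mult
           has_vector_derivative_const d ud x)
    then show "(v' has_vector_derivative wcoef (\<kappa> + 1) \<mu> x * v x) (at x)"
    proof (rule has_vector_derivative_eq_rhs)
      define X where "X = complex_of_real x"
      have X: "X \<noteq> 0" using x by (simp add: X_def)
      have "(1/2 - X/4 + \<kappa> + m / X) * u' x + (-1/4 - m / X^2) * u x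
          + ((X/2 - \<kappa> - 1) * (wcoef \<kappa> \<mu> x * u x) + 1/2 * u' x) = wcoef (\<kappa> + 1) \<mu> x * v x"
        unfolding v_def q q1 of_real_divide of_real_numeral X_def[symmetric]
        using X by (simp add: field_simps power2_eq_square)
      then show "((of_real (1/2 - x/4) + \<kappa> + m * of_real (1/x)) * u' x
        + (of_real (-1/4) + 0 + (m * of_real (- (1/x^2)) + 0 * of_real (1/x))) * u x)
        + ((of_real (x/2) - \<kappa> - 1) * (wcoef \<kappa> \<mu> x * u x) + (of_real (1/2) - 0 - 0) * u' x)
        = wcoef (\<kappa> + 1) \<mu> x * v x"
        by (simp add: X_def)
    qed
  qed
  \<comment> \<open>To leading order \<open>x/2 * u\<close> and \<open>- x * u'\<close> contribute
    1/2 each, so the normalisation survives. For \<open>v'\<close> the contributions are -1/4 from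
    \<open>u\<close> and 1/2 times -1/2 from \<open>u'\<close>.\<close>
  moreover have "((\<lambda>x. v x / wasym (\<kappa> + 1) x) \<longlongrightarrow> 1) at_top"
  proof -
    have "((\<lambda>x. (1/2 - \<kappa> * of_real (1/x)) * (u x / wasym \<kappa> x) - u' x / wasym \<kappa> x) \<longlongrightarrow> (1/2 - \<kappa> * 0) * 1 - (-1/2)) at_top"
      by (intro tendsto_intros U tendsto_of_real_inverse)
    moreover have "eventually (\<lambda>x. (1/2 - \<kappa> * of_real (1/x)) * (u x / wasym \<kappa> x) - u' x / wasym \<kappa> x = v x / wasym (\<kappa> + 1) x) at_top"
      using eventually_gt_at_top[of 0]
    proof eventually_elim
      case (elim x)
      then show ?case unfolding wasym_Suc[OF elim] v_def using wasym_nonzero[OF elim, of \<kappa>]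
        by (simp add: field_simps)
    qed
    ultimately show ?thesis by (simp add: tendsto_cong)
  qed
  moreover have "((\<lambda>x. v' x / wasym (\<kappa> + 1) x) \<longlongrightarrow> -1/2) at_top"
  proof -
    have "((\<lambda>x. ((1/2 + \<kappa> + m * of_real (1/x)) * of_real (1/x) - 1/4) * (u x / wasym \<kappa> x)
        + (1/2 - (\<kappa> + 1) * of_real (1/x)) * (u' x / wasym \<kappa> x)) \<longlongrightarrow>
        ((1/2 + \<kappa> + m * 0) * 0 - 1/4) * 1 + (1/2 - (\<kappa> + 1) * 0) * (-1/2)) at_top"
      by (intro tendsto_intros U tendsto_of_real_inverse)
    moreover have "eventually (\<lambda>x. ((1/2 + \<kappa> + m * of_real (1/x)) * of_real (1/x) - 1/4) * (u x / wasym \<kappa> x)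
        + (1/2 - (\<kappa> + 1) * of_real (1/x)) * (u' x / wasym \<kappa> x) = v' x / wasym (\<kappa> + 1) x) at_top"
      using eventually_gt_at_top[of 0]
    proof eventually_elim
      case (elim x)
      define X g where "X = complex_of_real x" and "g = wasym \<kappa> x"
      have nz: "X \<noteq> 0" "g \<noteq> 0" using elim wasym_nonzero[OF elim] by (auto simp: X_def g_def)
      have "wasym (\<kappa> + 1) x = X * g" using wasym_Suc[OF elim] by (simp add: X_def g_def)
      then show ?case
        unfolding v'_def of_real_divide of_real_diff of_real_1 of_real_numeral X_def[symmetric] g_def[symmetric]
        using nz by (simp add: field_simps)
    qed
    ultimately show ?thesis by (simp add: tendsto_cong)
  qed
  ultimately show ?thesis unfolding recessive_pair_def by blast
qed

text \<open>The classical formula \<open>W = exp (- x/2) * x^(\<mu> + 1/2) * U(1/2 + \<mu> -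
  \<kappa>, 1 + 2 \<mu>, x)\<close>. The hypothesis says that the exponent \<open>a - 1\<close> of
  \<open>t\<close> in Tricomi's integral has nonnegative real part.\<close>

lemma recessive_pair_base:
  assumes Re: "Re (1/2 + \<mu> - \<kappa>) \<ge> 1"
  shows "\<exists>u u'. recessive_pair \<kappa> \<mu> u u'"
proof -
  define a c where "a = 1/2 + \<mu> - \<kappa>" and "c = \<mu> + \<kappa> - 1/2"
  have a: "Re a \<ge> 1" using Re by (simp add: a_def)
  have Ga: "Gamma a \<noteq> 0" using a by (auto simp: Gamma_eq_zero_iff elim!: nonpos_Ints_cases)
  \<comment> \<open>Up to the sign \<open>(-1)^j\<close>, the \<open>j\<close>-th derivative of
    \<open>I 0\<close>.\<close>
  define I where "I j = kint (a - 1 + of_nat j) c" for j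
  define P where "P x = complex_of_real x powr (\<mu> + 1/2) * of_real (exp (- x/2)) / Gamma a" for x
  \<comment> \<open>The logarithmic derivative of \<open>P\<close>.\<close>
  define s where "s x = (\<mu> + 1/2) * of_real (1/x) - 1/2" for x :: real
  define u where "u x = P x * I 0 x" for x
  define u' where "u' x = P x * (s x * I 0 x - I 1 x)" for x
  have I: "(I j has_vector_derivative - I (Suc j) x) (at x)" if "x > 0" for j x
    using kint_deriv[of "a - 1 + of_nat j" x c] a that by (simp add: I_def algebra_simps)
  have kummer: "of_real x * I 2 x = (2 * \<mu> + 1 - of_real x) * I 1 x + a * I 0 x" if "x > 0" for x
  proof -
    have "a + c + 1 = 2 * \<mu> + 1" by (simp add: a_def c_def)
    moreover have "I 0 = kint (a - 1) c" "I 1 = kint a c" "I 2 = kint (a + 1) c"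
      by (simp_all add: I_def add.commute)
    ultimately show ?thesis using kint_kummer[OF a that, of c] by simp
  qed
  have P: "(P has_vector_derivative s x * P x) (at x)" if "x > 0" for x
  proof -
    have "((\<lambda>x. exp (- x/2)) has_real_derivative exp (- x/2) * (-1/2)) (at x)"
      by (auto intro!: derivative_eq_intros)
    from has_vector_derivative_mult[OF has_vector_derivative_of_real_powr[OF that, of "\<mu> + 1/2"] has_vector_derivative_of_real_real[OF this]]
    have "((\<lambda>x. complex_of_real x powr (\<mu> + 1/2) * of_real (exp (- x/2))) has_vector_derivative
      complex_of_real x powr (\<mu> + 1/2) * complex_of_real (exp (- x/2) * (-1/2)) +
      (\<mu> + 1/2) * complex_of_real (1/x) * complex_of_real x powr (\<mu> + 1/2) * of_real (exp (- x/2))) (at x)" .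
    from has_vector_derivative_mult[OF this has_vector_derivative_const[of "1 / Gamma a"]]
    show ?thesis unfolding P_def [abs_def] times_divide_eq_right mult_1_right
      by (rule has_vector_derivative_eq_rhs) (use Ga that in \<open>simp add: s_def field_simps\<close>)
  qed
  have "whittaker_pair \<kappa> \<mu> u u'"
    unfolding whittaker_pair_def
  proof (intro allI impI conjI)
    fix x :: real assume x: "x > 0"
    have "(u has_vector_derivative P x * - I (Suc 0) x + s x * P x * I 0 x) (at x)"
      unfolding u_def [abs_def] by (intro has_vector_derivative_mult P I x)
    then show "(u has_vector_derivative u' x) (at x)"
      by (rule has_vector_derivative_eq_rhs) (simp add: u'_def algebra_simps)
    have "((\<lambda>x. 1/x) has_real_derivative - (1/x^2)) (at x)"
      using x by (auto intro!: derivative_eq_intros simp: power2_eq_square)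
    note d = has_vector_derivative_of_real_real[OF this]
    have s': "(s has_vector_derivative ((\<mu> + 1/2) * of_real (- (1/x^2)) + 0 * of_real (1/x)) - 0) (at x)"
      unfolding s_def [abs_def]
      by (intro has_vector_derivative_diff has_vector_derivative_mult has_vector_derivative_const d)
    have "(u' has_vector_derivative P x * ((s x * - I (Suc 0) x + (((\<mu> + 1/2) * of_real (- (1/x^2)) + 0 * of_real (1/x)) - 0) * I 0 x)
         - (- I (Suc 1) x)) + s x * P x * (s x * I 0 x - I 1 x)) (at x)"
      unfolding u'_def [abs_def]
      by (intro has_vector_derivative_diff has_vector_derivative_mult P I x s')
    then show "(u' has_vector_derivative wcoef \<kappa> \<mu> x * u x) (at x)"
    proof (rule has_vector_derivative_eq_rhs)
      define X where "X = complex_of_real x"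
      have X: "X \<noteq> 0" using x by (simp add: X_def)
      have I2: "I 2 x = ((2 * \<mu> + 1 - X) * I 1 x + a * I 0 x) / X"
        using kummer[OF x] X by (simp add: X_def field_simps)
      have s: "s x = (\<mu> + 1/2) / X - 1/2" by (simp add: s_def X_def)
      have "(s x * - I 1 x + (\<mu> + 1/2) * (- (1/X^2)) * I 0 x) + I 2 x + s x * (s x * I 0 x - I 1 x)
          = wcoef \<kappa> \<mu> x * I 0 x"
        unfolding I2 s wcoef_def a_def X_def[symmetric] using X
        by (simp add: field_simps power2_eq_square)
      then have "P x * ((s x * - I 1 x + (\<mu> + 1/2) * (- (1/X^2)) * I 0 x) + I 2 x + s x * (s x * I 0 x - I 1 x))
          = P x * (wcoef \<kappa> \<mu> x * I 0 x)" by simp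
      then show "P x * ((s x * - I (Suc 0) x + (((\<mu> + 1/2) * of_real (- (1/x^2)) + 0 * of_real (1/x)) - 0) * I 0 x)
         - (- I (Suc 1) x)) + s x * P x * (s x * I 0 x - I 1 x) = wcoef \<kappa> \<mu> x * u x"
        by (simp add: u_def X_def[symmetric] algebra_simps numeral_2_eq_2)
    qed
  qed
  moreover have ratio: "P x * y / wasym \<kappa> x = complex_of_real x powr a * y / Gamma a" if "x > 0" for x y
  proof -
    have "complex_of_real x powr (\<mu> + 1/2) = complex_of_real x powr a * complex_of_real x powr \<kappa>"
      unfolding powr_add[symmetric] a_def by (simp add: add.commute)
    moreover have "exp (- complex_of_real x / 2) = of_real (exp (- x/2))" by (simp flip: exp_of_real)
    ultimately show ?thesis using that by (simp add: P_def wasym_def)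
  qed
  have lim0: "((\<lambda>x. complex_of_real x powr a * I 0 x / Gamma a) \<longlongrightarrow> Gamma a / Gamma a) at_top"
    using kint_asymptotic[of "a - 1" c] a Ga by (intro tendsto_divide tendsto_const) (auto simp: I_def)
  \<comment> \<open>\<open>I 1\<close> decays by one power of \<open>x\<close> faster than
    \<open>I 0\<close>, so it drops out of the limit of \<open>u' / wasym\<close>, and only the
    limit -1/2 of \<open>s\<close> remains.\<close>
  have lim1: "((\<lambda>x. complex_of_real (1/x) * (complex_of_real x powr (a + 1) * I 1 x / Gamma a)) \<longlongrightarrow> 0 * (Gamma (a + 1) / Gamma a)) at_top"
    using kint_asymptotic[of a c] a Ga by (intro tendsto_mult tendsto_divide tendsto_const tendsto_of_real_inverse) (auto simp: I_def)
  have "((\<lambda>x. u x / wasym \<kappa> x) \<longlongrightarrow> 1) at_top"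
  proof -
    have "eventually (\<lambda>x. u x / wasym \<kappa> x = complex_of_real x powr a * I 0 x / Gamma a) at_top"
      using eventually_gt_at_top[of 0] by eventually_elim (simp only: u_def ratio)
    then show ?thesis using lim0 Ga by (simp add: tendsto_cong)
  qed
  moreover have "((\<lambda>x. u' x / wasym \<kappa> x) \<longlongrightarrow> -1/2) at_top"
  proof -
    have "((\<lambda>x. s x * (complex_of_real x powr a * I 0 x / Gamma a)
       - complex_of_real (1/x) * (complex_of_real x powr (a + 1) * I 1 x / Gamma a)) \<longlongrightarrow>
       ((\<mu> + 1/2) * 0 - 1/2) * (Gamma a / Gamma a) - 0 * (Gamma (a + 1) / Gamma a)) at_top"
      unfolding s_def by (intro tendsto_diff tendsto_mult[OF _ lim0] lim1 tendsto_mult[OF tendsto_const] tendsto_const tendsto_of_real_inverse)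
    moreover have "eventually (\<lambda>x. s x * (complex_of_real x powr a * I 0 x / Gamma a)
       - complex_of_real (1/x) * (complex_of_real x powr (a + 1) * I 1 x / Gamma a) = u' x / wasym \<kappa> x) at_top"
      using eventually_gt_at_top[of 0]
    proof eventually_elim
      case (elim x)
      have "complex_of_real (1/x) * complex_of_real x powr (a + 1) = complex_of_real x powr a"
        using elim by (simp add: powr_add)
      then have "complex_of_real (1/x) * (complex_of_real x powr (a + 1) * I 1 x / Gamma a) = complex_of_real x powr a * I 1 x / Gamma a"
        by (metis mult.assoc times_divide_eq_right)
      then show ?case unfolding u'_def ratio[OF elim] by (simp add: algebra_simps diff_divide_distrib)
    qed
    ultimately show ?thesis using Ga by (simp add: tendsto_cong)
  qed
  ultimately show ?thesis unfolding recessive_pair_def by blast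
qed

text \<open>Lowering \<open>\<kappa>\<close> by a large integer \<open>n\<close> reaches the range
  of the integral representation; \<open>n\<close> raising steps lead back.\<close>

lemma recessive_pair_exists: "\<exists>u u'. recessive_pair \<kappa> \<mu> u u'"
proof -
  obtain n :: nat where n: "1/2 - Re \<mu> + Re \<kappa> \<le> n" using real_arch_simple by blast
  have "\<exists>u u'. recessive_pair (\<kappa> - of_nat n + of_nat k) \<mu> u u'" for k
  proof (induction k)
    case 0
    show ?case using n by (intro recessive_pair_base) simp
  next
    case (Suc k)
    then show ?case using recessive_pair_raise[of "\<kappa> - of_nat n + of_nat k" \<mu>] by (auto simp: algebra_simps)
  qed
  from this[of n] show ?thesis by simp
qed

text \<open>Shows that the definite description denotes: a normalised solution exists, and the
  difference of two of them is \<open>o(wasym)\<close>, hence 0. Uniqueness uses only the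
  asymptotics of the competitor itself, not those of its derivative.\<close>

lemma recessive_pair_whittakerW:
  obtains W' where "recessive_pair \<kappa> \<mu> (whittakerW \<kappa> \<mu>) W'"
proof -
  obtain w w' where w: "recessive_pair \<kappa> \<mu> w w'" using recessive_pair_exists by blast
  \<comment> \<open>The definite description fixes the value 0 on \<open>x \<le> 0\<close>, about
    which a \<open>recessive_pair\<close> says nothing.\<close>
  define w0 where "w0 x = (if x > 0 then w x else 0)" for x
  have w0: "recessive_pair \<kappa> \<mu> w0 w'"
  proof -
    have d0: "(w0 has_vector_derivative w' x) (at x)" if "x > 0" for x
    proof -
      have "(w has_vector_derivative w' x) (at x)" using w that by (auto simp: recessive_pair_def whittaker_pair_def)
      then show ?thesis
        by (rule has_vector_derivative_transform_within_open[of _ _ _ "{0<..}"]) (use that in \<open>auto simp: w0_def\<close>)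
    qed
    have "eventually (\<lambda>x. w0 x / wasym \<kappa> x = w x / wasym \<kappa> x) at_top"
      using eventually_gt_at_top[of 0] by eventually_elim (simp add: w0_def)
    then have "((\<lambda>x. w0 x / wasym \<kappa> x) \<longlongrightarrow> 1) at_top"
      using w by (simp only: tendsto_cong recessive_pair_def)
    moreover have "w0 x = w x" if "x > 0" for x using that by (simp add: w0_def)
    ultimately show ?thesis using w d0 by (simp add: recessive_pair_def whittaker_pair_def)
  qed
  have "whittakerW \<kappa> \<mu> = w0"
    unfolding whittakerW_def wasym_def[symmetric]
  proof (rule the_equality)
    show "whittaker_solution \<kappa> \<mu> w0 \<and> ((\<lambda>x. w0 x / wasym \<kappa> x) \<longlongrightarrow> 1) at_top \<and> (\<forall>x\<le>0. w0 x = 0)"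
      using w0 by (auto simp: whittaker_solution_iff recessive_pair_def w0_def)
  next
    fix u assume "whittaker_solution \<kappa> \<mu> u \<and> ((\<lambda>x. u x / wasym \<kappa> x) \<longlongrightarrow> 1) at_top \<and> (\<forall>x\<le>0. u x = 0)"
    then obtain u' where u: "whittaker_pair \<kappa> \<mu> u u'" "((\<lambda>x. u x / wasym \<kappa> x) \<longlongrightarrow> 1) at_top" "\<And>x. x \<le> 0 \<Longrightarrow> u x = 0"
      by (auto simp: whittaker_solution_iff)
    have W0: "whittaker_pair \<kappa> \<mu> w0 w'" "((\<lambda>x. w0 x / wasym \<kappa> x) \<longlongrightarrow> 1) at_top"
      using w0 by (auto simp: recessive_pair_def)
    have "whittaker_pair \<kappa> \<mu> (\<lambda>x. u x - w0 x) (\<lambda>x. u' x - w' x)"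
      unfolding whittaker_pair_def right_diff_distrib
      by (intro allI impI conjI has_vector_derivative_diff whittaker_pairD[OF u(1)] whittaker_pairD[OF W0(1)])
    moreover have "((\<lambda>x. (u x - w0 x) / wasym \<kappa> x) \<longlongrightarrow> 0) at_top"
      using tendsto_diff[OF u(2) W0(2)] by (simp add: diff_divide_distrib)
    ultimately have "u x - w0 x = 0" if "x > 0" for x
      by (rule whittaker_pair_small_eq_0[OF w0 _ _ that])
    then show "u = w0" using u(3) by (force simp: w0_def not_less)
  qed
  then show ?thesis using w0 that by blast
qed

section \<open>Growth of Whittaker functions\<close>

lemma subexp_polynomial_bound:
  fixes f :: "real \<Rightarrow> complex"
  assumes "\<And>t. t > 0 \<Longrightarrow> norm (f t) \<le> A * t ^ N + B + C * (1/t) ^ M" "A \<ge> 0" "B \<ge> 0" "C \<ge> 0"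
  shows "subexp S (\<lambda>_. f)"
proof (rule subexp_bound)
  show "subexp S (\<lambda>_ t. complex_of_real A * of_real t ^ N + of_real B + of_real C * (1 / of_real t) ^ M)"
    by (intro subexp_intros)
  show "norm (f t) \<le> norm (complex_of_real A * of_real t ^ N + of_real B + of_real C * (1 / of_real t) ^ M)"
    if "t > 0" for t
  proof -
    have "complex_of_real A * of_real t ^ N + of_real B + of_real C * (1 / of_real t) ^ M =
        of_real (A * t ^ N + B + C * (1/t) ^ M)" by simp
    moreover have "norm (complex_of_real (A * t ^ N + B + C * (1/t) ^ M)) = A * t ^ N + B + C * (1/t) ^ M"
      unfolding norm_of_real using that assms by (intro abs_of_nonneg add_nonneg_nonneg mult_nonneg_nonneg zero_le_power) auto
    ultimately show ?thesis using assms(1)[OF that] by simp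
  qed
qed

text \<open>Near infinity the factor \<open>exp (t/2)\<close> cancels the decay of
  \<open>wasym\<close> and leaves a power; near 0 the energy inequality gives a power of
  \<open>1/t\<close>. The factor is kept because the Kummer function in the kernel is
  \<open>W\<close> with this exponential split off.\<close>

lemma recessive_pair_growth:
  assumes "recessive_pair \<kappa> \<mu> w w'"
  shows "subexp S (\<lambda>_ t. of_real (exp (t/2)) * w t)" "subexp S (\<lambda>_ t. of_real (exp (t/2)) * w' t)"
proof -
  have W: "whittaker_pair \<kappa> \<mu> w w'" "((\<lambda>x. w x / wasym \<kappa> x) \<longlongrightarrow> 1) at_top"
    "((\<lambda>x. w' x / wasym \<kappa> x) \<longlongrightarrow> -1/2) at_top"
    using assms by (auto simp: recessive_pair_def)
  have "eventually (\<lambda>x. norm (w x / wasym \<kappa> x) < 2) at_top"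
    using tendsto_norm[OF W(2)] by (rule order_tendstoD) simp
  moreover have "eventually (\<lambda>x. norm (w' x / wasym \<kappa> x) < 2) at_top"
    using tendsto_norm[OF W(3)] by (rule order_tendstoD) simp
  ultimately have "eventually (\<lambda>x. norm (w x / wasym \<kappa> x) < 2 \<and> norm (w' x / wasym \<kappa> x) < 2) at_top"
    by (rule eventually_conj)
  then obtain X0 where X0: "\<And>x. x \<ge> X0 \<Longrightarrow> norm (w x / wasym \<kappa> x) < 2 \<and> norm (w' x / wasym \<kappa> x) < 2"
    by (auto simp: eventually_at_top_linorder)
  define X where "X = max X0 1"
  have X: "X \<ge> 1" "X \<ge> X0" by (auto simp: X_def)
  obtain N :: nat where N: "Re \<kappa> \<le> N" using real_arch_simple by blast
  have large: "exp (t/2) * norm (w t) \<le> 2 * t ^ N \<and> exp (t/2) * norm (w' t) \<le> 2 * t ^ N" if "t \<ge> X" for t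
  proof -
    have t: "t > 0" "t \<ge> 1" "t \<ge> X0" using that X by auto
    have "norm (w t) \<le> 2 * norm (wasym \<kappa> t) \<and> norm (w' t) \<le> 2 * norm (wasym \<kappa> t)"
      using X0[OF t(3)] wasym_nonzero[OF t(1), of \<kappa>] by (auto simp: norm_divide field_simps)
    moreover have "norm (wasym \<kappa> t) \<le> t ^ N * exp (- t/2)"
    proof -
      have "t powr Re \<kappa> \<le> t powr real N" using t N by (intro powr_mono) auto
      then show ?thesis using t by (simp add: norm_wasym powr_realpow)
    qed
    ultimately have "norm (w t) \<le> 2 * t ^ N * exp (- t/2) \<and> norm (w' t) \<le> 2 * t ^ N * exp (- t/2)" by linarith
    then have "exp (t/2) * norm (w t) \<le> exp (t/2) * (2 * t ^ N * exp (- t/2)) \<and>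
        exp (t/2) * norm (w' t) \<le> exp (t/2) * (2 * t ^ N * exp (- t/2))"
      by (intro conjI mult_left_mono) auto
    moreover have "exp (t/2) * (2 * t ^ N * exp (- t/2)) = 2 * t ^ N"
      by (simp add: exp_minus)
    ultimately show ?thesis by (simp only:)
  qed
  obtain M :: nat where M: "\<forall>x. 0 < x \<and> x \<le> X \<longrightarrow>
    x ^ M * ((norm (w x))^2 + (x * norm (w' x))^2) \<le> X ^ M * ((norm (w X))^2 + (X * norm (w' X))^2)"
    using whittaker_energy_monotone[OF W(1)] ..
  define B where "B = X ^ M * ((norm (w X))^2 + (X * norm (w' X))^2)"
  have B: "B \<ge> 0" using X by (auto simp: B_def)
  have small: "norm (w t) \<le> 1 + B * (1/t)^M \<and> norm (w' t) \<le> 1 + B * (1/t)^(M+2)" if t: "0 < t" "t \<le> X" for t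
  proof -
    have "t ^ M * ((norm (w t))^2 + (t * norm (w' t))^2) \<le> B" using M t by (auto simp: B_def)
    then have "t ^ M * (norm (w t))^2 + t ^ M * (t * norm (w' t))^2 \<le> B" by (simp add: distrib_left)
    moreover have "t ^ M * (norm (w t))^2 \<ge> 0" "t ^ M * (t * norm (w' t))^2 \<ge> 0" using t by auto
    ultimately have "t ^ M * (norm (w t))^2 \<le> B" "t ^ M * (t * norm (w' t))^2 \<le> B" by linarith+
    then have "(norm (w t))^2 \<le> B * (1/t)^M" "(norm (w' t))^2 \<le> B * (1/t)^(M+2)"
      using t by (auto simp: field_simps power_add power_mult_distrib power2_eq_square)
    \<comment> \<open>Passes from bounds on squared norms to bounds on norms without square
      roots.\<close>
    moreover have "z \<le> 1 + z^2" for z :: real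
    proof -
      have "0 \<le> (z - 1/2)^2" by simp
      then show ?thesis by (simp add: power2_eq_square algebra_simps)
    qed
    ultimately show ?thesis by (meson add_left_mono order.trans)
  qed
  show "subexp S (\<lambda>_ t. of_real (exp (t/2)) * w t)"
  proof (rule subexp_polynomial_bound[where A = 2 and N = N and B = "exp (X/2)" and C = "exp (X/2) * B" and M = M])
    fix t :: real assume t: "t > 0"
    show "norm (of_real (exp (t/2)) * w t) \<le> 2 * t ^ N + exp (X/2) + exp (X/2) * B * (1/t) ^ M"
    proof (cases "t \<ge> X")
      case True
      then have "norm (of_real (exp (t/2)) * w t) \<le> 2 * t ^ N" using large by (simp add: norm_mult)
      moreover have "exp (X/2) \<ge> 0" "exp (X/2) * B * (1/t) ^ M \<ge> 0" using B t by auto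
      ultimately show ?thesis by linarith
    next
      case False
      then have "norm (of_real (exp (t/2)) * w t) \<le> exp (X/2) * (1 + B * (1/t)^M)"
        unfolding norm_mult using small[of t] t by (intro mult_mono) auto
      moreover have "2 * t ^ N \<ge> 0" using t by simp
      ultimately show ?thesis unfolding distrib_left mult.assoc by linarith
    qed
  qed (use B in auto)
  show "subexp S (\<lambda>_ t. of_real (exp (t/2)) * w' t)"
  proof (rule subexp_polynomial_bound[where A = 2 and N = N and B = "exp (X/2)" and C = "exp (X/2) * B" and M = "M+2"])
    fix t :: real assume t: "t > 0"
    show "norm (of_real (exp (t/2)) * w' t) \<le> 2 * t ^ N + exp (X/2) + exp (X/2) * B * (1/t) ^ (M+2)"
    proof (cases "t \<ge> X")
      case True
      then have "norm (of_real (exp (t/2)) * w' t) \<le> 2 * t ^ N" using large by (simp add: norm_mult)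
      moreover have "exp (X/2) \<ge> 0" "exp (X/2) * B * (1/t) ^ (M+2) \<ge> 0" using B t by auto
      ultimately show ?thesis by linarith
    next
      case False
      then have "norm (of_real (exp (t/2)) * w' t) \<le> exp (X/2) * (1 + B * (1/t)^(M+2))"
        unfolding norm_mult using small[of t] t by (intro mult_mono) auto
      moreover have "2 * t ^ N \<ge> 0" using t by simp
      ultimately show ?thesis unfolding distrib_left mult.assoc by linarith
    qed
  qed (use B in auto)
qed

lemma recessive_pair_subexp:
  assumes "recessive_pair \<kappa> \<mu> w w'"
  shows "subexp S (\<lambda>_. w)" "subexp S (\<lambda>_. w')"
proof -
  have *: "norm z \<le> norm (complex_of_real (exp (t/2)) * z)" if "t > 0" for t z
    using that mult_right_mono[of 1 "exp (t/2)" "norm z"] by (simp add: norm_mult)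
  show "subexp S (\<lambda>_. w)" "subexp S (\<lambda>_. w')"
    by (rule subexp_bound[OF recessive_pair_growth(1)[OF assms] *], simp)
       (rule subexp_bound[OF recessive_pair_growth(2)[OF assms] *], simp)
qed

text \<open>In terms of Tricomi's function, \<open>v(w) = U(-\<alpha>, 1/2, w) = exp (w/2) w\<^bsup>-1/4\<^esup> W\<^bsub>\<alpha>+1/4,1/4\<^esub>(w)\<close>.\<close>

locale kummer_profile =
  fixes \<alpha> :: complex and v v' v'' :: "real \<Rightarrow> complex"
  assumes v: "\<And>w. w > 0 \<Longrightarrow> (v has_vector_derivative v' w) (at w)"
    and v': "\<And>w. w > 0 \<Longrightarrow> (v' has_vector_derivative v'' w) (at w)"
    and kummer: "\<And>w. w > 0 \<Longrightarrow> of_real w * v'' w = of_real (w - 1/2) * v' w - \<alpha> * v w"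
    and v_subexp: "subexp UNIV (\<lambda>_::unit. v)" "subexp UNIV (\<lambda>_::unit. v')" "subexp UNIV (\<lambda>_::unit. v'')"
    and v_asymptotic: "((\<lambda>w. v w / complex_of_real w powr \<alpha>) \<longlongrightarrow> 1) at_top"

lemma kummer_profile_exists:
  "\<exists>v v' v''. kummer_profile \<alpha> v v' v'' \<and>
    (\<forall>w>0. v w = of_real (exp (w/2) * w powr (-1/4)) * whittakerW (\<alpha> + 1/4) (1/4) w)"
proof -
  obtain W' where W': "recessive_pair (\<alpha> + 1/4) (1/4) (whittakerW (\<alpha> + 1/4) (1/4)) W'"
    by (rule recessive_pair_whittakerW)
  define W where "W = whittakerW (\<alpha> + 1/4) (1/4)"
  have rp: "recessive_pair (\<alpha> + 1/4) (1/4) W W'" using W' by (simp add: W_def)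
  then have wp: "whittaker_pair (\<alpha> + 1/4) (1/4) W W'" by (simp add: recessive_pair_def)
  define r where "r w = exp (w/2) * w powr (-1/4)" for w :: real
  \<comment> \<open>The logarithmic derivative of \<open>r\<close>.\<close>
  define s where "s w = 1/2 - 1/(4*w)" for w :: real
  define v where "v w = of_real (r w) * W w" for w
  define v' where "v' w = of_real (r w) * (W' w + of_real (s w) * W w)" for w
  \<comment> \<open>Defined by solving Kummer's equation, so that the equation is immediate and
    growth bounds pass from \<open>v\<close> and \<open>v'\<close> to \<open>v''\<close>. What then
    has to be checked is that this is the derivative of \<open>v'\<close>.\<close>
  define v'' where "v'' w = 1 / of_real w * (of_real (w - 1/2) * v' w - \<alpha> * v w)" for w
  have r: "((\<lambda>w. complex_of_real (r w)) has_vector_derivative of_real (r w * s w)) (at w)" if "w > 0" for w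
  proof (rule has_vector_derivative_of_real_real)
    have "w powr (- (1/4) - 1) = w powr (-1/4) / w" unfolding powr_diff using that by simp
    then show "(r has_real_derivative r w * s w) (at w)"
      using that unfolding r_def [abs_def] s_def
      by (auto intro!: derivative_eq_intros simp: field_simps)
  qed
  have s: "((\<lambda>w. complex_of_real (s w)) has_vector_derivative of_real (1/(4*w^2))) (at w)" if "w > 0" for w
  proof (rule has_vector_derivative_of_real_real)
    show "(s has_real_derivative 1/(4*w^2)) (at w)"
      using that unfolding s_def [abs_def]
      by (auto intro!: derivative_eq_intros simp: power2_eq_square)
  qed
  have "kummer_profile \<alpha> v v' v''"
  proof
    fix w :: real assume w: "w > 0"
    have "(v has_vector_derivative of_real (r w) * W' w + of_real (r w * s w) * W w) (at w)"
      unfolding v_def [abs_def]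
      by (intro has_vector_derivative_mult r w whittaker_pairD[OF wp])
    then show "(v has_vector_derivative v' w) (at w)"
      by (rule has_vector_derivative_eq_rhs) (simp add: v'_def algebra_simps)
    have "(v' has_vector_derivative of_real (r w) * (wcoef (\<alpha> + 1/4) (1/4) w * W w
        + (of_real (s w) * W' w + of_real (1/(4*w^2)) * W w)) + of_real (r w * s w) * (W' w + of_real (s w) * W w)) (at w)"
      unfolding v'_def [abs_def]
      by (intro has_vector_derivative_add has_vector_derivative_mult r s w whittaker_pairD[OF wp])
    then show "(v' has_vector_derivative v'' w) (at w)"
    proof (rule has_vector_derivative_eq_rhs)
      define X R where "X = complex_of_real w" and "R = complex_of_real (r w)"
      have X: "X \<noteq> 0" using w by (simp add: X_def)
      have sX: "complex_of_real (s w) = 1/2 - 1/(4*X)" by (simp add: s_def X_def)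
      have "wcoef (\<alpha> + 1/4) (1/4) w * W w
        + ((1/2 - 1/(4*X)) * W' w + 1/(4*X^2) * W w) + (1/2 - 1/(4*X)) * (W' w + (1/2 - 1/(4*X)) * W w)
        = 1/X * ((X - 1/2) * (W' w + (1/2 - 1/(4*X)) * W w) - \<alpha> * W w)"
        unfolding wcoef_def X_def[symmetric] using X
        by (simp add: field_simps power2_eq_square)
      moreover have "R * (q * W0 + (S * W1 + D * W0)) + R * S * (W1 + S * W0) = Y * (Z * (R * (W1 + S * W0)) - \<alpha> * (R * W0))"
        if "q * W0 + (S * W1 + D * W0) + S * (W1 + S * W0) = Y * (Z * (W1 + S * W0) - \<alpha> * W0)"
        for q W0 W1 S D Y Z :: complex
      proof -
        have "R * (q * W0 + (S * W1 + D * W0)) + R * S * (W1 + S * W0) =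
            R * (q * W0 + (S * W1 + D * W0) + S * (W1 + S * W0))" by (simp add: algebra_simps)
        then show ?thesis unfolding that by (simp add: algebra_simps)
      qed
      ultimately have "R * (wcoef (\<alpha> + 1/4) (1/4) w * W w + ((1/2 - 1/(4*X)) * W' w + 1/(4*X^2) * W w))
          + R * (1/2 - 1/(4*X)) * (W' w + (1/2 - 1/(4*X)) * W w)
        = 1/X * ((X - 1/2) * (R * (W' w + (1/2 - 1/(4*X)) * W w)) - \<alpha> * (R * W w))" by blast
      moreover have "complex_of_real (1/(4*w^2)) = 1/(4*X^2)" "complex_of_real (w - 1/2) = X - 1/2"
        by (simp_all add: X_def)
      ultimately show "of_real (r w) * (wcoef (\<alpha> + 1/4) (1/4) w * W w
        + (of_real (s w) * W' w + of_real (1/(4*w^2)) * W w)) + of_real (r w * s w) * (W' w + of_real (s w) * W w) = v'' w"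
        unfolding v''_def v'_def v_def of_real_mult sX R_def[symmetric] X_def[symmetric] by simp
    qed
    show "of_real w * v'' w = of_real (w - 1/2) * v' w - \<alpha> * v w"
      using w by (simp add: v''_def)
  next
    have p: "subexp UNIV (\<lambda>(_::unit) t. complex_of_real (t powr (-1/4)))"
    proof (rule subexp_real_bound[where M = 1])
      fix t :: real assume t: "t > 0"
      have "t powr (-1/4) \<le> t + 1/t"
      proof (cases "t \<ge> 1")
        case True
        then have "t powr (-1/4) \<le> t powr 0" by (intro powr_mono) auto
        also have "\<dots> \<le> t" using True by simp
        finally show ?thesis using t by (smt (verit) divide_pos_pos)
      next
        case False
        then have "t powr (-1/4) \<le> t powr (-1)" using t by (intro powr_mono') auto
        also have "\<dots> = 1/t" using t by (simp add: powr_minus divide_inverse)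
        finally show ?thesis using t by linarith
      qed
      then show "norm (complex_of_real (t powr (-1/4))) \<le> 1 * (t + 1/t)" by simp
    qed
    have v: "subexp UNIV (\<lambda>_::unit. v)"
    proof -
      have "subexp UNIV (\<lambda>(_::unit) t. complex_of_real (t powr (-1/4)) * (of_real (exp (t/2)) * W t))"
        by (intro subexp_mult p recessive_pair_growth[OF rp])
      then show ?thesis by (simp add: v_def[abs_def] r_def mult_ac)
    qed
    moreover have v': "subexp UNIV (\<lambda>_::unit. v')"
    proof -
      have "subexp UNIV (\<lambda>(_::unit) t. complex_of_real (t powr (-1/4)) * (of_real (exp (t/2)) * W' t) + (1/2 - 1/4 * (1 / of_real t)) * v t)"
        by (intro subexp_intros p v recessive_pair_growth[OF rp])
      then show ?thesis by (simp add: v'_def[abs_def] v_def r_def s_def algebra_simps)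
    qed
    moreover have "subexp UNIV (\<lambda>_::unit. v'')"
      unfolding v''_def [abs_def] of_real_diff by (intro subexp_intros v v')
    ultimately show "subexp UNIV (\<lambda>_::unit. v)" "subexp UNIV (\<lambda>_::unit. v')" "subexp UNIV (\<lambda>_::unit. v'')" by auto
    have "((\<lambda>x. W x / wasym (\<alpha> + 1/4) x) \<longlongrightarrow> 1) at_top" using rp by (simp add: recessive_pair_def)
    moreover have "eventually (\<lambda>x. W x / wasym (\<alpha> + 1/4) x = v x / complex_of_real x powr \<alpha>) at_top"
      using eventually_gt_at_top[of 0]
    proof eventually_elim
      case (elim x)
      have "complex_of_real (x powr (-1/4)) = inverse (complex_of_real x powr (1/4))"
        using elim powr_of_real[of x "1/4"] by (simp add: powr_minus)
      moreover have "exp (- complex_of_real x / 2) = inverse (of_real (exp (x/2)))"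
        by (simp add: exp_minus flip: exp_of_real)
      moreover have "z / (A * B * inverse E) = E * inverse B * z / A" if "E \<noteq> 0" for z A B E :: complex
        using that by (simp add: divide_simps)
      ultimately show ?case
        unfolding v_def r_def wasym_def powr_add of_real_mult by simp
    qed
    ultimately show "((\<lambda>w. v w / complex_of_real w powr \<alpha>) \<longlongrightarrow> 1) at_top" by (simp add: tendsto_cong)
  qed
  moreover have "\<forall>w>0. v w = of_real (exp (w/2) * w powr (-1/4)) * whittakerW (\<alpha> + 1/4) (1/4) w"
    by (simp add: v_def r_def W_def)
  ultimately show ?thesis by blast
qed

section \<open>The product kernel\<close>

text \<open>By the asymptotics of \<open>D\<^bsub>2\<alpha>\<^esub>\<close>, all exponential factors of \<open>k\<^sub>\<alpha>\<close> combine to \<open>exp (- kphi y x \<xi>)\<close>;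
  what remains is the Kummer function \<open>v\<close> of the locale \<open>kummer_profile\<close> at \<open>karg y x \<xi> = z\<^sup>2/2\<close>, where \<open>z\<close> is the argument of \<open>D\<^bsub>2\<alpha>\<^esub>\<close>.\<close>

definition kphi :: "real \<Rightarrow> real \<Rightarrow> real \<Rightarrow> real" where
  "kphi y a b = (a * y / b + a * b / y + y * b / a) / 4"

definition karg :: "real \<Rightarrow> real \<Rightarrow> real \<Rightarrow> real" where
  "karg y a b = kphi y a b + (a + b + y) / 2"

text \<open>The partial derivative of \<open>kphi\<close> in \<open>a\<close>; \<open>kddphi\<close>
  is the second one. Derivatives in \<open>b\<close> are obtained by exchanging the two arguments,
  since \<open>kphi\<close> is symmetric.\<close>

definition kdphi :: "real \<Rightarrow> real \<Rightarrow> real \<Rightarrow> real" where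
  "kdphi y a b = (y / b + b / y - y * b / a^2) / 4"

definition kddphi :: "real \<Rightarrow> real \<Rightarrow> real \<Rightarrow> real" where
  "kddphi y a b = y * b / (2 * a^3)"

text \<open>The logarithmic derivative of \<open>kpre\<close> in \<open>a\<close>.\<close>

definition klog :: "real \<Rightarrow> real \<Rightarrow> real \<Rightarrow> real" where
  "klog y a b = 1 / (2 * a) - kdphi y a b"

definition kpre :: "real \<Rightarrow> real \<Rightarrow> real \<Rightarrow> real" where
  "kpre y a b = sqrt (a * b) * exp (- kphi y a b)"

lemma kphi_commute: "kphi y a b = kphi y b a" by (simp add: kphi_def algebra_simps)
lemma karg_commute: "karg y a b = karg y b a" by (simp add: karg_def kphi_commute[of y a b] algebra_simps)
lemma kpre_commute: "kpre y a b = kpre y b a" by (simp add: kpre_def kphi_commute[of y a b] mult.commute)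

lemma karg_pos: "a > 0 \<Longrightarrow> b > 0 \<Longrightarrow> y > 0 \<Longrightarrow> karg y a b > 0"
  by (auto simp: karg_def kphi_def intro!: add_pos_pos divide_pos_pos)

section \<open>Derivatives of the kernel and its differential equation\<close>

lemma kphi_deriv:
  assumes "a > 0" "b > 0" "y > 0"
  shows "((\<lambda>a. kphi y a b) has_real_derivative kdphi y a b) (at a)"
  using assms unfolding kphi_def kdphi_def
  by (auto intro!: derivative_eq_intros simp: field_simps power2_eq_square)

lemma kdphi_deriv:
  assumes "a > 0" "b > 0" "y > 0"
  shows "((\<lambda>a. kdphi y a b) has_real_derivative kddphi y a b) (at a)"
  using assms unfolding kdphi_def kddphi_def
  by (auto intro!: derivative_eq_intros simp: field_simps power2_eq_square power3_eq_cube)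

lemma karg_deriv:
  assumes "a > 0" "b > 0" "y > 0"
  shows "((\<lambda>a. karg y a b) has_real_derivative kdphi y a b + 1/2) (at a)"
  unfolding karg_def by (auto intro!: derivative_eq_intros kphi_deriv assms)

lemma klog_deriv:
  assumes "a > 0" "b > 0" "y > 0"
  shows "((\<lambda>a. klog y a b) has_real_derivative - (1 / (2 * a^2)) - kddphi y a b) (at a)"
  unfolding klog_def using assms
  by (auto intro!: derivative_eq_intros kdphi_deriv simp: power2_eq_square)

lemma kpre_deriv:
  assumes "a > 0" "b > 0" "y > 0"
  shows "((\<lambda>a. kpre y a b) has_real_derivative kpre y a b * klog y a b) (at a)"
proof -
  have ab: "a * b > 0" using assms by simp
  have s: "((\<lambda>a. sqrt (a * b)) has_real_derivative sqrt (a * b) * (1 / (2 * a))) (at a)"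
  proof -
    have "((\<lambda>a. sqrt (a * b)) has_real_derivative (inverse (sqrt (a * b)) / 2) * b) (at a)"
      by (rule DERIV_chain2[where g = "\<lambda>a. a * b", OF DERIV_real_sqrt[OF ab]]) (auto intro!: derivative_eq_intros)
    moreover have "(inverse (sqrt (a * b)) / 2) * b = sqrt (a * b) * (1 / (2 * a))"
    proof -
      have "sqrt (a * b) * sqrt (a * b) = a * b" using ab by simp
      then show ?thesis using assms ab by (simp add: field_simps del: real_sqrt_mult_self)
    qed
    ultimately show ?thesis by (simp only:)
  qed
  have "((\<lambda>a. exp (- kphi y a b)) has_real_derivative exp (- kphi y a b) * (- kdphi y a b)) (at a)"
    by (auto intro!: derivative_eq_intros kphi_deriv assms)
  from DERIV_mult[OF s this] show ?thesis
    unfolding kpre_def klog_def by (rule DERIV_cong) (simp add: algebra_simps)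
qed

text \<open>This identity and the next two compare the coefficients of \<open>v''\<close>,
  \<open>v'\<close> and \<open>v\<close> in \<open>a^2 * K_aa\<close> with those in
  \<open>b^2 * K_bb\<close>. The differences are \<open>(a - b) * w\<close>,
  \<open>- (a - b) * (w - 1/2)\<close> and \<open>(a^2 - b^2) / 4\<close>, where
  \<open>w = karg y a b\<close>; the first two match the coefficients of Kummer's equation.\<close>

lemma kernel_identity_0:
  assumes "a > 0" "b > 0" "y > 0"
  shows "a^2 * (kdphi y a b + 1/2)^2 - b^2 * (kdphi y b a + 1/2)^2 = (a - b) * karg y a b"
  using assms unfolding karg_def kphi_def kdphi_def by (simp add: field_simps) algebra

lemma kernel_identity_1:
  assumes "a > 0" "b > 0" "y > 0"
  shows "a^2 * (2 * klog y a b * (kdphi y a b + 1/2) + kddphi y a b)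
       - b^2 * (2 * klog y b a * (kdphi y b a + 1/2) + kddphi y b a) + (a - b) * (karg y a b - 1/2) = 0"
  using assms unfolding klog_def karg_def kphi_def kdphi_def kddphi_def by (simp add: field_simps) algebra

lemma kernel_identity_2:
  assumes "a > 0" "b > 0" "y > 0"
  shows "a^2 * (klog y a b ^ 2 - 1 / (2 * a^2) - kddphi y a b) - a^2 / 4
       = b^2 * (klog y b a ^ 2 - 1 / (2 * b^2) - kddphi y b a) - b^2 / 4"
  using assms unfolding klog_def kdphi_def kddphi_def by (simp add: field_simps) algebra

context kummer_profile
begin

definition K :: "real \<Rightarrow> real \<Rightarrow> real \<Rightarrow> complex" where
  "K y a b = of_real (kpre y a b) * v (karg y a b)"

definition Ka :: "real \<Rightarrow> real \<Rightarrow> real \<Rightarrow> complex" where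
  "Ka y a b = of_real (kpre y a b) *
     (of_real (klog y a b) * v (karg y a b) + of_real (kdphi y a b + 1/2) * v' (karg y a b))"

definition Kaa :: "real \<Rightarrow> real \<Rightarrow> real \<Rightarrow> complex" where
  "Kaa y a b = of_real (kpre y a b) *
     (of_real (klog y a b ^ 2 - 1 / (2 * a^2) - kddphi y a b) * v (karg y a b)
      + of_real (2 * klog y a b * (kdphi y a b + 1/2) + kddphi y a b) * v' (karg y a b)
      + of_real ((kdphi y a b + 1/2)^2) * v'' (karg y a b))"

text \<open>Allows \<open>Ka y t x\<close> and \<open>Kaa y t x\<close> to serve as derivatives in
  the integration variable \<open>t\<close>, so only one set of derivatives is computed.\<close>

lemma K_commute: "K y a b = K y b a"
  unfolding K_def kpre_commute[of y a b] karg_commute[of y a b] ..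

lemma K_derivs:
  assumes "a > 0" "b > 0" "y > 0"
  shows "((\<lambda>a. K y a b) has_vector_derivative Ka y a b) (at a)"
    and "((\<lambda>a. Ka y a b) has_vector_derivative Kaa y a b) (at a)"
proof -
  note w = karg_pos[OF assms]
  note r = has_vector_derivative_of_real_real
  have cv: "((\<lambda>a. v (karg y a b)) has_vector_derivative of_real (kdphi y a b + 1/2) * v' (karg y a b)) (at a)"
    using vector_diff_chain_at[OF karg_deriv[OF assms, unfolded has_real_derivative_iff_has_vector_derivative] v[OF w]]
    by (simp add: o_def scaleR_conv_of_real)
  have cv': "((\<lambda>a. v' (karg y a b)) has_vector_derivative of_real (kdphi y a b + 1/2) * v'' (karg y a b)) (at a)"
    using vector_diff_chain_at[OF karg_deriv[OF assms, unfolded has_real_derivative_iff_has_vector_derivative] v'[OF w]]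
    by (simp add: o_def scaleR_conv_of_real)
  have d: "((\<lambda>a. kdphi y a b + 1/2) has_real_derivative kddphi y a b) (at a)"
    by (auto intro!: derivative_eq_intros kdphi_deriv assms)
  have "((\<lambda>a. K y a b) has_vector_derivative
     of_real (kpre y a b) * (of_real (kdphi y a b + 1/2) * v' (karg y a b)) + of_real (kpre y a b * klog y a b) * v (karg y a b)) (at a)"
    unfolding K_def by (intro has_vector_derivative_mult r kpre_deriv assms cv)
  then show "((\<lambda>a. K y a b) has_vector_derivative Ka y a b) (at a)"
    by (rule has_vector_derivative_eq_rhs) (simp add: Ka_def algebra_simps)
  have "((\<lambda>a. Ka y a b) has_vector_derivative
     of_real (kpre y a b) * ((of_real (klog y a b) * (of_real (kdphi y a b + 1/2) * v' (karg y a b))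
        + of_real (- (1 / (2 * a^2)) - kddphi y a b) * v (karg y a b))
      + (of_real (kdphi y a b + 1/2) * (of_real (kdphi y a b + 1/2) * v'' (karg y a b))
        + of_real (kddphi y a b) * v' (karg y a b)))
     + of_real (kpre y a b * klog y a b) *
       (of_real (klog y a b) * v (karg y a b) + of_real (kdphi y a b + 1/2) * v' (karg y a b))) (at a)"
    unfolding Ka_def by (intro has_vector_derivative_add has_vector_derivative_mult r kpre_deriv klog_deriv d assms cv cv')
  then show "((\<lambda>a. Ka y a b) has_vector_derivative Kaa y a b) (at a)"
  proof (rule has_vector_derivative_eq_rhs)
    have e: "P * ((L * (D * V') + (- Q - DD) * V) + (D * (D * V'') + DD * V')) + (P * L) * (L * V + D * V') =
       P * ((L^2 - Q - DD) * V + (2 * L * D + DD) * V' + D^2 * V'')" for P L D V V' V'' Q DD :: complex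
      by (simp add: algebra_simps power2_eq_square)
    show "of_real (kpre y a b) * ((of_real (klog y a b) * (of_real (kdphi y a b + 1/2) * v' (karg y a b))
        + of_real (- (1 / (2 * a^2)) - kddphi y a b) * v (karg y a b))
      + (of_real (kdphi y a b + 1/2) * (of_real (kdphi y a b + 1/2) * v'' (karg y a b))
        + of_real (kddphi y a b) * v' (karg y a b)))
     + of_real (kpre y a b * klog y a b) *
       (of_real (klog y a b) * v (karg y a b) + of_real (kdphi y a b + 1/2) * v' (karg y a b)) = Kaa y a b"
      unfolding Kaa_def of_real_mult of_real_diff of_real_minus of_real_power e
      by (simp only: of_real_add of_real_mult of_real_numeral)
  qed
qed

text \<open>Beyond the terms in \<open>v\<close>, the three coefficient identities leave
  \<open>(a - b) * (w * v'' - (w - 1/2) * v')\<close>. By Kummer's equation this is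
  \<open>- \<alpha> * (a - b) * v\<close>, which is exactly the difference of the first-degree terms
  of the two operators.\<close>

lemma K_pde:
  assumes "a > 0" "b > 0" "y > 0"
  shows "of_real (a^2) * Kaa y a b + (\<alpha> * of_real a - of_real (a^2 / 4)) * K y a b =
         of_real (b^2) * Kaa y b a + (\<alpha> * of_real b - of_real (b^2 / 4)) * K y a b"
proof -
  define w where "w = karg y a b"
  have w: "w > 0" unfolding w_def using karg_pos[OF assms] .
  define c0 c1 c2 where "c0 = (\<lambda>a b. klog y a b ^ 2 - 1 / (2 * a^2) - kddphi y a b)"
    and "c1 = (\<lambda>a b. 2 * klog y a b * (kdphi y a b + 1/2) + kddphi y a b)"
    and "c2 = (\<lambda>a b. (kdphi y a b + 1/2)^2)"
  have i0: "a^2 * c2 a b = b^2 * c2 b a + (a - b) * w"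
    using kernel_identity_0[OF assms] by (simp add: c2_def w_def)
  have i1: "a^2 * c1 a b = b^2 * c1 b a - (a - b) * (w - 1/2)"
    using kernel_identity_1[OF assms] by (simp add: c1_def w_def)
  have i2: "a^2 * c0 a b = b^2 * c0 b a + a^2 / 4 - b^2 / 4"
    using kernel_identity_2[OF assms] by (simp add: c0_def)
  define P where "P = complex_of_real (kpre y a b)"
  have Kab: "Kaa y a b = P * (of_real (c0 a b) * v w + of_real (c1 a b) * v' w + of_real (c2 a b) * v'' w)"
    by (simp add: Kaa_def P_def w_def c0_def c1_def c2_def)
  have Kba: "Kaa y b a = P * (of_real (c0 b a) * v w + of_real (c1 b a) * v' w + of_real (c2 b a) * v'' w)"
    unfolding P_def w_def kpre_commute[of y a b] karg_commute[of y a b]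
    by (simp add: Kaa_def c0_def c1_def c2_def)
  have "of_real (a^2) * Kaa y a b = P * (of_real (a^2 * c0 a b) * v w + of_real (a^2 * c1 a b) * v' w + of_real (a^2 * c2 a b) * v'' w)"
    unfolding Kab of_real_mult by (simp add: algebra_simps)
  also have "\<dots> = of_real (b^2) * Kaa y b a + P * (of_real (a^2 / 4 - b^2 / 4) * v w - of_real (a - b) * (of_real (w - 1/2) * v' w) + of_real (a - b) * (of_real w * v'' w))"
    unfolding i0 i1 i2 Kba of_real_mult of_real_add of_real_diff by (simp add: algebra_simps)
  also have "\<dots> = of_real (b^2) * Kaa y b a + P * v w * (of_real (a^2 / 4 - b^2 / 4) - \<alpha> * of_real (a - b))"
    unfolding kummer[OF w] by (simp add: algebra_simps)
  finally show ?thesis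
    unfolding K_def P_def[symmetric] w_def[symmetric] by (simp add: algebra_simps)
qed

end

section \<open>Majorants for the kernel, locally uniform in \<open>x\<close>\<close>

lemma subexp_param [subexp_intros]:
  assumes "0 < x1"
  shows "subexp {x1..x2} (\<lambda>a t. complex_of_real a)" "subexp {x1..x2} (\<lambda>a t. 1 / complex_of_real a)"
  by (rule subexp_bounded[of _ _ x2], use assms in simp)
     (rule subexp_bounded[of _ _ "1/x1"], use assms in \<open>auto simp: norm_divide frac_le\<close>)

lemma subexp_sqrt:
  assumes "0 < x1"
  shows "subexp {x1..x2} (\<lambda>a t. complex_of_real (sqrt (a * t)))"
proof (rule subexp_bound)
  show "subexp {x1..x2} (\<lambda>a t. complex_of_real a + of_real t)" using assms by (intro subexp_intros)
  show "norm (complex_of_real (sqrt (a * t))) \<le> norm (complex_of_real a + of_real t)"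
    if "a \<in> {x1..x2}" "t > 0" for a t
  proof -
    have "sqrt (a * t) \<le> (a + t) / 2" using that assms by (intro arith_geo_mean_sqrt) auto
    then show ?thesis using that assms unfolding of_real_add[symmetric] norm_of_real by simp
  qed
qed

lemma kernel_coefficients_subexp:
  assumes "0 < x1" "y > 0"
  shows "subexp {x1..x2} (\<lambda>a t. complex_of_real (klog y a t))"
    "subexp {x1..x2} (\<lambda>a t. complex_of_real (kdphi y a t))"
    "subexp {x1..x2} (\<lambda>a t. complex_of_real (kddphi y a t))"
    "subexp {x1..x2} (\<lambda>a t. complex_of_real (klog y t a))"
    "subexp {x1..x2} (\<lambda>a t. complex_of_real (kdphi y t a))"
proof -
  have d: "complex_of_real (kdphi y a t) = (of_real y * (1 / of_real t) + of_real t * of_real (1/y) - of_real y * of_real t * (1 / of_real a)^2) * of_real (1/4)" for a t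
    by (simp add: kdphi_def power_divide)
  have l: "complex_of_real (klog y a t) = of_real (1/2) * (1 / of_real a) - of_real (kdphi y a t)" for a t
    by (simp add: klog_def)
  have dd: "complex_of_real (kddphi y a t) = of_real (y/2) * of_real t * (1 / of_real a)^3" for a t
    by (simp add: kddphi_def power_divide)
  show 1: "subexp {x1..x2} (\<lambda>a t. complex_of_real (kdphi y a t))" unfolding d using assms(1) by (intro subexp_intros)
  show 2: "subexp {x1..x2} (\<lambda>a t. complex_of_real (kdphi y t a))" unfolding d using assms(1) by (intro subexp_intros)
  show "subexp {x1..x2} (\<lambda>a t. complex_of_real (klog y a t))" unfolding l using assms(1) by (intro subexp_intros 1)
  show "subexp {x1..x2} (\<lambda>a t. complex_of_real (klog y t a))" unfolding l using assms(1) by (intro subexp_intros 2)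
  show "subexp {x1..x2} (\<lambda>a t. complex_of_real (kddphi y a t))" unfolding dd using assms(1) by (intro subexp_intros)
qed

text \<open>Supplies the hypothesis of \<open>subexp_compose\<close>. The reciprocal is harmless
  because \<open>karg\<close> never falls below \<open>y / 2\<close>.\<close>

lemma karg_bound:
  assumes "0 < x1" "y > 0"
  obtains M where "\<And>a t. a \<in> {x1..x2} \<Longrightarrow> t > 0 \<Longrightarrow> karg y a t > 0 \<and> karg y a t + 1 / karg y a t \<le> M * (t + 1/t)"
proof -
  \<comment> \<open>The terms of \<open>karg\<close> are each bounded by a multiple of
    \<open>t + 1/t \<ge> 1\<close>, and \<open>M\<close> collects the factors; the final
    \<open>2 / y\<close> belongs to the reciprocal.\<close>
  define M where "M = \<bar>x2\<bar> * y / 4 + \<bar>x2\<bar> / (4 * y) + y / (4 * x1) + (\<bar>x2\<bar> + 1 + y) / 2 + 2 / y"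
  have "karg y a t > 0 \<and> karg y a t + 1 / karg y a t \<le> M * (t + 1/t)" if at: "a \<in> {x1..x2}" "t > 0" for a t
  proof -
    define T where "T = t + 1/t"
    have a: "0 < a" "a \<le> \<bar>x2\<bar>" "x1 \<le> a" using at assms by auto
    have T: "t \<le> T" "1/t \<le> T" using at by (auto simp: T_def)
    have T1: "1 \<le> T"
    proof (cases "t \<ge> 1")
      case False
      then have "1 \<le> 1/t" using at by simp
      then show ?thesis using T by linarith
    qed (use T in linarith)
    have w: "karg y a t > 0" using karg_pos a at assms by auto
    have wy: "karg y a t \<ge> y / 2"
      using a at assms by (auto simp: karg_def kphi_def field_simps intro!: add_nonneg_nonneg)
    then have "1 / karg y a t \<le> 1 / (y / 2)" using assms by (intro frac_le) auto
    then have 0: "1 / karg y a t \<le> 2 / y * T"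
      using T1 assms mult_left_mono[of 1 T "2 / y"] by simp
    have 1: "a * y / t \<le> \<bar>x2\<bar> * y * T"
    proof -
      have "(a * y) * (1/t) \<le> (\<bar>x2\<bar> * y) * T" using a T at assms by (intro mult_mono) auto
      then show ?thesis by simp
    qed
    have 2: "a * t / y \<le> \<bar>x2\<bar> / y * T"
    proof -
      have "(a / y) * t \<le> (\<bar>x2\<bar> / y) * T" using a T at assms by (intro mult_mono divide_right_mono) auto
      then show ?thesis by simp
    qed
    have 3: "y * t / a \<le> y / x1 * T"
    proof -
      have "(y / a) * t \<le> (y / x1) * T" using a T at assms by (intro mult_mono divide_left_mono) auto
      then show ?thesis by simp
    qed
    have 4: "a \<le> \<bar>x2\<bar> * T" "y \<le> y * T"
      using a T1 assms mult_left_mono[of 1 T "\<bar>x2\<bar>"] mult_left_mono[of 1 T y] by auto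
    have "M * T = (\<bar>x2\<bar> * y * T + \<bar>x2\<bar> / y * T + y / x1 * T) / 4 + (\<bar>x2\<bar> * T + T + y * T) / 2 + 2 / y * T"
      unfolding M_def using assms by (simp add: field_simps)
    moreover have "karg y a t \<le> (\<bar>x2\<bar> * y * T + \<bar>x2\<bar> / y * T + y / x1 * T) / 4 + (\<bar>x2\<bar> * T + T + y * T) / 2"
      unfolding karg_def kphi_def using 1 2 3 4 T by (intro add_mono divide_right_mono) auto
    ultimately show ?thesis using 0 w unfolding T_def[symmetric] by linarith
  qed
  then show ?thesis using that by blast
qed

text \<open>The terms \<open>a * y / t\<close> and \<open>a * t / y\<close> of the phase penalise
  the two ends of the half line; with \<open>a \<ge> x1\<close> they give the rate
  \<open>d\<close>.\<close>

lemma exp_kphi_bound: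
  assumes "0 < x1" "y > 0"
  obtains d where "d > 0" "\<And>a t. a \<in> {x1..x2} \<Longrightarrow> t > 0 \<Longrightarrow>
    norm (complex_of_real (exp (- kphi y a t))) \<le> exp (- (d * (t + 1/t)))"
proof -
  define d where "d = min (x1 * y) (x1 / y) / 4"
  have d: "d > 0" "d \<le> x1 * y / 4" "d \<le> x1 / y / 4" using assms by (auto simp: d_def min_def)
  have "d * (t + 1/t) \<le> kphi y a t" if "a \<in> {x1..x2}" "t > 0" for a t
  proof -
    have "d * t \<le> a * t / y / 4"
    proof -
      have "d * t \<le> (x1 / y / 4) * t" using d that by (intro mult_right_mono) auto
      also have "\<dots> \<le> (a / y / 4) * t" using that assms by (intro mult_right_mono divide_right_mono) auto
      finally show ?thesis by simp
    qed
    moreover have "d * (1/t) \<le> a * y / t / 4"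
    proof -
      have "d * (1/t) \<le> (x1 * y / 4) * (1/t)" using d that by (intro mult_right_mono) auto
      also have "\<dots> \<le> (a * y / 4) * (1/t)" using that assms by (intro mult_right_mono divide_right_mono) auto
      finally show ?thesis by simp
    qed
    moreover have "y * t / a / 4 \<ge> 0" using that assms by auto
    moreover have "kphi y a t = a * y / t / 4 + a * t / y / 4 + y * t / a / 4"
      by (simp add: kphi_def add_divide_distrib)
    ultimately show ?thesis unfolding distrib_left by linarith
  qed
  then show ?thesis using that[of d] d(1) by simp
qed

lemma subexp_kphi_dominated:
  assumes "0 < x1" "y > 0" "subexp {x1..x2} S"
  shows "\<exists>C d. d > 0 \<and> (\<forall>a\<in>{x1..x2}. \<forall>t>0.
    norm (S a t * of_real (exp (- kphi y a t))) \<le> C * exp (- (d * (t + 1/t))))"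
proof -
  obtain d where d: "d > 0" "\<And>a t. a \<in> {x1..x2} \<Longrightarrow> t > 0 \<Longrightarrow>
    norm (complex_of_real (exp (- kphi y a t))) \<le> exp (- (d * (t + 1/t)))"
    using exp_kphi_bound[OF assms(1,2)] by metis
  obtain C where "\<And>a t. a \<in> {x1..x2} \<Longrightarrow> t > 0 \<Longrightarrow>
    norm (S a t * of_real (exp (- kphi y a t))) \<le> C * exp (- (d / 2 * (t + 1/t)))"
    using subexp_times_exp_bound[OF assms(3) d(1), where E = "\<lambda>a t. complex_of_real (exp (- kphi y a t))", OF d(2)] by metis
  then show ?thesis using d(1) by (intro exI[of _ C] exI[of _ "d / 2"]) auto
qed

context kummer_profile
begin

lemma v_karg_subexp:
  assumes "0 < x1" "y > 0"
  shows "subexp {x1..x2} (\<lambda>a t. v (karg y a t))" "subexp {x1..x2} (\<lambda>a t. v' (karg y a t))"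
    "subexp {x1..x2} (\<lambda>a t. v'' (karg y a t))"
proof -
  obtain M where M: "\<And>a t. a \<in> {x1..x2} \<Longrightarrow> t > 0 \<Longrightarrow> karg y a t > 0 \<and> karg y a t + 1 / karg y a t \<le> M * (t + 1/t)"
    using karg_bound[OF assms] by metis
  show "subexp {x1..x2} (\<lambda>a t. v (karg y a t))" "subexp {x1..x2} (\<lambda>a t. v' (karg y a t))"
    "subexp {x1..x2} (\<lambda>a t. v'' (karg y a t))"
    by (rule subexp_compose[OF v_subexp(1) M] subexp_compose[OF v_subexp(2) M] subexp_compose[OF v_subexp(3) M]; assumption)+
qed

text \<open>Each expression is a subexponential factor times \<open>exp (- kphi)\<close>. The power
  \<open>n = 2\<close> serves the integrals with weight \<open>1 / t^2\<close>, the power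
  \<open>n = 0\<close> the boundary terms of the integration by parts; the last bound concerns the
  derivative in \<open>t\<close>.\<close>

lemma kernel_dominated:
  assumes "0 < x1" "y > 0" and W: "subexp {x1..x2} (\<lambda>_. W)"
  obtains C d where "d > 0"
    "\<And>x t. x \<in> {x1..x2} \<Longrightarrow> t > 0 \<Longrightarrow> norm (W t * K y x t * (1 / of_real t)^n) \<le> C * exp (- (d * (t + 1/t)))"
    "\<And>x t. x \<in> {x1..x2} \<Longrightarrow> t > 0 \<Longrightarrow> norm (W t * Ka y x t * (1 / of_real t)^n) \<le> C * exp (- (d * (t + 1/t)))"
    "\<And>x t. x \<in> {x1..x2} \<Longrightarrow> t > 0 \<Longrightarrow> norm (W t * Kaa y x t * (1 / of_real t)^n) \<le> C * exp (- (d * (t + 1/t)))"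
    "\<And>x t. x \<in> {x1..x2} \<Longrightarrow> t > 0 \<Longrightarrow> norm (W t * Ka y t x * (1 / of_real t)^n) \<le> C * exp (- (d * (t + 1/t)))"
proof -
  have dom: "\<exists>C d. d > 0 \<and> (\<forall>x\<in>{x1..x2}. \<forall>t>0. norm (f x t) \<le> C * exp (- (d * (t + 1/t))))"
    if S: "subexp {x1..x2} S" and f: "\<And>x t. f x t = W t * (1 / of_real t)^n * of_real (sqrt (x * t)) * S x t * of_real (exp (- kphi y x t))"
    for f S
  proof -
    have "subexp {x1..x2} (\<lambda>x t. W t * (1 / of_real t)^n * of_real (sqrt (x * t)) * S x t)"
      by (intro subexp_intros subexp_sqrt W S assms)
    from subexp_kphi_dominated[OF assms(1,2) this] show ?thesis unfolding f .
  qed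
  note vs = v_karg_subexp[OF assms(1,2)] and ps = kernel_coefficients_subexp[OF assms(1,2)]
  have 1: "\<exists>C d. d > 0 \<and> (\<forall>x\<in>{x1..x2}. \<forall>t>0. norm (W t * K y x t * (1 / of_real t)^n) \<le> C * exp (- (d * (t + 1/t))))"
    by (rule dom[OF vs(1)]) (simp add: K_def kpre_def mult_ac)
  have 2: "\<exists>C d. d > 0 \<and> (\<forall>x\<in>{x1..x2}. \<forall>t>0. norm (W t * Ka y x t * (1 / of_real t)^n) \<le> C * exp (- (d * (t + 1/t))))"
  proof (rule dom)
    show "subexp {x1..x2} (\<lambda>a t. of_real (klog y a t) * v (karg y a t) + (of_real (kdphi y a t) + of_real (1/2)) * v' (karg y a t))"
      by (intro subexp_intros ps vs assms)
  qed (simp add: Ka_def kpre_def mult_ac)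
  have 3: "\<exists>C d. d > 0 \<and> (\<forall>x\<in>{x1..x2}. \<forall>t>0. norm (W t * Kaa y x t * (1 / of_real t)^n) \<le> C * exp (- (d * (t + 1/t))))"
  proof (rule dom)
    show "subexp {x1..x2} (\<lambda>a t. (of_real (klog y a t) ^ 2 - of_real (1/2) * (1 / of_real a)^2 - of_real (kddphi y a t)) * v (karg y a t)
      + (2 * of_real (klog y a t) * (of_real (kdphi y a t) + of_real (1/2)) + of_real (kddphi y a t)) * v' (karg y a t)
      + (of_real (kdphi y a t) + of_real (1/2))^2 * v'' (karg y a t))"
      by (intro subexp_intros ps vs assms)
  qed (simp add: Kaa_def kpre_def mult_ac power_divide)
  have 4: "\<exists>C d. d > 0 \<and> (\<forall>x\<in>{x1..x2}. \<forall>t>0. norm (W t * Ka y t x * (1 / of_real t)^n) \<le> C * exp (- (d * (t + 1/t))))"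
  proof (rule dom)
    show "subexp {x1..x2} (\<lambda>a t. of_real (klog y t a) * v (karg y a t) + (of_real (kdphi y t a) + of_real (1/2)) * v' (karg y a t))"
      by (intro subexp_intros ps vs assms)
    fix x t
    show "W t * Ka y t x * (1 / of_real t)^n = W t * (1 / of_real t)^n * of_real (sqrt (x * t)) *
      (of_real (klog y t x) * v (karg y x t) + (of_real (kdphi y t x) + of_real (1/2)) * v' (karg y x t)) * of_real (exp (- kphi y x t))"
      unfolding Ka_def karg_commute[of y t x] kpre_commute[of y t x] by (simp add: kpre_def mult_ac)
  qed
  obtain C1 d1 where c1: "d1 > 0" "\<And>x t. x \<in> {x1..x2} \<Longrightarrow> t > 0 \<Longrightarrow> norm (W t * K y x t * (1 / of_real t)^n) \<le> C1 * exp (- (d1 * (t + 1/t)))" using 1 by metis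
  obtain C2 d2 where c2: "d2 > 0" "\<And>x t. x \<in> {x1..x2} \<Longrightarrow> t > 0 \<Longrightarrow> norm (W t * Ka y x t * (1 / of_real t)^n) \<le> C2 * exp (- (d2 * (t + 1/t)))" using 2 by metis
  obtain C3 d3 where c3: "d3 > 0" "\<And>x t. x \<in> {x1..x2} \<Longrightarrow> t > 0 \<Longrightarrow> norm (W t * Kaa y x t * (1 / of_real t)^n) \<le> C3 * exp (- (d3 * (t + 1/t)))" using 3 by metis
  obtain C4 d4 where c4: "d4 > 0" "\<And>x t. x \<in> {x1..x2} \<Longrightarrow> t > 0 \<Longrightarrow> norm (W t * Ka y t x * (1 / of_real t)^n) \<le> C4 * exp (- (d4 * (t + 1/t)))" using 4 by metis
  \<comment> \<open>The four bounds are merged into one with the largest constant and the smallest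
    rate needed.\<close>
  define C where "C = \<bar>C1\<bar> + \<bar>C2\<bar> + \<bar>C3\<bar> + \<bar>C4\<bar>"
  define d where "d = min (min d1 d2) (min d3 d4)"
  have le: "Ci * exp (- (di * (t + 1/t))) \<le> C * exp (- (d * (t + 1/t)))" if "t > 0" "Ci \<le> C" "d \<le> di" for Ci di t
  proof -
    have "d * (t + 1/t) \<le> di * (t + 1/t)" using that by (intro mult_right_mono) auto
    then show ?thesis using that by (intro mult_mono) (auto simp: C_def)
  qed
  show ?thesis
  proof (rule that[of d C])
    show "d > 0" by (simp add: d_def c1 c2 c3 c4)
    fix x t :: real assume xt: "x \<in> {x1..x2}" "t > 0"
    show "norm (W t * K y x t * (1 / of_real t)^n) \<le> C * exp (- (d * (t + 1/t)))"
      by (rule order.trans[OF c1(2)[OF xt] le[OF xt(2)]]) (auto simp: C_def d_def)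
    show "norm (W t * Ka y x t * (1 / of_real t)^n) \<le> C * exp (- (d * (t + 1/t)))"
      by (rule order.trans[OF c2(2)[OF xt] le[OF xt(2)]]) (auto simp: C_def d_def)
    show "norm (W t * Kaa y x t * (1 / of_real t)^n) \<le> C * exp (- (d * (t + 1/t)))"
      by (rule order.trans[OF c3(2)[OF xt] le[OF xt(2)]]) (auto simp: C_def d_def)
    show "norm (W t * Ka y t x * (1 / of_real t)^n) \<le> C * exp (- (d * (t + 1/t)))"
      by (rule order.trans[OF c4(2)[OF xt] le[OF xt(2)]]) (auto simp: C_def d_def)
  qed
qed


text \<open>The right-hand side of the product formula without the factor
  \<open>sqrt y / (2 * sqrt pi)\<close>.\<close>

definition Kint :: "(real \<Rightarrow> complex) \<Rightarrow> real \<Rightarrow> real \<Rightarrow> complex" where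
  "Kint W y x = integral {0<..} (\<lambda>t. W t * K y x t * (1 / of_real t)^2)"

lemma kernel_integrand_integrable:
  assumes "x > 0" "y > 0" and W: "continuous_on {0<..} W" "\<And>S. subexp S (\<lambda>_::real. W)"
  shows "(\<lambda>t. W t * K y x t * (1 / of_real t)^2) absolutely_integrable_on {0<..}"
proof -
  obtain C d where Cd: "d > 0"
    "\<And>x' t. x' \<in> {x..x} \<Longrightarrow> t > 0 \<Longrightarrow> norm (W t * K y x' t * (1 / of_real t)^2) \<le> C * exp (- (d * (t + 1/t)))"
    using kernel_dominated[OF assms(1,2) W(2), of x 2] by metis
  have "continuous_on {0<..} (\<lambda>t. K y x t)"
  proof (rule continuous_on_has_vector_derivative)
    fix t :: real assume "t \<in> {0<..}"
    then show "((\<lambda>t. K y x t) has_vector_derivative Ka y t x) (at t)"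
      unfolding K_commute[of y x] using K_derivs(1)[of t x y] assms by simp
  qed
  then have "continuous_on {0<..} (\<lambda>t. W t * K y x t * (1 / of_real t)^2)"
    by (intro continuous_intros W) auto
  then show ?thesis
    by (rule continuous_bounded_by_integrable_imp_integrable[OF _ _ integrable_on_exp_two_ended[OF Cd(1), of C]])
       (use Cd(2) in auto)
qed

text \<open>Differentiating twice under the integral puts the operator on \<open>K\<close> in
  \<open>x\<close>; \<open>K_pde\<close> moves it to \<open>t\<close>, and Lagrange's identity moves
  it on to \<open>W\<close>, where Whittaker's equation applies.\<close>

lemma Kint_solves_whittaker:
  assumes "y > 0" and W: "recessive_pair \<alpha> \<nu> W W'"
  shows "\<exists>F'. whittaker_pair \<alpha> \<nu> (Kint W y) F'"
proof -
  have wp: "whittaker_pair \<alpha> \<nu> W W'" using W by (simp add: recessive_pair_def)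
  note Wd = whittaker_pairD[OF wp]
  have cW: "continuous_on {0<..} W"
    by (rule continuous_on_has_vector_derivative[where f' = W']) (use Wd in auto)
  note sW = recessive_pair_subexp[OF W]
  define f where "f x t = W t * K y x t * (1 / of_real t)^2" for x t
  define f1 where "f1 x t = W t * Ka y x t * (1 / of_real t)^2" for x t
  define f2 where "f2 x t = W t * Kaa y x t * (1 / of_real t)^2" for x t
  have fint: "f x integrable_on {0<..}" if "x > 0" for x
    unfolding f_def [abs_def]
    by (rule set_lebesgue_integral_eq_integral(1)[OF kernel_integrand_integrable[OF that assms(1) cW sW(1)]])
  have df: "((\<lambda>x. f x t) has_vector_derivative f1 x t) (at x)" if "x > 0" "t > 0" for x t
    unfolding f_def f1_def
    by (intro has_vector_derivative_mult_left has_vector_derivative_mult_right K_derivs that assms)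
  have df1: "((\<lambda>x. f1 x t) has_vector_derivative f2 x t) (at x)" if "x > 0" "t > 0" for x t
    unfolding f1_def f2_def
    by (intro has_vector_derivative_mult_left has_vector_derivative_mult_right K_derivs that assms)
  define F1 where "F1 x = integral {0<..} (f1 x)" for x
  have dF: "f1 x integrable_on {0<..}" "(Kint W y has_vector_derivative F1 x) (at x)" if x: "x > 0" for x
  proof -
    obtain C d where Cd: "d > 0"
      "\<And>x' t. x' \<in> {x/2..2*x} \<Longrightarrow> t > 0 \<Longrightarrow> norm (W t * Ka y x' t * (1 / of_real t)^2) \<le> C * exp (- (d * (t + 1/t)))"
      using kernel_dominated[OF _ assms(1) sW(1), of "x/2" "2*x" 2] x by (metis half_gt_zero)
    have *: "f1 x integrable_on {0<..}"
      "((\<lambda>x. integral {0<..} (f x)) has_vector_derivative integral {0<..} (f1 x)) (at x)"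
      by (rule has_vector_derivative_integral_dominated[where a = "x/2" and b = "2*x" and f = f and f' = f1 and g = "\<lambda>t. C * exp (- (d * (t + 1/t)))"];
          use x Cd(2) fint df integrable_on_exp_two_ended[OF Cd(1), of C] in \<open>auto simp: f1_def\<close>)+
    show "f1 x integrable_on {0<..}" by (rule *)
    show "(Kint W y has_vector_derivative F1 x) (at x)"
    proof -
      have "Kint W y = (\<lambda>x. integral {0<..} (f x))"
        by (intro ext) (simp add: Kint_def f_def[abs_def])
      then show ?thesis using *(2) by (simp add: F1_def)
    qed
  qed
  have dF1: "f2 x integrable_on {0<..}" "(F1 has_vector_derivative integral {0<..} (f2 x)) (at x)" if x: "x > 0" for x
  proof -
    obtain C d where Cd: "d > 0"
      "\<And>x' t. x' \<in> {x/2..2*x} \<Longrightarrow> t > 0 \<Longrightarrow> norm (W t * Kaa y x' t * (1 / of_real t)^2) \<le> C * exp (- (d * (t + 1/t)))"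
      using kernel_dominated[OF _ assms(1) sW(1), of "x/2" "2*x" 2] x by (metis half_gt_zero)
    have *: "f2 x integrable_on {0<..}"
      "((\<lambda>x. integral {0<..} (f1 x)) has_vector_derivative integral {0<..} (f2 x)) (at x)"
      by (rule has_vector_derivative_integral_dominated[where a = "x/2" and b = "2*x" and f = f1 and f' = f2 and g = "\<lambda>t. C * exp (- (d * (t + 1/t)))"];
          use x Cd(2) dF(1) df1 integrable_on_exp_two_ended[OF Cd(1), of C] in \<open>auto simp: f2_def\<close>)+
    show "f2 x integrable_on {0<..}" by (rule *)
    show "(F1 has_vector_derivative integral {0<..} (f2 x)) (at x)"
      using *(2) by (simp add: F1_def[abs_def])
  qed
  have eq: "integral {0<..} (f2 x) = wcoef \<alpha> \<nu> x * Kint W y x" if x: "x > 0" for x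
  proof -
    \<comment> \<open>The \<open>t\<close>-derivative of the Wronskian-type expression
      \<open>W * K_t - W' * K\<close>, whose integral vanishes because that expression tends to 0 at
      both ends.\<close>
    define g where "g t = W t * Kaa y t x - wcoef \<alpha> \<nu> t * W t * K y t x" for t
    \<comment> \<open>Here the kernel equation enters. The factor \<open>t^2\<close> of the operator
      in \<open>t\<close> cancels the weight \<open>1 / t^2\<close>, so \<open>g\<close> carries no
      weight, while \<open>x^2\<close> comes out as a constant.\<close>
    have g_eq: "g t = of_real (x^2) * (f2 x t - wcoef \<alpha> \<nu> x * f x t)" if t: "t > 0" for t
    proof -
      define X T where "X = complex_of_real x" and "T = complex_of_real t"
      have nz: "X \<noteq> 0" "T \<noteq> 0" using x t by (auto simp: X_def T_def)
      have pde: "X^2 * Kaa y x t + (\<alpha> * X - X^2/4) * K y x t = T^2 * Kaa y t x + (\<alpha> * T - T^2/4) * K y x t"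
        using K_pde[OF x t assms(1)] by (simp add: X_def T_def)
      have "T^2 * (g t) = W t * (T^2 * Kaa y t x) + (\<alpha> * T - T^2/4 + (1/4 - \<nu>^2)) * W t * K y x t"
        unfolding g_def wcoef_def T_def[symmetric] K_commute[of y t x] using nz
        by (simp add: field_simps power2_eq_square)
      also have "T^2 * Kaa y t x = X^2 * Kaa y x t + (\<alpha> * X - X^2/4) * K y x t - (\<alpha> * T - T^2/4) * K y x t"
        using pde by (simp add: algebra_simps)
      finally have Tg: "T^2 * g t = W t * (X^2 * Kaa y x t) + (\<alpha> * X - X^2/4 + (1/4 - \<nu>^2)) * (W t * K y x t)"
        by (simp add: algebra_simps)
      have wX: "X^2 * wcoef \<alpha> \<nu> x = - (\<alpha> * X - X^2/4 + (1/4 - \<nu>^2))"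
        unfolding wcoef_def X_def[symmetric] using nz by (simp add: field_simps power2_eq_square)
      have "T^2 * g t = W t * (X^2 * Kaa y x t) - X^2 * wcoef \<alpha> \<nu> x * (W t * K y x t)"
        unfolding Tg wX by (simp only: mult_minus_left diff_minus_eq_add)
      then show ?thesis
        unfolding f_def f2_def T_def[symmetric] of_real_power X_def[symmetric] using nz
        by (simp add: field_simps)
    qed
    obtain C d where Cd: "d > 0"
      "\<And>x' t. x' \<in> {x..x} \<Longrightarrow> t > 0 \<Longrightarrow> norm (W t * K y x' t * (1 / of_real t)^2) \<le> C * exp (- (d * (t + 1/t)))"
      "\<And>x' t. x' \<in> {x..x} \<Longrightarrow> t > 0 \<Longrightarrow> norm (W t * Kaa y x' t * (1 / of_real t)^2) \<le> C * exp (- (d * (t + 1/t)))"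
      using kernel_dominated[OF x assms(1) sW(1), of x 2] by metis
    define B where "B t = norm (complex_of_real (x^2)) * (C * exp (- (d * (t + 1/t))) + norm (wcoef \<alpha> \<nu> x) * (C * exp (- (d * (t + 1/t)))))" for t
    have gint: "(g has_integral of_real (x^2) * (integral {0<..} (f2 x) - wcoef \<alpha> \<nu> x * Kint W y x)) {0<..}"
    proof (rule has_integral_eq[where f = "\<lambda>t. of_real (x^2) * (f2 x t - wcoef \<alpha> \<nu> x * f x t)"])
      show "((\<lambda>t. of_real (x^2) * (f2 x t - wcoef \<alpha> \<nu> x * f x t)) has_integral of_real (x^2) * (integral {0<..} (f2 x) - wcoef \<alpha> \<nu> x * Kint W y x)) {0<..}"
        using integrable_integral[OF fint[OF x]]
        by (intro has_integral_mult_right has_integral_diff integrable_integral dF1 x) (simp add: Kint_def f_def[abs_def])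
    qed (simp add: g_eq)
    have "integral {0<..} g = 0"
    proof (rule integral_derivative_vanishing_ends[where F = "\<lambda>t. W t * Ka y t x - W' t * K y t x" and g = B])
      fix t :: real assume t: "t > 0"
      have "((\<lambda>t. W t * Ka y t x - W' t * K y t x) has_vector_derivative
          (W t * Kaa y t x + W' t * Ka y t x) - (W' t * Ka y t x + wcoef \<alpha> \<nu> t * W t * K y t x)) (at t)"
        by (intro has_vector_derivative_diff has_vector_derivative_mult Wd K_derivs t x assms)
      then show "((\<lambda>t. W t * Ka y t x - W' t * K y t x) has_vector_derivative g t) (at t)"
        by (rule has_vector_derivative_eq_rhs) (simp add: g_def)
      have "norm (g t) = norm (complex_of_real (x^2)) * norm (f2 x t - wcoef \<alpha> \<nu> x * f x t)"
        unfolding g_eq[OF t] norm_mult ..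
      also have "\<dots> \<le> norm (complex_of_real (x^2)) * (norm (f2 x t) + norm (wcoef \<alpha> \<nu> x) * norm (f x t))"
        by (intro mult_left_mono order.trans[OF norm_triangle_ineq4]) (auto simp: norm_mult)
      also have "\<dots> \<le> B t" unfolding B_def
        by (intro mult_left_mono add_mono) (use Cd(2)[of x t] Cd(3)[of x t] t in \<open>auto simp: f_def f2_def\<close>)
      finally show "norm (g t) \<le> B t" .
    next
      show "g integrable_on {0<..}" using gint by blast
      show "B integrable_on {0<..}" unfolding B_def
        by (intro integrable_on_mult_right integrable_add integrable_on_exp_two_ended Cd)
    next
      obtain C1 d1 where 1: "d1 > 0"
        "\<And>x' t. x' \<in> {x..x} \<Longrightarrow> t > 0 \<Longrightarrow> norm (W t * Ka y t x' * (1 / of_real t)^0) \<le> C1 * exp (- (d1 * (t + 1/t)))"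
        using kernel_dominated[OF x assms(1) sW(1), of x 0] by metis
      obtain C2 d2 where 2: "d2 > 0"
        "\<And>x' t. x' \<in> {x..x} \<Longrightarrow> t > 0 \<Longrightarrow> norm (W' t * K y x' t * (1 / of_real t)^0) \<le> C2 * exp (- (d2 * (t + 1/t)))"
        using kernel_dominated[OF x assms(1) sW(2), of x 0] by metis
      have b1: "norm (W t * Ka y t x) \<le> C1 * exp (- (d1 * (t + 1/t)))" if "t > 0" for t
        using 1(2)[of x t] that by simp
      have b2: "norm (W' t * K y t x) \<le> C2 * exp (- (d2 * (t + 1/t)))" if "t > 0" for t
        using 2(2)[of x t] that by (simp add: K_commute[of y t x])
      note l1 = tendsto_zero_exp_two_ended[OF 1(1) b1] and l2 = tendsto_zero_exp_two_ended[OF 2(1) b2]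
      show "((\<lambda>t. W t * Ka y t x - W' t * K y t x) \<longlongrightarrow> 0) (at_right 0)"
        using tendsto_diff[OF l1(1) l2(1)] by simp
      show "((\<lambda>t. W t * Ka y t x - W' t * K y t x) \<longlongrightarrow> 0) at_top"
        using tendsto_diff[OF l1(2) l2(2)] by simp
    qed
    then have "of_real (x^2) * (integral {0<..} (f2 x) - wcoef \<alpha> \<nu> x * Kint W y x) = 0"
      using gint integral_unique by metis
    then show ?thesis using x by simp
  qed
  have "whittaker_pair \<alpha> \<nu> (Kint W y) F1"
    unfolding whittaker_pair_def using dF(2) dF1(2) eq by simp
  then show ?thesis by blast
qed

end

section \<open>Laplace asymptotics\<close>

lemma cosh_ge_quadratic: "cosh (x::real) \<ge> 1 + x^2 / 2"
proof -
  let ?f = "\<lambda>n. if even n then x ^ n /\<^sub>R fact n else 0"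
  have s: "?f sums cosh x" by (rule cosh_converges)
  have "sum ?f {..<3} \<le> suminf ?f"
    using sums_summable[OF s] by (intro sum_le_suminf) (auto intro!: divide_nonneg_nonneg simp: zero_le_even_power)
  then show ?thesis using sums_unique[OF s] by (simp add: eval_nat_numeral)
qed

text \<open>The limit profile of the rescaled phase, identified with a normal density of variance
  2.\<close>

lemma has_integral_gaussian_scaled: "((\<lambda>s. exp (- (s^2) / 4)) has_integral 2 * sqrt pi) UNIV"
proof -
  have n: "normal_density 0 (sqrt 2) s = 1 / (2 * sqrt pi) * exp (- (s^2) / 4)" for s
    by (simp add: normal_density_def real_sqrt_mult)
  have "(normal_density 0 (sqrt 2) has_integral (\<integral>x. normal_density 0 (sqrt 2) x \<partial>lborel)) UNIV"
    by (rule has_integral_integral_lborel) simp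
  then have "((\<lambda>s. 2 * sqrt pi * normal_density 0 (sqrt 2) s) has_integral 2 * sqrt pi * 1) UNIV"
    by (intro has_integral_mult_right) simp
  then show ?thesis by (simp add: n)
qed

text \<open>The majorant for the rescaled integrals; it keeps half of the decay rate of the limit
  profile.\<close>

lemma integrable_gaussian_scaled: "(\<lambda>s. C * exp (- (s^2) / 8) :: real) integrable_on UNIV"
proof -
  have "(normal_density 0 2 has_integral (\<integral>x. normal_density 0 2 x \<partial>lborel)) UNIV"
    by (rule has_integral_integral_lborel) simp
  then have "((\<lambda>s. C * sqrt (8 * pi) * normal_density 0 2 s) has_integral (C * sqrt (8 * pi) * (\<integral>x. normal_density 0 2 x \<partial>lborel))) UNIV"
    by (rule has_integral_mult_right)
  moreover have "C * sqrt (8 * pi) * normal_density 0 2 s = C * exp (- (s^2) / 8)" for s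
    by (simp add: normal_density_def)
  ultimately have "((\<lambda>s. C * exp (- (s^2) / 8)) has_integral (C * sqrt (8 * pi) * (\<integral>x. normal_density 0 2 x \<partial>lborel))) UNIV"
    by (simp only:)
  then show ?thesis by blast
qed

lemma range_mult_exp:
  assumes "y > 0" "r > 0"
  shows "range (\<lambda>s::real. y * exp (s / r)) = {0<..}"
proof -
  have "t \<in> range (\<lambda>s. y * exp (s / r))" if "t > 0" for t
    using that assms by (intro image_eqI[of _ _ "r * ln (t / y)"]) auto
  then show ?thesis using assms by auto
qed

text \<open>At \<open>t = y * exp \<sigma>\<close> the first two terms of the phase combine to
  \<open>x / 2 * cosh \<sigma>\<close>. This shows both the factor \<open>exp (- x/2)\<close> and
  the concentration at \<open>\<sigma> = 0\<close>, that is at \<open>t = y\<close>.\<close>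

lemma kphi_shift:
  assumes "y > 0" "x > 0"
  shows "x / 2 - kphi y x (y * exp \<sigma>) = - (x / 2 * (cosh \<sigma> - 1)) - y * (y * exp \<sigma>) / x / 4"
  using assms by (simp add: kphi_def cosh_def exp_minus field_simps)

lemma karg_ge:
  assumes "x > 0" "t > 0" "y > 0"
  shows "karg y x t \<ge> x / 2"
proof -
  have "kphi y x t \<ge> 0" using assms by (simp add: kphi_def)
  moreover have "karg y x t = x / 2 + (kphi y x t + (t / 2 + y / 2))"
    by (simp add: karg_def add_divide_distrib)
  ultimately show ?thesis using assms by simp
qed

context kummer_profile
begin

text \<open>Asymptotics for large \<open>w\<close>, compactness for the rest. The threshold 1/2 fits
  \<open>karg \<ge> x / 2\<close> with \<open>x \<ge> 1\<close>.\<close>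

lemma v_bound:
  "\<exists>C>0. \<forall>w\<ge>1/2. norm (v w) \<le> C * w powr Re \<alpha>"
proof -
  have "eventually (\<lambda>w. norm (v w / complex_of_real w powr \<alpha>) < 2) at_top"
    using tendsto_norm[OF v_asymptotic] by (rule order_tendstoD) simp
  then obtain X where X: "\<And>w. w \<ge> X \<Longrightarrow> norm (v w / complex_of_real w powr \<alpha>) < 2"
    by (auto simp: eventually_at_top_linorder)
  have "continuous_on {1/2..X} v"
    by (rule continuous_on_has_vector_derivative[where f' = v']) (auto intro: v)
  then have "continuous_on {1/2..X} (\<lambda>w. v w / complex_of_real w powr \<alpha>)"
    by (intro continuous_intros) auto
  then have "bounded ((\<lambda>w. v w / complex_of_real w powr \<alpha>) ` {1/2..X})"
    by (intro compact_imp_bounded compact_continuous_image) auto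
  then obtain B where "\<forall>z\<in>(\<lambda>w. v w / complex_of_real w powr \<alpha>) ` {1/2..X}. norm z \<le> B"
    unfolding bounded_iff by blast
  then have B: "norm (v w / complex_of_real w powr \<alpha>) \<le> B" if "w \<in> {1/2..X}" for w
    using that by blast
  have "norm (v w) \<le> (\<bar>B\<bar> + 2) * w powr Re \<alpha>" if w: "w \<ge> 1/2" for w
  proof -
    have "norm (v w / complex_of_real w powr \<alpha>) \<le> \<bar>B\<bar> + 2"
      using X[of w] B[of w] w by (cases "w \<ge> X") auto
    moreover have "norm (complex_of_real w powr \<alpha>) = w powr Re \<alpha>"
      using w by (simp add: norm_powr_real_powr)
    ultimately show ?thesis using w by (simp add: norm_divide field_simps)
  qed
  then show ?thesis by (intro exI[of _ "\<bar>B\<bar> + 2"]) auto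
qed

text \<open>The slowly varying factor of the integrand after the substitution and division by
  \<open>wasym \<alpha> x\<close>; the phase is kept apart.\<close>

definition laplace_amplitude :: "(real \<Rightarrow> complex) \<Rightarrow> real \<Rightarrow> real \<Rightarrow> real \<Rightarrow> complex" where
  "laplace_amplitude W y x t = W t * of_real (1 / sqrt t) * (v (karg y x t) / complex_of_real x powr \<alpha>)"

text \<open>Uniformity for all \<open>x \<ge> 1\<close> holds because \<open>karg / x\<close> stays
  between 1/2 and a multiple of \<open>t + 1/t\<close>, and
  \<open>v (karg y x t) / x^\<alpha>\<close> has the size of a power of this ratio.\<close>

lemma laplace_subexp:
  assumes W: "subexp {1..} (\<lambda>_::real. W)" and y: "y > 0"
  shows "subexp {1..} (laplace_amplitude W y)"
proof -
  obtain C where C: "C > 0" "\<And>w. w \<ge> 1/2 \<Longrightarrow> norm (v w) \<le> C * w powr Re \<alpha>"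
    using v_bound by blast
  obtain N :: nat where N: "\<bar>Re \<alpha>\<bar> \<le> N" using real_arch_simple by blast
  define M where "M = y + 1/y + y + 2 + y"
  have M: "M > 0" using y by (auto simp: M_def intro!: add_pos_pos)
  have 1: "subexp {1..} (\<lambda>x t. v (karg y x t) / complex_of_real x powr \<alpha>)"
  proof (rule subexp_bound)
    show "subexp {1..} (\<lambda>(x::real) t. complex_of_real (C * 2 powr \<bar>Re \<alpha>\<bar> * (2 * M) ^ N) * complex_of_real (t + 1/t) ^ N)"
      by (intro subexp_intros subexp_linear)
    fix x t :: real assume "x \<in> {1..}" "t > 0"
    then have xt: "x \<ge> 1" "t > 0" "x > 0" by auto
    define T where "T = t + 1/t"
    have T: "t \<le> T" "1/t \<le> T" using xt by (auto simp: T_def)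
    have T1: "1 \<le> T"
    proof (cases "t \<ge> 1")
      case False
      then have "1 \<le> 1/t" using xt by simp
      then show ?thesis using T by linarith
    qed (use T in linarith)
    define r where "r = karg y x t / x"
    have w: "karg y x t \<ge> x / 2" using karg_ge xt y by simp
    have r2: "r \<ge> 1/2" using w xt by (simp add: r_def field_simps)
    have rM: "r \<le> M * T"
    proof -
      have e: "r = (y * (1/t) + 1/y * t + y * t * (1/x)^2) / 4 + (1 + t * (1/x) + y * (1/x)) / 2"
        using xt y by (simp add: r_def karg_def kphi_def field_simps power2_eq_square)
      have ix: "0 \<le> 1/x" "1/x \<le> 1" "(1/x)^2 \<le> 1" using xt by (auto simp: power_le_one)
      have "y * (1/t) \<le> y * T" "1/y * t \<le> 1/y * T" using T y by (intro mult_left_mono; simp)+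
      moreover have "y * t * (1/x)^2 \<le> y * T * 1" using T ix xt y T1 by (intro mult_mono) auto
      moreover have "t * (1/x) \<le> T * 1" "y * (1/x) \<le> y * 1" using T ix xt y T1 by (intro mult_mono; linarith)+
      moreover have "y * 1 \<le> y * T" using T1 y by (intro mult_left_mono) auto
      moreover have "0 \<le> y * T" "0 \<le> 1/y * T" using T1 y by auto
      moreover have "M * T = y * T + 1/y * T + y * T + 2 * T + y * T" by (simp add: M_def algebra_simps)
      moreover have "(a1 + a2 + a3) / 4 + (1 + a4 + a5) / 2 \<le> P + Q + P + 2 * T + P"
        if "a1 \<le> P" "a2 \<le> Q" "a3 \<le> P * 1" "a4 \<le> T * 1" "a5 \<le> y * 1" "y * 1 \<le> P" "0 \<le> P" "0 \<le> Q"
        for a1 a2 a3 a4 a5 P Q :: real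
        using that T1 unfolding add_divide_distrib by linarith
      ultimately show ?thesis unfolding e by (simp only:)
    qed
    have "norm (v (karg y x t) / complex_of_real x powr \<alpha>) \<le> (C * karg y x t powr Re \<alpha>) / x powr Re \<alpha>"
      using C(2)[of "karg y x t"] w xt by (simp add: norm_divide norm_powr_real_powr divide_right_mono)
    also have "\<dots> = C * r powr Re \<alpha>" using w xt by (simp add: r_def powr_divide)
    also have "r powr Re \<alpha> \<le> 2 powr \<bar>Re \<alpha>\<bar> * (2 * M) ^ N * T ^ N"
    proof -
      \<comment> \<open>The sign of \<open>Re \<alpha>\<close> is unknown. Passing to
        \<open>2 * r \<ge> 1\<close> makes the power increasing in its exponent, so that
        \<open>Re \<alpha>\<close> can be replaced by \<open>N\<close>.\<close>
      have "r powr Re \<alpha> = 2 powr (- Re \<alpha>) * (2 * r) powr Re \<alpha>"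
        using r2 by (simp add: powr_mult powr_minus)
      also have "\<dots> \<le> 2 powr \<bar>Re \<alpha>\<bar> * (2 * r) powr real N"
        using r2 N by (intro mult_mono powr_mono) auto
      also have "(2 * r) powr real N = (2 * r) ^ N" using r2 by (simp add: powr_realpow)
      also have "\<dots> \<le> (2 * (M * T)) ^ N" using rM r2 by (intro power_mono) auto
      also have "\<dots> = (2 * M) ^ N * T ^ N" by (simp add: power_mult_distrib mult.assoc)
      finally show ?thesis by (simp add: mult.assoc)
    qed
    finally have "norm (v (karg y x t) / complex_of_real x powr \<alpha>) \<le> C * (2 powr \<bar>Re \<alpha>\<bar> * (2 * M) ^ N * T ^ N)"
      using C(1) by simp
    also have "\<dots> = norm (complex_of_real (C * 2 powr \<bar>Re \<alpha>\<bar> * (2 * M) ^ N) * complex_of_real T ^ N)"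
    proof -
      have "complex_of_real (C * 2 powr \<bar>Re \<alpha>\<bar> * (2 * M) ^ N) * complex_of_real T ^ N = of_real (C * (2 powr \<bar>Re \<alpha>\<bar> * (2 * M) ^ N * T ^ N))"
        by (simp add: mult.assoc)
      then show ?thesis using C(1) M T1 by (simp only: norm_of_real) simp
    qed
    finally show "norm (v (karg y x t) / complex_of_real x powr \<alpha>) \<le> norm (complex_of_real (C * 2 powr \<bar>Re \<alpha>\<bar> * (2 * M) ^ N) * complex_of_real (t + 1/t) ^ N)"
      unfolding T_def .
  qed
  have 2: "subexp {1..} (\<lambda>(x::real) t. complex_of_real (1 / sqrt t))"
  proof (rule subexp_real_bound[where M = 1])
    fix t :: real assume t: "t > 0"
    have "1 / sqrt t \<le> t + 1/t"
    proof (cases "t \<ge> 1")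
      case True
      then have "1 / sqrt t \<le> 1" by simp
      moreover have "0 \<le> 1/t" using t by simp
      ultimately show ?thesis using True by linarith
    next
      case False
      have "sqrt t * sqrt t \<le> sqrt t * 1" using False t by (intro mult_left_mono) auto
      then have "t \<le> sqrt t" using t by simp
      then have "1 / sqrt t \<le> 1 / t" using t by (intro frac_le) auto
      then show ?thesis using t by linarith
    qed
    then show "norm (complex_of_real (1 / sqrt t)) \<le> 1 * (t + 1/t)" using t by (simp add: norm_divide)
  qed
  show ?thesis unfolding laplace_amplitude_def [abs_def] by (intro subexp_mult W 1 2)
qed

end

text \<open>Since \<open>cosh \<sigma> - 1\<close> behaves like \<open>\<sigma>^2 / 2\<close>, the
  scale \<open>\<sigma> = s / sqrt x\<close> gives \<open>s^2 / 4\<close>; the second term is of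
  order \<open>1 / x\<close>.\<close>

lemma laplace_exponent_limit: "((\<lambda>x::real. exp (- (x / 2 * (cosh (s / sqrt x) - 1)) - y * (y * exp (s / sqrt x)) / x / 4)) \<longlongrightarrow> exp (- (s^2) / 4)) at_top"
  unfolding cosh_def real_scaleR_def power2_eq_square by real_asymp

context kummer_profile
begin

text \<open>As \<open>t\<close> tends to \<open>y\<close>, \<open>karg / x\<close> tends to
  \<open>(1 + 1) / 4 + 1/2 = 1\<close>, so \<open>v (karg y x t)\<close> may be compared with
  \<open>x^\<alpha>\<close>.\<close>

lemma laplace_limit:
  assumes y: "y > 0" and W: "isCont W y"
  shows "((\<lambda>x. laplace_amplitude W y x (y * exp (s / sqrt x))) \<longlongrightarrow> W y * of_real (1 / sqrt y)) at_top"
proof -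
  define g where "g x = y * exp (s / sqrt x)" for x
  have g: "(g \<longlongrightarrow> y) at_top" unfolding g_def [abs_def] by real_asymp
  have gpos: "g x > 0" for x using y by (simp add: g_def)
  have 1: "((\<lambda>x. W (g x)) \<longlongrightarrow> W y) at_top"
    using isCont_tendsto_compose[OF W g] .
  have 2: "((\<lambda>x. complex_of_real (1 / sqrt (g x))) \<longlongrightarrow> of_real (1 / sqrt y)) at_top"
    using y by (intro tendsto_intros g) auto
  have r: "((\<lambda>x. karg y x (g x) / x) \<longlongrightarrow> 1) at_top"
  proof -
    have i: "((\<lambda>x::real. 1 / x) \<longlongrightarrow> 0) at_top" by real_asymp
    have "((\<lambda>x. (y / g x + g x / y + y * g x * (1/x)^2) / 4 + (1 + g x * (1/x) + y * (1/x)) / 2) \<longlongrightarrow>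
      (y / y + y / y + y * y * 0^2) / 4 + (1 + y * 0 + y * 0) / 2) at_top"
      using y by (intro tendsto_intros g i) auto
    moreover have "eventually (\<lambda>x. (y / g x + g x / y + y * g x * (1/x)^2) / 4 + (1 + g x * (1/x) + y * (1/x)) / 2 = karg y x (g x) / x) at_top"
      using eventually_gt_at_top[of 0]
    proof eventually_elim
      case (elim x)
      then show ?case using gpos[of x] y
        by (simp add: karg_def kphi_def field_simps power2_eq_square)
    qed
    ultimately show ?thesis using y by (simp add: tendsto_cong)
  qed
  have 3: "((\<lambda>x. v (karg y x (g x)) / complex_of_real x powr \<alpha>) \<longlongrightarrow> 1) at_top"
  proof -
    have "filterlim (\<lambda>x. karg y x (g x)) at_top at_top"
    proof (rule filterlim_at_top_mono)
      show "filterlim (\<lambda>x::real. x / 2) at_top at_top" by real_asymp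
      show "eventually (\<lambda>x. x / 2 \<le> karg y x (g x)) at_top"
        using eventually_gt_at_top[of 0] by eventually_elim (rule karg_ge[OF _ gpos y])
    qed
    from filterlim_compose[OF v_asymptotic this]
    have "((\<lambda>x. v (karg y x (g x)) / complex_of_real (karg y x (g x)) powr \<alpha>) \<longlongrightarrow> 1) at_top" .
    moreover have "((\<lambda>x. complex_of_real (karg y x (g x) / x) powr \<alpha>) \<longlongrightarrow> of_real 1 powr \<alpha>) at_top"
      by (intro tendsto_powr_complex tendsto_of_real[OF r] tendsto_const) (auto simp: complex_nonpos_Reals_iff)
    ultimately have "((\<lambda>x. v (karg y x (g x)) / complex_of_real (karg y x (g x)) powr \<alpha> * complex_of_real (karg y x (g x) / x) powr \<alpha>) \<longlongrightarrow> 1 * of_real 1 powr \<alpha>) at_top"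
      by (rule tendsto_mult)
    moreover have "eventually (\<lambda>x. v (karg y x (g x)) / complex_of_real (karg y x (g x)) powr \<alpha> * complex_of_real (karg y x (g x) / x) powr \<alpha> = v (karg y x (g x)) / complex_of_real x powr \<alpha>) at_top"
      using eventually_gt_at_top[of 0]
    proof eventually_elim
      case (elim x)
      have w: "karg y x (g x) > 0" using karg_pos elim gpos y by blast
      have "complex_of_real (karg y x (g x)) powr \<alpha> = complex_of_real x powr \<alpha> * complex_of_real (karg y x (g x) / x) powr \<alpha>"
        using w elim by (simp add: of_real_powr_exp_ln ln_div exp_add[symmetric] algebra_simps del: of_real_divide)
      moreover have "complex_of_real (karg y x (g x) / x) powr \<alpha> \<noteq> 0" "complex_of_real x powr \<alpha> \<noteq> 0" using w elim by auto
      ultimately show ?case by (simp only:) (simp add: field_simps del: of_real_divide)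
    qed
    ultimately show ?thesis by (simp add: tendsto_cong)
  qed
  have "((\<lambda>x. laplace_amplitude W y x (g x)) \<longlongrightarrow> W y * of_real (1 / sqrt y) * 1) at_top"
    unfolding laplace_amplitude_def by (intro tendsto_mult 1 2 3)
  then show ?thesis by (simp add: g_def)
qed

lemma Kint_change_of_variables:
  assumes "x > 0" "y > 0" and W: "continuous_on {0<..} W" "\<And>S. subexp S (\<lambda>_::real. W)"
  defines "h \<equiv> \<lambda>s. laplace_amplitude W y x (y * exp (s / sqrt x)) *
     of_real (exp (- (x / 2 * (cosh (s / sqrt x) - 1)) - y * (y * exp (s / sqrt x)) / x / 4))"
  shows "h integrable_on UNIV" "Kint W y x / wasym \<alpha> x = integral UNIV h"
proof -
  define f where "f t = W t * K y x t * (1 / of_real t)^2" for t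
  define g where "g s = y * exp (s / sqrt x)" for s
  have img: "range g = {0<..}" unfolding g_def [abs_def] using range_mult_exp[of y "sqrt x"] assms by simp
  have inj: "inj g" using assms by (auto simp: inj_def g_def)
  have dg: "(g has_field_derivative g s / sqrt x) (at s)" for s
  proof -
    have "((\<lambda>s. y * exp (s / sqrt x)) has_field_derivative y * (exp (s / sqrt x) * (1 / sqrt x))) (at s)"
      by (intro DERIV_cmult DERIV_fun_exp DERIV_cdivide DERIV_ident)
    then show ?thesis by (simp add: g_def[abs_def])
  qed
  have fi: "f absolutely_integrable_on {0<..}"
    unfolding f_def [abs_def] by (rule kernel_integrand_integrable[OF assms(1,2) W])
  have "(\<lambda>s. \<bar>g s / sqrt x\<bar> *\<^sub>R f (g s)) absolutely_integrable_on UNIV \<and>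
      integral UNIV (\<lambda>s. \<bar>g s / sqrt x\<bar> *\<^sub>R f (g s)) = Kint W y x"
    by (subst has_absolute_integral_change_of_variables_real[where g = g])
       (use dg inj img fi in \<open>auto simp: Kint_def f_def[abs_def]\<close>)
  then have "((\<lambda>s. \<bar>g s / sqrt x\<bar> *\<^sub>R f (g s)) has_integral Kint W y x) UNIV"
    using set_lebesgue_integral_eq_integral(1) integrable_integral by metis
  then have "((\<lambda>s. 1 / wasym \<alpha> x * (\<bar>g s / sqrt x\<bar> *\<^sub>R f (g s))) has_integral 1 / wasym \<alpha> x * Kint W y x) UNIV"
    by (rule has_integral_mult_right)
  moreover have "1 / wasym \<alpha> x * (\<bar>g s / sqrt x\<bar> *\<^sub>R f (g s)) = h s" for s
  proof -
    define t where "t = g s"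
    have t: "t > 0" using assms by (simp add: t_def g_def)
    have tt: "t = y * exp (s / sqrt x)" by (simp add: t_def g_def)
    \<comment> \<open>Jacobian, weight and the root in \<open>kpre\<close> combine to
      \<open>1 / sqrt t\<close>, with all powers of \<open>x\<close> cancelling.\<close>
    have r: "t / sqrt x * (1/t)^2 * kpre y x t = 1 / sqrt t * exp (- kphi y x t)"
    proof -
      have "sqrt x \<noteq> 0" "sqrt t * sqrt t = t" "sqrt t \<noteq> 0" using t assms by auto
      then have "t / sqrt x * (1/t)^2 * kpre y x t = (sqrt t * sqrt t) / sqrt x * (1/(sqrt t * sqrt t))^2 * (sqrt x * sqrt t * exp (- kphi y x t))"
        by (simp only: kpre_def real_sqrt_mult)
      also have "\<dots> = 1 / sqrt t * exp (- kphi y x t)"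
        using \<open>sqrt x \<noteq> 0\<close> \<open>sqrt t \<noteq> 0\<close> by (simp add: power2_eq_square divide_simps del: real_sqrt_mult_self)
      finally show ?thesis .
    qed
    have e: "exp (- complex_of_real x / 2) = of_real (exp (- x/2))" by (simp flip: exp_of_real)
    have e2: "exp (- kphi y x t) = exp (- x/2) * exp (x / 2 - kphi y x t)"
      unfolding exp_add[symmetric] by simp
    have "\<bar>t / sqrt x\<bar> *\<^sub>R f t = of_real (t / sqrt x * (1/t)^2 * kpre y x t) * (W t * v (karg y x t))"
      using t assms by (simp add: f_def K_def scaleR_conv_of_real)
    also have "\<dots> = of_real (exp (- x/2)) * (of_real (1 / sqrt t) * of_real (exp (x / 2 - kphi y x t)) * (W t * v (karg y x t)))"
      unfolding r e2 by simp
    finally have "1 / wasym \<alpha> x * (\<bar>t / sqrt x\<bar> *\<^sub>R f t) = 1 / (complex_of_real x powr \<alpha>) * (of_real (1 / sqrt t) * of_real (exp (x / 2 - kphi y x t)) * (W t * v (karg y x t)))"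
      unfolding wasym_def e by simp
    also have "\<dots> = laplace_amplitude W y x t * of_real (exp (x / 2 - kphi y x t))"
    proof -
      have "1 / P * (R * E * (z * V)) = z * R * (V / P) * E" for P R E z V :: complex by simp
      then show ?thesis unfolding laplace_amplitude_def .
    qed
    also have "\<dots> = h s"
      unfolding h_def tt kphi_shift[OF assms(2,1)] ..
    finally show ?thesis by (simp add: t_def)
  qed
  ultimately have "(h has_integral 1 / wasym \<alpha> x * Kint W y x) UNIV" by simp
  then show "h integrable_on UNIV" "Kint W y x / wasym \<alpha> x = integral UNIV h"
    by (auto simp: integral_unique)
qed

lemma Kint_asymptotic:
  assumes y: "y > 0" and W: "continuous_on {0<..} W" "\<And>S. subexp S (\<lambda>_::real. W)"
  shows "((\<lambda>x. Kint W y x / wasym \<alpha> x) \<longlongrightarrow> W y * of_real (1 / sqrt y) * of_real (2 * sqrt pi)) at_top"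
proof -
  define h where "h x s = laplace_amplitude W y x (y * exp (s / sqrt x)) *
     of_real (exp (- (x / 2 * (cosh (s / sqrt x) - 1)) - y * (y * exp (s / sqrt x)) / x / 4))" for x s
  have hx: "h x integrable_on UNIV" "Kint W y x / wasym \<alpha> x = integral UNIV (h x)" if "x > 0" for x
    unfolding h_def [abs_def] using Kint_change_of_variables[OF that y W] by auto
  define Y where "Y = max y (1/y)"
  have Y: "Y > 0" "y \<le> Y" "1/y \<le> Y" using y by (auto simp: Y_def)
  \<comment> \<open>The rate is set so that \<open>t + 1/t \<le> 2 * Y * cosh \<sigma>\<close> makes
    the amplitude at most \<open>C * exp (1/4 + c/4)\<close> with
    \<open>c = cosh \<sigma> - 1\<close>. For \<open>x \<ge> 1\<close> this uses up at most half of
    the decay \<open>exp (- x * c / 2)\<close>.\<close>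
  obtain C where C: "C > 0" "\<And>x t. x \<in> {1..} \<Longrightarrow> t > 0 \<Longrightarrow> norm (laplace_amplitude W y x t) \<le> C * exp (1 / (8 * Y) * (t + 1/t))"
    using subexpD[OF laplace_subexp[OF W(2) y], of "1 / (8 * Y)"] Y by auto
  have bnd: "norm (h x s) \<le> C * exp (1/4) * exp (- (s^2) / 8)" if x: "x \<ge> 1" for x s
  proof -
    define \<sigma> where "\<sigma> = s / sqrt x"
    define c where "c = cosh \<sigma> - 1"
    have c: "c \<ge> \<sigma>^2 / 2" using cosh_ge_quadratic[of \<sigma>] by (simp add: c_def)
    then have c0: "c \<ge> 0" using zero_le_power2[of \<sigma>] by linarith
    define t where "t = y * exp \<sigma>"
    have t: "t > 0" using y by (simp add: t_def)
    have "t + 1/t \<le> Y * exp \<sigma> + Y * exp (- \<sigma>)"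
    proof (rule add_mono)
      show "t \<le> Y * exp \<sigma>" unfolding t_def using Y by (intro mult_right_mono) auto
      have "1/t = 1/y * exp (- \<sigma>)" by (simp add: t_def exp_minus divide_inverse)
      then show "1/t \<le> Y * exp (- \<sigma>)" using Y(3) mult_right_mono[of "1/y" Y "exp (- \<sigma>)"] by simp
    qed
    also have "\<dots> = 2 * Y * (1 + c)" by (simp add: c_def cosh_def algebra_simps)
    finally have "1 / (8 * Y) * (t + 1/t) \<le> 1 / (8 * Y) * (2 * Y * (1 + c))"
      using Y by (intro mult_left_mono) auto
    also have "\<dots> = 1/4 + c/4" using Y by (simp add: field_simps)
    finally have l: "norm (laplace_amplitude W y x t) \<le> C * exp (1/4 + c/4)"
      using C(2)[of x t] x t C(1) by (smt (verit) atLeast_iff exp_le_cancel_iff mult_left_mono)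
    \<comment> \<open>The remaining decay is \<open>exp (- x * c / 4)\<close>, and
      \<open>x * c \<ge> s^2 / 2\<close> turns it into \<open>exp (- s^2 / 8)\<close>.\<close>
    have "c * 1 \<le> c * x" using x c0 by (intro mult_left_mono) auto
    moreover have "c * x \<ge> s^2 / 2"
    proof -
      have "\<sigma>^2 / 2 * x \<le> c * x" using c x by (intro mult_right_mono) auto
      moreover have "\<sigma>^2 * x = s^2" using x by (simp add: \<sigma>_def power_divide)
      ultimately show ?thesis by simp
    qed
    moreover have "y * t / x / 4 \<ge> 0" using y t x by auto
    ultimately have "1/4 + c/4 + (- (x / 2 * c) - y * t / x / 4) \<le> 1/4 + (- (s^2) / 8)" by (simp add: mult.commute)
    then have ex: "exp (1/4 + c/4) * exp (- (x / 2 * c) - y * t / x / 4) \<le> exp (1/4) * exp (- (s^2) / 8)"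
      unfolding exp_add[symmetric] by simp
    have "norm (h x s) = norm (laplace_amplitude W y x t) * exp (- (x / 2 * c) - y * t / x / 4)"
      unfolding h_def \<sigma>_def[symmetric] c_def[symmetric] t_def[symmetric] norm_mult by simp
    also have "\<dots> \<le> C * exp (1/4 + c/4) * exp (- (x / 2 * c) - y * t / x / 4)"
      using l by (intro mult_right_mono) auto
    also have "\<dots> \<le> C * (exp (1/4) * exp (- (s^2) / 8))"
      unfolding mult.assoc using ex C(1) by (intro mult_left_mono) auto
    finally show ?thesis by (simp add: mult.assoc)
  qed
  have "((\<lambda>x. integral UNIV (h x)) \<longlongrightarrow> integral UNIV (\<lambda>s. W y * of_real (1 / sqrt y) * of_real (exp (- (s^2) / 4)))) at_top"
  proof (rule dominated_convergence_real_at_top[where xmin = 1 and h = "\<lambda>s. C * exp (1/4) * exp (- (s^2) / 8)"])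
    show "(\<lambda>s. C * exp (1/4) * exp (- (s^2) / 8)) integrable_on UNIV" by (rule integrable_gaussian_scaled)
    show "((\<lambda>x. h x s) \<longlongrightarrow> W y * of_real (1 / sqrt y) * of_real (exp (- (s^2) / 4))) at_top" for s
      unfolding h_def
    proof (rule tendsto_mult)
      show "((\<lambda>x. laplace_amplitude W y x (y * exp (s / sqrt x))) \<longlongrightarrow> W y * of_real (1 / sqrt y)) at_top"
        using W(1) y by (intro laplace_limit y) (auto simp: continuous_on_eq_continuous_at)
    qed (rule tendsto_of_real[OF laplace_exponent_limit])
  qed (use hx bnd in auto)
  moreover have "integral UNIV (\<lambda>s. W y * of_real (1 / sqrt y) * of_real (exp (- (s^2) / 4))) = W y * of_real (1 / sqrt y) * of_real (2 * sqrt pi)"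
    by (intro integral_unique has_integral_mult_right has_integral_of_real has_integral_gaussian_scaled)
  moreover have "eventually (\<lambda>x. integral UNIV (h x) = Kint W y x / wasym \<alpha> x) at_top"
    using eventually_gt_at_top[of 0] by eventually_elim (simp add: hx)
  ultimately show ?thesis by (simp only: tendsto_cong)
qed

end

text \<open>With \<open>y\<close> fixed, both sides solve the same equation in \<open>x\<close>, and
  the constant makes their ratios to \<open>wasym \<alpha> x\<close> tend to the same limit
  \<open>W y\<close>; the difference is therefore recessive to higher order and vanishes.\<close>

lemma (in kummer_profile) whittaker_product:
  assumes "x > 0" "y > 0" and W: "recessive_pair \<alpha> \<nu> W W'"
  shows "of_real (sqrt y / (2 * sqrt pi)) * Kint W y x = W x * W y"
proof -
  have wp: "whittaker_pair \<alpha> \<nu> W W'" "((\<lambda>x. W x / wasym \<alpha> x) \<longlongrightarrow> 1) at_top"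
    using W by (auto simp: recessive_pair_def)
  have cW: "continuous_on {0<..} W"
    by (rule continuous_on_has_vector_derivative[where f' = W']) (use whittaker_pairD[OF wp(1)] in auto)
  obtain F' where F': "whittaker_pair \<alpha> \<nu> (Kint W y) F'"
    using Kint_solves_whittaker[OF assms(2) W] by blast
  define c where "c = complex_of_real (sqrt y / (2 * sqrt pi))"
  define d where "d x = c * Kint W y x - W y * W x" for x
  have "whittaker_pair \<alpha> \<nu> d (\<lambda>x. c * F' x - W y * W' x)"
    unfolding whittaker_pair_def
  proof (intro allI impI conjI)
    fix x :: real assume x: "x > 0"
    show "(d has_vector_derivative c * F' x - W y * W' x) (at x)"
      unfolding d_def [abs_def]
      by (intro has_vector_derivative_diff has_vector_derivative_mult_right whittaker_pairD[OF F' x] whittaker_pairD[OF wp(1) x])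
    have "((\<lambda>x. c * F' x - W y * W' x) has_vector_derivative c * (wcoef \<alpha> \<nu> x * Kint W y x) - W y * (wcoef \<alpha> \<nu> x * W x)) (at x)"
      by (intro has_vector_derivative_diff has_vector_derivative_mult_right whittaker_pairD[OF F' x] whittaker_pairD[OF wp(1) x])
    then show "((\<lambda>x. c * F' x - W y * W' x) has_vector_derivative wcoef \<alpha> \<nu> x * d x) (at x)"
      by (rule has_vector_derivative_eq_rhs) (simp add: d_def algebra_simps)
  qed
  moreover have "((\<lambda>x. d x / wasym \<alpha> x) \<longlongrightarrow> 0) at_top"
  proof -
    have "((\<lambda>x. c * (Kint W y x / wasym \<alpha> x) - W y * (W x / wasym \<alpha> x)) \<longlongrightarrow>
       c * (W y * of_real (1 / sqrt y) * of_real (2 * sqrt pi)) - W y * 1) at_top"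
      by (intro tendsto_intros Kint_asymptotic assms cW recessive_pair_subexp[OF W] wp(2))
    moreover have "c * (W y * of_real (1 / sqrt y) * of_real (2 * sqrt pi)) = W y"
      using assms by (simp add: c_def)
    ultimately show ?thesis by (simp add: d_def[abs_def] diff_divide_distrib)
  qed
  ultimately have "d x = 0"
    by (rule whittaker_pair_small_eq_0[OF W _ _ assms(1)])
  then show ?thesis by (simp add: d_def c_def mult.commute)
qed

section \<open>Identification of the kernel and conclusion\<close>

lemma karg_square:
  assumes "x > 0" "y > 0" "\<xi> > 0"
  shows "karg y x \<xi> = (x*y + x*\<xi> + y*\<xi>)^2 / (4*x*y*\<xi>)"
  using assms by (simp add: karg_def kphi_def field_simps power2_eq_square)

lemma kernel_k_eq:
  assumes "kummer_profile alpha v v' v''"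
    and vW: "\<And>w. w > 0 \<Longrightarrow> v w = of_real (exp (w/2) * w powr (-1/4)) * whittakerW (alpha + 1/4) (1/4) w"
    and pos: "x > 0" "y > 0" "\<xi> > 0"
  shows "kernel_k alpha x y \<xi> = of_real (sqrt y / (2 * sqrt pi)) * kummer_profile.K v y x \<xi>"
proof -
  interpret kummer_profile alpha v v' v'' by fact
  define w where "w = karg y x \<xi>"
  define W where "W = whittakerW (alpha + 1/4) (1/4) w"
  define z where "z = (x*y + x*\<xi> + y*\<xi>) / sqrt (2*x*y*\<xi>)"
  have w: "w > 0" unfolding w_def by (rule karg_pos[OF pos(1,3,2)])
  have weq: "(x*y + x*\<xi> + y*\<xi>)^2 / (8*x*y*\<xi>) = w / 2"
    unfolding w_def karg_square[OF pos] by simp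
  have num: "x*y + x*\<xi> + y*\<xi> > 0" using pos by (intro add_pos_pos) auto
  have z2: "z^2 = 2 * w"
    using pos unfolding z_def w_def karg_square[OF pos] by (simp add: power_divide)
  have z: "z > 0" using pos num by (simp add: z_def)
  \<comment> \<open>From \<open>z^2 = 2 * w\<close>: the power of \<open>z\<close> in the parabolic
    cylinder function becomes the factor \<open>w^(-1/4)\<close> of \<open>v\<close>, up to a power
    of 2.\<close>
  have zw: "z powr (-1/2) = 2 powr (-1/4) * w powr (-1/4)"
  proof -
    have "z = (2 * w) powr (1/2)" using z z2 by (metis less_imp_le powr_half_sqrt real_sqrt_unique zero_le_power2)
    then have "z powr (-1/2) = (2 * w) powr (-1/4)" by (simp add: powr_powr)
    then show ?thesis by (simp add: powr_mult)
  qed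
  have D: "parabolicD (2 * alpha) z = 2 powr (alpha + 1/4) * of_real (2 powr (-1/4) * w powr (-1/4)) * W"
  proof -
    have "complex_of_real z powr (-1/2) = of_real (z powr (-1/2))"
      using powr_of_real[of z "-1/2"] z by simp
    then show ?thesis unfolding parabolicD_def z2 W_def zw by simp
  qed
  \<comment> \<open>The powers of 2 come from the kernel, from the parabolic cylinder function and
    from \<open>z^2 = 2 * w\<close>; together they give the 1/2 in
    \<open>sqrt y / (2 * sqrt pi)\<close>.\<close>
  have two: "(2::complex) powr (-1 - alpha) * 2 powr (alpha + 1/4) * of_real (2 powr (-1/4)) = 1/2"
  proof -
    have "complex_of_real (2 powr (-1/4)) = 2 powr (-1/4)"
      using powr_of_real[of 2 "-1/4"] by simp
    then have "(2::complex) powr (-1 - alpha) * 2 powr (alpha + 1/4) * of_real (2 powr (-1/4)) = 2 powr (-1)"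
      by (simp only: powr_add[symmetric]) simp
    then show ?thesis by (simp add: powr_minus inverse_eq_divide)
  qed
  \<comment> \<open>Splits off \<open>exp (w/2)\<close>, which \<open>v\<close> absorbs together
    with the decay of the Whittaker function in \<open>parabolicD\<close>.\<close>
  have ex: "exp (x/2 + y/2 + \<xi>/2 - w/2) = exp (- kphi y x \<xi>) * exp (w/2)"
  proof -
    have "w = kphi y x \<xi> + (x/2 + \<xi>/2 + y/2)" by (simp add: w_def karg_def add_divide_distrib)
    then have "x/2 + y/2 + \<xi>/2 - w/2 = - kphi y x \<xi> + w/2" by linarith
    then show ?thesis unfolding exp_add[symmetric] by (simp only:)
  qed
  have sq: "sqrt (x*y*\<xi>) = sqrt y * sqrt (x*\<xi>)" by (simp add: real_sqrt_mult)
  have "kernel_k alpha x y \<xi> = 2 powr (-1 - alpha) * of_real (1 / sqrt pi) * of_real (sqrt y * sqrt (x*\<xi>))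
      * of_real (exp (- kphi y x \<xi>) * exp (w/2)) * (2 powr (alpha + 1/4) * of_real (2 powr (-1/4) * w powr (-1/4)) * W)"
    unfolding kernel_k_def weq z_def[symmetric] D ex sq ..
  also have "\<dots> = (2 powr (-1 - alpha) * 2 powr (alpha + 1/4) * of_real (2 powr (-1/4))) * (of_real (sqrt y) * of_real (1 / sqrt pi))
      * (of_real (kpre y x \<xi>) * (of_real (exp (w/2) * w powr (-1/4)) * W))"
  proof -
    have "A * B * (Y * X) * (E * F) * (C * (T * P) * W) = (A * C * T) * (Y * B) * ((X * E) * ((F * P) * W))"
      for A B C X Y E F T P :: complex by (simp add: mult_ac)
    then show ?thesis unfolding kpre_def of_real_mult .
  qed
  also have "\<dots> = of_real (sqrt y / (2 * sqrt pi)) * K y x \<xi>"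
    unfolding two K_def w_def[symmetric] vW[OF w] W_def by simp
  finally show ?thesis .
qed

theorem theorem3p1:
  fixes x y :: real and alpha nu :: complex
  assumes "x > 0" and "y > 0"
  shows "((\<lambda>\<xi>. whittakerW alpha nu \<xi> * kernel_k alpha x y \<xi> / complex_of_real (\<xi>^2))
           has_integral (whittakerW alpha nu x * whittakerW alpha nu y)) {0<..}"
proof -
  obtain v v' v'' where kp: "kummer_profile alpha v v' v''"
    and vW: "\<And>w. w > 0 \<Longrightarrow> v w = of_real (exp (w/2) * w powr (-1/4)) * whittakerW (alpha + 1/4) (1/4) w"
    using kummer_profile_exists[of alpha] by blast
  interpret kummer_profile alpha v v' v'' by (rule kp)
  obtain W' where rp: "recessive_pair alpha nu (whittakerW alpha nu) W'"
    by (rule recessive_pair_whittakerW)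
  define W where "W = whittakerW alpha nu"
  note rp = rp[folded W_def]
  have cW: "continuous_on {0<..} W"
    by (rule continuous_on_has_vector_derivative[where f' = W'])
       (use rp in \<open>auto simp: recessive_pair_def whittaker_pair_def\<close>)
  have "((\<lambda>t. W t * K y x t * (1 / of_real t)^2) has_integral Kint W y x) {0<..}"
    unfolding Kint_def
    by (rule integrable_integral[OF set_lebesgue_integral_eq_integral(1)[OF
          kernel_integrand_integrable[OF assms cW recessive_pair_subexp(1)[OF rp]]]])
  then have "((\<lambda>t. of_real (sqrt y / (2 * sqrt pi)) * (W t * K y x t * (1 / of_real t)^2)) has_integral
      of_real (sqrt y / (2 * sqrt pi)) * Kint W y x) {0<..}"
    by (rule has_integral_mult_right)
  then have "((\<lambda>t. of_real (sqrt y / (2 * sqrt pi)) * (W t * K y x t * (1 / of_real t)^2)) has_integral W x * W y) {0<..}"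
    unfolding whittaker_product[OF assms rp] .
  then have "((\<lambda>\<xi>. W \<xi> * kernel_k alpha x y \<xi> / complex_of_real (\<xi>^2)) has_integral W x * W y) {0<..}"
  proof (rule has_integral_eq[rotated])
    fix t :: real assume "t \<in> {0<..}"
    then have t: "t > 0" by simp
    have k: "kernel_k alpha x y t = of_real (sqrt y / (2 * sqrt pi)) * K y x t"
      by (rule kernel_k_eq[OF kp _ assms t]) (rule vW)
    have "c * (z * k * (1 / T)^2) = z * (c * k) / T^2" for c z k T :: complex
      by (simp add: power_divide)
    then show "of_real (sqrt y / (2 * sqrt pi)) * (W t * K y x t * (1 / of_real t)^2) =
        W t * kernel_k alpha x y t / complex_of_real (t^2)"
      unfolding k of_real_power .
  qed
  then show ?thesis by (simp add: W_def)
qed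

end
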